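(* Let $\mathbb{K}$ be $\mathbb{R}$ or $\mathbb{C}$. Every finite-dimensional C*-algebra over $\mathbb{K}$ is computably categorical as a C*-algebra over $\mathbb{K}$.
   Context: A C*-algebra over $\mathbb{K}\in\{\mathbb{R},\mathbb{C}\}$ is a Banach *-algebra over $\mathbb{K}$ (not necessarily unital) that is isometrically *-isomorphic to a norm-closed *-subalgebra of the bounded operators on a Hilbert space over $\mathbb{K}$. *-homomorphisms are $\mathbb{K}$-linear. A presentation $A^\dagger=(A,\overline{a})$ of a separable C*-algebra $A$ over $\mathbb{K}$ consists of $A$ and a countable (finite or infinite) sequence $\overline{a}$ of elements (the special points) generating $A$ as a C*-algebra over $\mathbb{K}$. A polynomial is rational if its coefficients lie in $\mathbb{Q}$ (when $\mathbb{K}=\mathbb{R}$) or $\mathbb{Q}(i)$ (when $\mathbb{K}=\mathbb{C}$). A rational point of $A^\dagger$ is an element $p(a_{i_1},\ldots,a_{i_n})$ with $p$ a rational noncommutative *-polynomial with no constant term (as input to an algorithm it is given by $p$ and the indices). $A^\dagger$ is computable if there is an effective procedure which, given a rational point $r$ and $k\in\mathbb{N}$, returns $q\in\mathbb{Q}$ with $|\|r\|-q|<2^{-k}$. For computable presentations $A^\dagger$, $B^\dagger$ of $A$, $B$, a *-homomorphism $\varphi:A\to B$ is computable from $A^\dagger$ to $B^\dagger$ if there is an effective procedure which, given a rational point $r$ of $A^\dagger$ and $k\in\mathbb{N}$, returns a rational point $s$ of $B^\dagger$ with $\|\varphi(r)-s\|<2^{-k}$. A computable isomorphism is a bijective computable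 *-homomorphism. $A$ is computably categorical (as a C*-algebra over $\mathbb{K}$) if for all computable presentations $A^\dagger$, $A^+$ of $A$ there is a computable isomorphism from $A^\dagger$ to $A^+$. *)

theory Defs
  imports "HOL-Analysis.Analysis" "HOL-Library.Nat_Bijection" "HOL-Library.Extended_Nat"
begin

section \<open>Algebras over a subfield of the complex numbers\<close>

text \<open>
  The two ground fields are treated uniformly as subsets of \<^typ>\<open>complex\<close>: the real case is
  \<open>K = \<real>\<close> and the complex case is \<open>K = UNIV\<close>. Scalar multiplication is a map
  \<open>sc :: complex \<Rightarrow> 'a \<Rightarrow> 'a\<close> of which only the values at scalars in \<open>K\<close> are ever constrained or used.
  Every space over either field is in particular a real normed space, so the additive, metric and
  multiplicative structure is taken from the type classes, and \<open>sc\<close> extends \<open>(*\<^sub>R)\<close>.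
\<close>

locale normed_space_over =
  fixes K :: "complex set" and sc :: "complex \<Rightarrow> 'a::real_normed_vector \<Rightarrow> 'a"
  assumes sc_of_real: "sc (complex_of_real r) x = r *\<^sub>R x"
    and sc_add_right: "c \<in> K \<Longrightarrow> sc c (x + y) = sc c x + sc c y"
    and sc_add_left: "c \<in> K \<Longrightarrow> d \<in> K \<Longrightarrow> sc (c + d) x = sc c x + sc d x"
    and sc_sc: "c \<in> K \<Longrightarrow> d \<in> K \<Longrightarrow> sc c (sc d x) = sc (c * d) x"
    and norm_sc: "c \<in> K \<Longrightarrow> norm (sc c x) = cmod c * norm x"

definition finite_dimensional_over ::
  "complex set \<Rightarrow> (complex \<Rightarrow> 'a::real_normed_vector \<Rightarrow> 'a) \<Rightarrow> bool" where
  "finite_dimensional_over K sc \<longleftrightarrow>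
     (\<exists>B. finite B \<and> (\<forall>x. \<exists>u. (\<forall>b\<in>B. u b \<in> K) \<and> x = (\<Sum>b\<in>B. sc (u b) b)))"

locale banach_star_algebra = normed_space_over K sc
  for K :: "complex set"
  and sc :: "complex \<Rightarrow> 'a::{real_normed_algebra, banach} \<Rightarrow> 'a" +
  fixes star :: "'a \<Rightarrow> 'a"
  assumes sc_mult_left: "c \<in> K \<Longrightarrow> sc c x * y = sc c (x * y)"
    and sc_mult_right: "c \<in> K \<Longrightarrow> x * sc c y = sc c (x * y)"
    and star_add: "star (x + y) = star x + star y"
    and star_sc: "c \<in> K \<Longrightarrow> star (sc c x) = sc (cnj c) (star x)"
    and star_mult: "star (x * y) = star y * star x"
    and star_star: "star (star x) = x"
    and norm_star: "norm (star x) = norm x"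

locale hilbert_space_over = normed_space_over K sc
  for K :: "complex set" and sc :: "complex \<Rightarrow> 'h::banach \<Rightarrow> 'h" +
  fixes ip :: "'h \<Rightarrow> 'h \<Rightarrow> complex"
  assumes ip_in: "ip x y \<in> K"
    and ip_add: "ip (x + y) z = ip x z + ip y z"
    and ip_sc: "c \<in> K \<Longrightarrow> ip (sc c x) y = c * ip x y"
    and ip_commute: "ip y x = cnj (ip x y)"
    and ip_self: "ip x x = complex_of_real ((norm x)\<^sup>2)"

section \<open>C*-algebras\<close>

definition bounded_operators ::
  "complex set \<Rightarrow> (complex \<Rightarrow> 'h::real_normed_vector \<Rightarrow> 'h) \<Rightarrow> ('h \<Rightarrow>\<^sub>L 'h) set" where
  "bounded_operators K sc =
     {T. \<forall>c\<in>K. \<forall>x. blinfun_apply T (sc c x) = sc c (blinfun_apply T x)}"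

definition is_scaled_operator ::
  "(complex \<Rightarrow> 'h::real_normed_vector \<Rightarrow> 'h) \<Rightarrow> complex \<Rightarrow> ('h \<Rightarrow>\<^sub>L 'h) \<Rightarrow> ('h \<Rightarrow>\<^sub>L 'h) \<Rightarrow> bool" where
  "is_scaled_operator sc c T T' \<longleftrightarrow> (\<forall>x. blinfun_apply T' x = sc c (blinfun_apply T x))"

definition is_adjoint_operator ::
  "('h::real_normed_vector \<Rightarrow> 'h \<Rightarrow> complex) \<Rightarrow> ('h \<Rightarrow>\<^sub>L 'h) \<Rightarrow> ('h \<Rightarrow>\<^sub>L 'h) \<Rightarrow> bool" where
  "is_adjoint_operator ip T T' \<longleftrightarrow>
     (\<forall>x y. ip (blinfun_apply T x) y = ip x (blinfun_apply T' y))"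

definition closed_operator_star_subalgebra ::
  "complex set \<Rightarrow> (complex \<Rightarrow> 'h::real_normed_vector \<Rightarrow> 'h) \<Rightarrow> ('h \<Rightarrow> 'h \<Rightarrow> complex)
     \<Rightarrow> ('h \<Rightarrow>\<^sub>L 'h) set \<Rightarrow> bool" where
  "closed_operator_star_subalgebra K sc ip S \<longleftrightarrow>
     S \<subseteq> bounded_operators K sc \<and> closed S \<and> 0 \<in> S \<and>
     (\<forall>T\<in>S. \<forall>U\<in>S. T + U \<in> S) \<and>
     (\<forall>c\<in>K. \<forall>T\<in>S. \<exists>T'\<in>S. is_scaled_operator sc c T T') \<and>
     (\<forall>T\<in>S. \<forall>U\<in>S. T o\<^sub>L U \<in> S) \<and>
     (\<forall>T\<in>S. \<exists>T'\<in>S. is_adjoint_operator ip T T')"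

text \<open>
  HOL cannot quantify existentially over the type of the Hilbert space, so that type is a parameter
  of the notion of C*-algebra. A theorem with \<open>cstar_algebra K sc star TYPE('h)\<close> as a hypothesis and
  \<open>'h\<close> a type variable covers representations on arbitrary Hilbert spaces.
\<close>

definition cstar_algebra ::
  "complex set \<Rightarrow> (complex \<Rightarrow> 'a::{real_normed_algebra, banach} \<Rightarrow> 'a) \<Rightarrow> ('a \<Rightarrow> 'a)
     \<Rightarrow> 'h::banach itself \<Rightarrow> bool" where
  "cstar_algebra K sc star (_ :: 'h itself) \<longleftrightarrow>
     banach_star_algebra K sc star \<and>
     (\<exists>(scH :: complex \<Rightarrow> 'h \<Rightarrow> 'h) ip S \<pi>.
        hilbert_space_over K scH ip \<and>
        closed_operator_star_subalgebra K scH ip S \<and>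
        bij_betw \<pi> UNIV S \<and>
        (\<forall>x. norm (\<pi> x) = norm x) \<and>
        (\<forall>x y. \<pi> (x + y) = \<pi> x + \<pi> y) \<and>
        (\<forall>c\<in>K. \<forall>x. is_scaled_operator scH c (\<pi> x) (\<pi> (sc c x))) \<and>
        (\<forall>x y. \<pi> (x * y) = \<pi> x o\<^sub>L \<pi> y) \<and>
        (\<forall>x. is_adjoint_operator ip (\<pi> x) (\<pi> (star x))))"

definition closed_star_subalgebra ::
  "complex set \<Rightarrow> (complex \<Rightarrow> 'a::real_normed_algebra \<Rightarrow> 'a) \<Rightarrow> ('a \<Rightarrow> 'a) \<Rightarrow> 'a set \<Rightarrow> bool" where
  "closed_star_subalgebra K sc star S \<longleftrightarrow>
     closed S \<and> 0 \<in> S \<and>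
     (\<forall>x\<in>S. \<forall>y\<in>S. x + y \<in> S) \<and>
     (\<forall>c\<in>K. \<forall>x\<in>S. sc c x \<in> S) \<and>
     (\<forall>x\<in>S. \<forall>y\<in>S. x * y \<in> S) \<and>
     (\<forall>x\<in>S. star x \<in> S)"

definition star_homomorphism ::
  "complex set \<Rightarrow> (complex \<Rightarrow> 'a::real_normed_algebra \<Rightarrow> 'a) \<Rightarrow> ('a \<Rightarrow> 'a)
     \<Rightarrow> (complex \<Rightarrow> 'b::real_normed_algebra \<Rightarrow> 'b) \<Rightarrow> ('b \<Rightarrow> 'b) \<Rightarrow> ('a \<Rightarrow> 'b) \<Rightarrow> bool" where
  "star_homomorphism K scA starA scB starB \<phi> \<longleftrightarrow>
     (\<forall>x y. \<phi> (x + y) = \<phi> x + \<phi> y) \<and>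
     (\<forall>c\<in>K. \<forall>x. \<phi> (scA c x) = scB c (\<phi> x)) \<and>
     (\<forall>x y. \<phi> (x * y) = \<phi> x * \<phi> y) \<and>
     (\<forall>x. \<phi> (starA x) = starB (\<phi> x))"

section \<open>Recursive functions\<close>

text \<open>
  \<open>recursive n f\<close>: on argument lists of length \<open>n\<close>, \<open>f\<close> is a total recursive function. Minimization
  is restricted to regular functions, which yields exactly the total functions among the partial
  recursive ones.
\<close>

inductive recursive :: "nat \<Rightarrow> (nat list \<Rightarrow> nat) \<Rightarrow> bool" where
  zero: "recursive n (\<lambda>xs. 0)"
| succ: "recursive 1 (\<lambda>xs. Suc (xs ! 0))"
| proj: "i < n \<Longrightarrow> recursive n (\<lambda>xs. xs ! i)"
| comp: "recursive (length hs) g \<Longrightarrow> \<forall>h\<in>set hs. recursive n h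
    \<Longrightarrow> recursive n (\<lambda>xs. g (map (\<lambda>h. h xs) hs))"
| prim_rec: "recursive n g \<Longrightarrow> recursive (Suc (Suc n)) h
    \<Longrightarrow> recursive (Suc n) (\<lambda>xs. rec_nat (g (tl xs)) (\<lambda>m r. h (m # r # tl xs)) (hd xs))"
| minimization: "recursive (Suc n) g \<Longrightarrow> (\<And>xs. length xs = n \<Longrightarrow> \<exists>m. g (m # xs) = 0)
    \<Longrightarrow> recursive n (\<lambda>xs. LEAST m. g (m # xs) = 0)"

definition effective :: "(nat \<Rightarrow> nat \<Rightarrow> nat) \<Rightarrow> bool" where
  "effective f \<longleftrightarrow> (\<exists>g. recursive 2 g \<and> (\<forall>x y. f x y = g [x, y]))"

section \<open>Rational noncommutative *-polynomials\<close>

text \<open>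
  \<open>Gen i\<close> and \<open>Adj i\<close> stand for the \<open>i\<close>-th indeterminate and its adjoint. A monomial is a nonempty
  word, given as its first letter and the list of the remaining ones; hence there is no constant
  term. The coefficient \<open>(p, q)\<close> stands for \<open>p + q\<i>\<close>. Polynomials are formal sums of terms.
\<close>

datatype letter = Gen nat | Adj nat

type_synonym rat_term = "(rat \<times> rat) \<times> letter \<times> letter list"
type_synonym rat_poly = "rat_term list"

fun letter_index :: "letter \<Rightarrow> nat" where
  "letter_index (Gen i) = i"
| "letter_index (Adj i) = i"

definition coefficient :: "rat \<times> rat \<Rightarrow> complex" where
  "coefficient c = Complex (of_rat (fst c)) (of_rat (snd c))"

definition poly_indices :: "rat_poly \<Rightarrow> nat set" where
  "poly_indices p = (\<Union>(c, l, ls)\<in>set p. letter_index ` set (l # ls))"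

text \<open>For \<open>K = \<real>\<close> this forces the coefficients to be in \<open>\<rat>\<close>; for \<open>K = UNIV\<close> they range over \<open>\<rat>(\<i>)\<close>.\<close>

definition poly_over :: "complex set \<Rightarrow> rat_poly \<Rightarrow> bool" where
  "poly_over K p \<longleftrightarrow> (\<forall>(c, l, ls)\<in>set p. coefficient c \<in> K)"

fun letter_eval :: "('a \<Rightarrow> 'a) \<Rightarrow> (nat \<Rightarrow> 'a) \<Rightarrow> letter \<Rightarrow> 'a" where
  "letter_eval star a (Gen i) = a i"
| "letter_eval star a (Adj i) = star (a i)"

fun term_eval :: "(complex \<Rightarrow> 'a::real_normed_algebra \<Rightarrow> 'a) \<Rightarrow> ('a \<Rightarrow> 'a) \<Rightarrow> (nat \<Rightarrow> 'a)
    \<Rightarrow> rat_term \<Rightarrow> 'a" where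
  "term_eval sc star a (c, l, ls) =
     sc (coefficient c) (foldl (\<lambda>x l'. x * letter_eval star a l') (letter_eval star a l) ls)"

definition poly_eval :: "(complex \<Rightarrow> 'a::real_normed_algebra \<Rightarrow> 'a) \<Rightarrow> ('a \<Rightarrow> 'a) \<Rightarrow> (nat \<Rightarrow> 'a)
    \<Rightarrow> rat_poly \<Rightarrow> 'a" where
  "poly_eval sc star a p = (\<Sum>t\<leftarrow>p. term_eval sc star a t)"

text \<open>
  Algorithms operate on codes. Every natural number is a code, and every rational number and every
  rational polynomial has at least one code (see the surjectivity lemmas below).
\<close>

definition rat_decode :: "nat \<Rightarrow> rat" where
  "rat_decode n = (case prod_decode n of (a, b) \<Rightarrow> of_int (int_decode a) / of_nat (Suc b))"

definition letter_decode :: "nat \<Rightarrow> letter" where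
  "letter_decode n = (if even n then Gen (n div 2) else Adj (n div 2))"

definition term_decode :: "nat \<Rightarrow> rat_term" where
  "term_decode n =
     (case prod_decode n of (c, w) \<Rightarrow>
        (map_prod rat_decode rat_decode (prod_decode c),
         map_prod letter_decode (map letter_decode \<circ> list_decode) (prod_decode w)))"

definition poly_decode :: "nat \<Rightarrow> rat_poly" where
  "poly_decode n = map term_decode (list_decode n)"

lemma surj_rat_decode: "surj rat_decode"
proof -
  have "\<exists>n. rat_decode n = q" for q
  proof -
    obtain a b where ab: "quotient_of q = (a, b)" by (cases "quotient_of q")
    then have b: "b > 0" and q: "q = of_int a / of_int b"
      by (simp_all add: quotient_of_denom_pos quotient_of_div)
    have "Suc (nat b - 1) = nat b" using b by simp
    then have "rat_decode (prod_encode (int_encode a, nat b - 1)) = q"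
      using b by (simp add: rat_decode_def q del: of_nat_Suc)
    then show ?thesis ..
  qed
  then show ?thesis by (metis surj_def)
qed

lemma surj_letter_decode: "surj letter_decode"
proof (rule surjI)
  show "letter_decode (case l of Gen i \<Rightarrow> 2 * i | Adj i \<Rightarrow> Suc (2 * i)) = l" for l
    by (cases l) (simp_all add: letter_decode_def)
qed

lemma surj_term_decode: "surj term_decode"
proof -
  have "\<exists>n. term_decode n = ((p, q), l, ls)" for p q l ls
  proof -
    obtain a b c where "rat_decode a = p" "rat_decode b = q" "letter_decode c = l"
      by (metis surjD surj_rat_decode surj_letter_decode)
    moreover obtain ms where "map letter_decode ms = ls"
      by (metis ex_map_conv surjD surj_letter_decode)
    ultimately have "term_decode (prod_encode (prod_encode (a, b), prod_encode (c, list_encode ms)))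
        = ((p, q), l, ls)"
      by (simp add: term_decode_def)
    then show ?thesis ..
  qed
  then show ?thesis by (metis surj_def prod.collapse)
qed

lemma surj_poly_decode: "surj poly_decode"
proof -
  have "\<exists>n. poly_decode n = p" for p
  proof -
    obtain ts where "map term_decode ts = p"
      by (metis ex_map_conv surjD surj_term_decode)
    then have "poly_decode (list_encode ts) = p" by (simp add: poly_decode_def)
    then show ?thesis ..
  qed
  then show ?thesis by (metis surj_def)
qed

section \<open>Presentations\<close>

text \<open>The special points are \<open>points P i\<close> for \<open>i < num_points P\<close>; other values of \<open>points P\<close> are irrelevant.\<close>

record 'a presentation =
  num_points :: enat
  points :: "nat \<Rightarrow> 'a"

definition special_indices :: "'a presentation \<Rightarrow> nat set" where
  "special_indices P = {i. enat i < num_points P}"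

definition is_presentation ::
  "complex set \<Rightarrow> (complex \<Rightarrow> 'a::real_normed_algebra \<Rightarrow> 'a) \<Rightarrow> ('a \<Rightarrow> 'a)
     \<Rightarrow> 'a presentation \<Rightarrow> bool" where
  "is_presentation K sc star P \<longleftrightarrow>
     (\<forall>S. closed_star_subalgebra K sc star S \<and> points P ` special_indices P \<subseteq> S \<longrightarrow> S = UNIV)"

definition rational_code :: "complex set \<Rightarrow> 'a presentation \<Rightarrow> nat \<Rightarrow> bool" where
  "rational_code K P n \<longleftrightarrow>
     poly_over K (poly_decode n) \<and> poly_indices (poly_decode n) \<subseteq> special_indices P"

definition rational_point ::
  "(complex \<Rightarrow> 'a::real_normed_algebra \<Rightarrow> 'a) \<Rightarrow> ('a \<Rightarrow> 'a) \<Rightarrow> 'a presentation \<Rightarrow> nat \<Rightarrow> 'a" where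
  "rational_point sc star P n = poly_eval sc star (points P) (poly_decode n)"

definition computable_presentation ::
  "complex set \<Rightarrow> (complex \<Rightarrow> 'a::real_normed_algebra \<Rightarrow> 'a) \<Rightarrow> ('a \<Rightarrow> 'a)
     \<Rightarrow> 'a presentation \<Rightarrow> bool" where
  "computable_presentation K sc star P \<longleftrightarrow>
     is_presentation K sc star P \<and>
     (\<exists>f. effective f \<and>
       (\<forall>n k. rational_code K P n \<longrightarrow>
          \<bar>norm (rational_point sc star P n) - of_rat (rat_decode (f n k))\<bar> < (1 / 2) ^ k))"

definition computable_map ::
  "complex set \<Rightarrow> (complex \<Rightarrow> 'a::real_normed_algebra \<Rightarrow> 'a) \<Rightarrow> ('a \<Rightarrow> 'a)
     \<Rightarrow> (complex \<Rightarrow> 'b::real_normed_algebra \<Rightarrow> 'b) \<Rightarrow> ('b \<Rightarrow> 'b)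
     \<Rightarrow> 'a presentation \<Rightarrow> 'b presentation \<Rightarrow> ('a \<Rightarrow> 'b) \<Rightarrow> bool" where
  "computable_map K scA starA scB starB P Q \<phi> \<longleftrightarrow>
     (\<exists>f. effective f \<and>
       (\<forall>n k. rational_code K P n \<longrightarrow>
          rational_code K Q (f n k) \<and>
          norm (\<phi> (rational_point scA starA P n) - rational_point scB starB Q (f n k))
            < (1 / 2) ^ k))"

definition computable_isomorphism ::
  "complex set \<Rightarrow> (complex \<Rightarrow> 'a::real_normed_algebra \<Rightarrow> 'a) \<Rightarrow> ('a \<Rightarrow> 'a)
     \<Rightarrow> (complex \<Rightarrow> 'b::real_normed_algebra \<Rightarrow> 'b) \<Rightarrow> ('b \<Rightarrow> 'b)
     \<Rightarrow> 'a presentation \<Rightarrow> 'b presentation \<Rightarrow> ('a \<Rightarrow> 'b) \<Rightarrow> bool" where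
  "computable_isomorphism K scA starA scB starB P Q \<phi> \<longleftrightarrow>
     star_homomorphism K scA starA scB starB \<phi> \<and> bij \<phi> \<and>
     computable_map K scA starA scB starB P Q \<phi>"

definition computably_categorical ::
  "complex set \<Rightarrow> (complex \<Rightarrow> 'a::real_normed_algebra \<Rightarrow> 'a) \<Rightarrow> ('a \<Rightarrow> 'a) \<Rightarrow> bool" where
  "computably_categorical K sc star \<longleftrightarrow>
     (\<forall>P Q. computable_presentation K sc star P \<and> computable_presentation K sc star Q
        \<longrightarrow> (\<exists>\<phi>. computable_isomorphism K sc star sc star P Q \<phi>))"

end

theory Submission
  imports Defs
begin

text \<open>
  Two computable presentations of the same algebra are related by the identity map, but its matrix
  with respect to bases of monomials need not be computable. The automorphisms near the identity
  form a set with a computable point: an approximate automorphism can be improved by a Newton step,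
  built from a separability idempotent, whose size is proportional to the defect. Hence among
  the rational matrices near a given one of defect below \<open>\<eta>\<close>, at distance \<open>O(\<eta>)\<close>, there is always one
  of defect below \<open>\<eta> / 2\<close>. Since the structure constants in the monomial bases are computable, such
  matrices can be found by search, and the greedy sequence converges effectively to the matrix of
  an automorphism.
\<close>

section \<open>Recursive functions of one variable\<close>

text \<open>The Newton step only proves that the search succeeds and is never itself computed: the
  inner product, the separability idempotent and the bounds behind it come from a representation
  unrelated to the presentations. What an algorithm sees are the coordinates of products, adjoints
  and \<i>-multiples of monomials, which are computable reals. A strict inequality between
  computable reals can be confirmed but in general not refuted, so every condition in the search is
  strict. Finite data (bases, constants, an initial matrix close to that of the identity) are built
  into the algorithm non-uniformly. A Newton step gains a factor of order \<open>d + \<eta>\<close>,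
  where \<open>d\<close> is the distance to the identity. As \<open>d\<close> does not tend to 0,
  the convergence is linear rather than quadratic. Any ratio is reached by staying close enough to
  the identity, and with ratio 1/2 the total displacement is a geometric sum, which confines the
  sequence to that neighbourhood.\<close>

definition computable :: "(nat \<Rightarrow> nat) \<Rightarrow> bool" where
  "computable f \<longleftrightarrow> (\<exists>g. recursive 1 g \<and> (\<forall>x. f x = g [x]))"

abbreviation pr :: "nat \<Rightarrow> nat \<Rightarrow> nat" where "pr x y \<equiv> prod_encode (x, y)"
definition p1 :: "nat \<Rightarrow> nat" where "p1 x = fst (prod_decode x)"
definition p2 :: "nat \<Rightarrow> nat" where "p2 x = snd (prod_decode x)"

lemma p1_pr [simp]: "p1 (pr x y) = x" and p2_pr [simp]: "p2 (pr x y) = y"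
  and pr_p [simp]: "pr (p1 x) (p2 x) = x"
  by (simp_all add: p1_def p2_def)

lemma computable_effective:
  assumes "effective h" "computable f" "computable g" shows "computable (\<lambda>x. h (f x) (g x))"
proof -
  obtain h' f' g' where r: "recursive 2 h'" "recursive 1 f'" "recursive 1 g'"
    and e: "\<And>x y. h x y = h' [x, y]" "\<And>x. f x = f' [x]" "\<And>x. g x = g' [x]"
    using assms unfolding computable_def effective_def by metis
  have "recursive 1 (\<lambda>xs. h' (map (\<lambda>h. h xs) [f', g']))"
    using r by (intro recursive.comp) (auto simp: numeral_2_eq_2)
  then show ?thesis unfolding computable_def using e by auto
qed

lemma effective_swap: "effective f \<Longrightarrow> effective (\<lambda>x y. f y x)"
proof -
  assume "effective f"
  then obtain g where g: "recursive 2 g" "\<And>x y. f x y = g [x, y]" unfolding effective_def by auto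
  have "recursive 2 (\<lambda>xs. g (map (\<lambda>h. h xs) [\<lambda>xs. xs ! 1, \<lambda>xs. xs ! 0]))"
    using g by (intro recursive.comp) (auto simp: numeral_2_eq_2 intro!: recursive.proj)
  then show ?thesis unfolding effective_def using g
    by (intro exI[of _ "\<lambda>xs. g (map (\<lambda>h. h xs) [\<lambda>xs. xs ! 1, \<lambda>xs. xs ! 0])"]) simp
qed

lemma effective_compose:
  assumes "effective h" "effective f" "effective g" shows "effective (\<lambda>x y. h (f x y) (g x y))"
proof -
  obtain h' f' g' where r: "recursive 2 h'" "recursive 2 f'" "recursive 2 g'"
    and e: "\<And>x y. h x y = h' [x, y]" "\<And>x y. f x y = f' [x, y]" "\<And>x y. g x y = g' [x, y]"
    using assms unfolding effective_def by metis
  have "recursive 2 (\<lambda>xs. h' (map (\<lambda>h. h xs) [f', g']))"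
    using r by (intro recursive.comp) (auto simp: numeral_2_eq_2)
  then show ?thesis unfolding effective_def using e
    by (intro exI[of _ "\<lambda>xs. h' (map (\<lambda>h. h xs) [f', g'])"]) simp
qed

lemma effective_fst: "effective (\<lambda>x y. x)" and effective_snd: "effective (\<lambda>x y. y)"
  unfolding effective_def
  by (rule exI[of _ "\<lambda>xs. xs ! 0"], simp add: recursive.proj)
     (rule exI[of _ "\<lambda>xs. xs ! 1"], simp add: recursive.proj)

lemma effective_cf: assumes "computable h" "effective f" shows "effective (\<lambda>x y. h (f x y))"
proof -
  obtain h' f' where r: "recursive 1 h'" "recursive 2 f'"
    and e: "\<And>x. h x = h' [x]" "\<And>x y. f x y = f' [x, y]"
    using assms unfolding effective_def computable_def by metis
  have "recursive 2 (\<lambda>xs. h' (map (\<lambda>h. h xs) [f']))"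
    using r by (intro recursive.comp) auto
  then show ?thesis unfolding effective_def using e
    by (intro exI[of _ "\<lambda>xs. h' (map (\<lambda>h. h xs) [f'])"]) simp
qed

lemma computable_comp: "computable h \<Longrightarrow> computable f \<Longrightarrow> computable (\<lambda>x. h (f x))"
proof -
  assume "computable h" "computable f"
  then obtain h' f' where r: "recursive 1 h'" "recursive 1 f'" 
    and e: "\<And>x. h x = h' [x]" "\<And>x. f x = f' [x]"
    unfolding computable_def by metis
  have "recursive 1 (\<lambda>xs. h' (map (\<lambda>h. h xs) [f']))"
    using r by (intro recursive.comp) auto
  then show ?thesis unfolding computable_def using e by auto
qed

lemma computable_id: "computable (\<lambda>x. x)"
  unfolding computable_def by (rule exI[of _ "\<lambda>xs. xs ! 0"]) (simp add: recursive.proj)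

lemma computable_Suc0: "computable Suc" unfolding computable_def using recursive.succ by force

lemma computable_Suc: "computable f \<Longrightarrow> computable (\<lambda>x. Suc (f x))" by (rule computable_comp[OF computable_Suc0])

lemma computable_const: "computable (\<lambda>x. c)"
proof (induction c)
  case 0 show ?case unfolding computable_def using recursive.zero by force
qed (rule computable_Suc)

lemma effective_rec:
  assumes "computable a" "effective h"
  shows "effective (\<lambda>n x. rec_nat (a x) (\<lambda>m r. h r x) n)"
proof -
  obtain a' h' where r: "recursive 1 a'" "recursive 2 h'"
    and e: "\<And>x. a x = a' [x]" "\<And>x y. h x y = h' [x, y]"
    using assms unfolding effective_def computable_def by metis
  have "recursive (Suc (Suc 1)) (\<lambda>xs. h' (map (\<lambda>h. h xs) [\<lambda>xs. xs ! 1, \<lambda>xs. xs ! 2]))"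
    using r by (intro recursive.comp) (auto simp: numeral_2_eq_2 intro!: recursive.proj)
  note recursive.prim_rec[OF r(1) this]
  then show ?thesis unfolding effective_def using e
    by (intro exI) (rule conjI, simp add: numeral_2_eq_2, simp)
qed

lemma effective_plus: "effective (+)"
proof -
  have *: "rec_nat x (\<lambda>m r. Suc r) n = n + x" for x n :: nat by (induction n) auto
  show ?thesis
    using effective_rec[OF computable_id, of "\<lambda>r x. Suc r"] effective_cf[OF computable_Suc0 effective_fst]
    unfolding * by (simp add: add.commute)
qed

lemma effective_times: "effective (*)"
proof -
  have *: "rec_nat 0 (\<lambda>m r. r + x) n = n * x" for x n :: nat by (induction n) auto
  show ?thesis
    using effective_rec[OF computable_const[of 0] effective_plus] unfolding * .
qed

lemma computable_plus: "computable f \<Longrightarrow> computable g \<Longrightarrow> computable (\<lambda>x. f x + g x)"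
  by (rule computable_effective[OF effective_plus])

lemma computable_times: "computable f \<Longrightarrow> computable g \<Longrightarrow> computable (\<lambda>x. f x * g x)"
  by (rule computable_effective[OF effective_times])

lemma effective_rec_index:
  assumes "computable a" "effective h"
  shows "effective (\<lambda>n x. rec_nat (a x) (\<lambda>m r. h m r) n)"
proof -
  obtain a' h' where r: "recursive 1 a'" "recursive 2 h'"
    and e: "\<And>x. a x = a' [x]" "\<And>x y. h x y = h' [x, y]"
    using assms unfolding effective_def computable_def by metis
  have rec: "recursive (Suc (Suc 1)) (\<lambda>xs. h' (map (\<lambda>h. h xs) [\<lambda>xs. xs ! 0, \<lambda>xs. xs ! 1]))"
    using r by (intro recursive.comp) (auto simp: numeral_2_eq_2 intro!: recursive.proj)
  have h: "h = (\<lambda>m r. h' [m, r])" using e(2) by blast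
  note recursive.prim_rec[OF r(1) rec]
  then show ?thesis unfolding effective_def h using e(1)
    by (intro exI) (rule conjI, simp add: numeral_2_eq_2, simp)
qed

lemma computable_rec_index:
  assumes "effective h" "computable f"
  shows "computable (\<lambda>x. rec_nat a (\<lambda>m r. h m r) (f x))"
  using computable_effective[OF effective_rec_index[OF computable_const[of a] assms(1)] assms(2) computable_id] .

lemma computable_pred: "computable (\<lambda>x. x - 1)"
proof -
  have *: "rec_nat 0 (\<lambda>m r. m) n = n - 1" for n :: nat by (cases n) auto
  show ?thesis
    using computable_rec_index[OF effective_fst computable_id, of 0] unfolding * .
qed

lemma effective_minus: "effective (-)"
proof -
  have *: "rec_nat x (\<lambda>m r. r - 1) n = x - n" for x n :: nat by (induction n) auto
  have "effective (\<lambda>n x. x - n)"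
    using effective_rec[OF computable_id, of "\<lambda>r x. r - 1"] effective_cf[OF computable_pred effective_fst]
    unfolding * by simp
  then show ?thesis by (rule effective_swap)
qed

lemma computable_minus: "computable f \<Longrightarrow> computable g \<Longrightarrow> computable (\<lambda>x. f x - g x)"
  by (rule computable_effective[OF effective_minus])

section \<open>The pairing function and its inverse\<close>

lemma computable_triangle: "computable triangle"
proof -
  have "effective (\<lambda>m r. r + Suc m)"
    by (intro effective_compose[OF effective_plus] effective_snd effective_cf[OF computable_Suc0] effective_fst)
  from computable_rec_index[OF this computable_id, of 0]
  have "computable (\<lambda>n. rec_nat 0 (\<lambda>m r. r + Suc m) n)" .
  moreover have "rec_nat 0 (\<lambda>m r. r + Suc m) n = triangle n" for n by (induction n) auto
  ultimately show ?thesis by (simp add: eta_contract_eq)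
qed

lemma computable_pr: "computable f \<Longrightarrow> computable g \<Longrightarrow> computable (\<lambda>x. pr (f x) (g x))"
  by (simp add: prod_encode_def computable_plus computable_comp[OF computable_triangle])

lemma effective_pr: "effective pr"
  unfolding prod_encode_def split
  by (intro effective_compose[OF effective_plus] effective_cf[OF computable_triangle] effective_plus effective_fst)

lemma computable_Least_effective:
  assumes "effective h" "\<And>x. \<exists>m. h m x = 0" shows "computable (\<lambda>x. LEAST m. h m x = 0)"
proof -
  obtain h' where r: "recursive (Suc 1) h'" and e: "\<And>x y. h x y = h' [x, y]"
    using assms(1) unfolding effective_def by (metis Suc_1)
  have "recursive 1 (\<lambda>xs. LEAST m. h' (m # xs) = 0)"
    using assms(2) e by (intro recursive.minimization[OF r]) (auto simp: length_Suc_conv)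
  then show ?thesis unfolding computable_def using e by auto
qed

text \<open>The largest \<open>k\<close> with \<open>triangle k \<le> n\<close>. As
  \<open>pr a b = triangle (a + b) + a\<close>, it recovers the sum of the two paired numbers, and
  from it both of them.\<close>

definition triangle_root :: "nat \<Rightarrow> nat" where
  "triangle_root n = (LEAST k. Suc n - triangle (Suc k) = 0)"

lemma computable_triangle_root: "computable triangle_root"
proof -
  have "n \<le> triangle n" for n by (induction n) auto
  then have ex: "\<exists>k. Suc x - triangle (Suc k) = 0" for x by (metis diff_is_0_eq)
  have "effective (\<lambda>k x. Suc x - triangle (Suc k))"
    by (intro effective_compose[OF effective_minus] effective_cf[OF computable_triangle]
        effective_cf[OF computable_Suc0] effective_fst effective_snd)
  from computable_Least_effective[OF this ex]
  show ?thesis unfolding triangle_root_def[abs_def] .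
qed

lemma triangle_mono: "a \<le> b \<Longrightarrow> triangle a \<le> triangle b"
  by (induction b) (auto simp: le_Suc_eq)

lemma triangle_root_pr: "triangle_root (pr a b) = a + b"
  unfolding triangle_root_def
proof (rule Least_equality)
  fix k assume "Suc (pr a b) - triangle (Suc k) = 0"
  then have "triangle (a + b) < triangle (Suc k)" by (simp add: prod_encode_def)
  then have "\<not> Suc k \<le> a + b" using triangle_mono by (meson leD)
  then show "a + b \<le> k" by simp
qed (simp add: prod_encode_def)

lemma computable_p1': "computable p1"
proof -
  have "p1 (pr a b) = pr a b - triangle (triangle_root (pr a b))" for a b
    unfolding triangle_root_pr p1_pr by (simp add: prod_encode_def)
  then have "p1 = (\<lambda>x. x - triangle (triangle_root x))" by (metis pr_p)
  moreover have "computable (\<lambda>x. x - triangle (triangle_root x))"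
    by (intro computable_minus computable_id computable_comp[OF computable_triangle] computable_triangle_root)
  ultimately show ?thesis by (simp only:)
qed

lemma computable_p2': "computable p2"
proof -
  have "p2 (pr a b) = triangle_root (pr a b) - p1 (pr a b)" for a b
    unfolding triangle_root_pr by simp
  then have "p2 = (\<lambda>x. triangle_root x - p1 x)" by (metis pr_p)
  moreover have "computable (\<lambda>x. triangle_root x - p1 x)"
    by (intro computable_minus computable_p1' computable_triangle_root)
  ultimately show ?thesis by (simp only:)
qed

lemma computable_p1: "computable f \<Longrightarrow> computable (\<lambda>x. p1 (f x))" by (rule computable_comp[OF computable_p1'])
lemma computable_p2: "computable f \<Longrightarrow> computable (\<lambda>x. p2 (f x))" by (rule computable_comp[OF computable_p2'])

lemmas computable_intros = computable_id computable_const computable_Suc computable_plus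
  computable_times computable_minus computable_pr computable_p1
  computable_p2

lemma effective_iff: "effective f \<longleftrightarrow> computable (\<lambda>x. f (p1 x) (p2 x))"
proof
  assume "effective f" then show "computable (\<lambda>x. f (p1 x) (p2 x))" by (rule computable_effective[OF _ computable_p1' computable_p2'])
next
  assume "computable (\<lambda>x. f (p1 x) (p2 x))"
  from effective_cf[OF this effective_pr] show "effective f" by simp
qed

lemma computable_Least:
  assumes "computable (\<lambda>z. h (p1 z) (p2 z))" "\<And>x. \<exists>m. h x m = 0" shows "computable (\<lambda>x. LEAST m. h x m = 0)"
  by (rule computable_Least_effective[OF effective_swap]) (use assms in \<open>simp_all add: effective_iff\<close>)

lemma computable_rec0:
  assumes "computable a" "computable (\<lambda>z. h (p1 z) (p2 z))" 
  shows "computable (\<lambda>x. rec_nat (a x) (\<lambda>m r. h m r) x)"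
  using computable_effective[OF effective_rec_index[OF assms(1)] computable_id computable_id] assms(2)
  by (simp add: effective_iff)

text \<open>The loop used below: parity, powers of two and the walk down a coded list are iterations
  of a fixed computable map.\<close>

lemma computable_funpow:
  assumes "computable h" shows "computable (\<lambda>x. (h ^^ p1 x) (p2 x))"
proof -
  have "rec_nat x (\<lambda>m r. h r) n = (h ^^ n) x" for n x by (induction n) auto
  then show ?thesis
    using computable_effective[OF effective_rec[OF computable_id, of "\<lambda>r x. h r"], of p1 p2]
      effective_cf[OF assms effective_fst] computable_p1' computable_p2' by simp
qed

lemma computable_power2: "computable f \<Longrightarrow> computable (\<lambda>x. 2 ^ f x)"
proof -
  assume "computable f"
  have "((*) 2 ^^ n) (1::nat) = 2 ^ n" for n by (induction n) auto
  moreover have "computable (\<lambda>x. ((*) 2 ^^ p1 (pr (f x) 1)) (p2 (pr (f x) 1)))"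
    by (rule computable_comp[OF computable_funpow]) (intro computable_intros \<open>computable f\<close>)+
  ultimately show ?thesis by simp
qed

lemma computable_mod2: "computable f \<Longrightarrow> computable (\<lambda>x. f x mod 2)"
proof -
  assume "computable f"
  have "((\<lambda>b. 1 - b) ^^ n) 0 = n mod 2" for n :: nat 
    by (induction n) (simp, simp only: funpow.simps o_apply, presburger)
  moreover have "computable (\<lambda>x. ((\<lambda>b. 1 - b) ^^ p1 (pr (f x) 0)) (p2 (pr (f x) 0)))"
    by (rule computable_comp[OF computable_funpow]) (intro computable_intros \<open>computable f\<close>)+
  ultimately show ?thesis by simp
qed

lemma computable_div2: "computable f \<Longrightarrow> computable (\<lambda>x. f x div 2)"
proof -
  assume "computable f"
  have *: "\<exists>m. x - (2 * m + 1) = 0" for x :: nat by (rule exI[of _ x]) simp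
  have "computable (\<lambda>x. LEAST m. x - (2 * m + 1) = 0)"
    by (rule computable_Least[OF _ *]) (intro computable_intros)
  moreover have "(LEAST m. x - (2 * m + 1) = 0) = x div 2" for x :: nat
    by (rule Least_equality) auto
  ultimately show ?thesis using computable_comp[OF _ \<open>computable f\<close>] by simp
qed

section \<open>Semidecidable predicates\<close>

text \<open>The \<Sigma>1 form with an explicit witness. Witnesses can be paired, which gives
  closure under conjunction and under existential quantification.\<close>

definition semidecidable :: "(nat \<Rightarrow> bool) \<Rightarrow> bool" where
  "semidecidable P \<longleftrightarrow> (\<exists>f. computable f \<and> (\<forall>x. P x \<longleftrightarrow> (\<exists>w. f (pr x w) = 0)))"

lemma semidecidableI: assumes "computable f" "\<And>x. P x \<longleftrightarrow> f x = 0" shows "semidecidable P"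
  unfolding semidecidable_def by (rule exI[of _ "\<lambda>z. f (p1 z)"]) (use assms computable_comp computable_p1' in auto)

lemma semidecidable_eq: "computable f \<Longrightarrow> computable g \<Longrightarrow> semidecidable (\<lambda>x. f x = g x)"
  by (rule semidecidableI[of "\<lambda>x. (f x - g x) + (g x - f x)"]) (auto intro: computable_intros)

lemma semidecidable_le: "computable f \<Longrightarrow> computable g \<Longrightarrow> semidecidable (\<lambda>x. f x \<le> g x)"
  by (rule semidecidableI[of "\<lambda>x. f x - g x"]) (auto intro: computable_intros)

lemma semidecidable_less: "computable f \<Longrightarrow> computable g \<Longrightarrow> semidecidable (\<lambda>x. f x < g x)"
  by (rule semidecidableI[of "\<lambda>x. Suc (f x) - g x"]) (auto intro!: computable_intros)

lemma semidecidable_const: "semidecidable (\<lambda>x. b)"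
  by (rule semidecidableI[of "\<lambda>x. if b then 0 else 1"]) (auto intro!: computable_intros)

lemma semidecidable_comp: "semidecidable P \<Longrightarrow> computable g \<Longrightarrow> semidecidable (\<lambda>x. P (g x))"
proof -
  assume "semidecidable P" and g: "computable g"
  then obtain f where f: "computable f" "\<And>x. P x \<longleftrightarrow> (\<exists>w. f (pr x w) = 0)" unfolding semidecidable_def by auto
  show ?thesis unfolding semidecidable_def
    by (rule exI[of _ "\<lambda>z. f (pr (g (p1 z)) (p2 z))"])
       (use f in \<open>auto intro!: computable_intros computable_comp[OF f(1)] computable_comp[OF g]\<close>)
qed

lemma semidecidable_conj: "semidecidable P \<Longrightarrow> semidecidable Q \<Longrightarrow> semidecidable (\<lambda>x. P x \<and> Q x)"
proof -
  assume "semidecidable P" "semidecidable Q"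
  then obtain f g where f: "computable f" "\<And>x. P x \<longleftrightarrow> (\<exists>w. f (pr x w) = 0)"
    and g: "computable g" "\<And>x. Q x \<longleftrightarrow> (\<exists>w. g (pr x w) = 0)" unfolding semidecidable_def by metis
  have "(P x \<and> Q x) \<longleftrightarrow> (\<exists>w. f (pr x (p1 w)) + g (pr x (p2 w)) = 0)" for x
    unfolding f(2) g(2) by simp (metis p1_pr p2_pr)
  moreover have "computable (\<lambda>z. f (pr (p1 z) (p1 (p2 z))) + g (pr (p1 z) (p2 (p2 z))))"
    by (intro computable_intros computable_comp[OF f(1)] computable_comp[OF g(1)])
  ultimately show ?thesis unfolding semidecidable_def
    by (intro exI[of _ "\<lambda>z. f (pr (p1 z) (p1 (p2 z))) + g (pr (p1 z) (p2 (p2 z)))"] conjI allI) simp_all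
qed

lemma semidecidable_disj: "semidecidable P \<Longrightarrow> semidecidable Q \<Longrightarrow> semidecidable (\<lambda>x. P x \<or> Q x)"
proof -
  assume "semidecidable P" "semidecidable Q"
  then obtain f g where f: "computable f" "\<And>x. P x \<longleftrightarrow> (\<exists>w. f (pr x w) = 0)"
    and g: "computable g" "\<And>x. Q x \<longleftrightarrow> (\<exists>w. g (pr x w) = 0)" unfolding semidecidable_def by metis
  have "(P x \<or> Q x) \<longleftrightarrow> (\<exists>w. f (pr x w) * g (pr x w) = 0)" for x
    unfolding f(2) g(2) by auto
  moreover have "computable (\<lambda>z. f z * g z)"
    by (intro computable_intros f(1) g(1))
  ultimately show ?thesis unfolding semidecidable_def
    by (intro exI[of _ "\<lambda>z. f z * g z"] conjI allI) simp_all
qed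

lemma semidecidable_ex: assumes "semidecidable (\<lambda>z. P (p1 z) (p2 z))" shows "semidecidable (\<lambda>x. \<exists>y. P x y)"
proof -
  obtain f where f: "computable f" "\<And>x. P (p1 x) (p2 x) \<longleftrightarrow> (\<exists>w. f (pr x w) = 0)"
    using assms unfolding semidecidable_def by metis
  have "(\<exists>y. P x y) \<longleftrightarrow> (\<exists>w. f (pr (pr x (p1 w)) (p2 w)) = 0)" for x
    using f(2)[of "pr x _"] by simp (metis p1_pr p2_pr)
  moreover have "computable (\<lambda>z. f (pr (pr (p1 z) (p1 (p2 z))) (p2 (p2 z))))"
    by (intro computable_intros computable_comp[OF f(1)])
  ultimately show ?thesis unfolding semidecidable_def
    by (intro exI[of _ "\<lambda>z. f (pr (pr (p1 z) (p1 (p2 z))) (p2 (p2 z)))"] conjI allI) simp_all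
qed

text \<open>The minimization runs over a value and a witness at once. Trying the values one after
  the other could get stuck at a value for which the search for a witness never ends.\<close>

lemma semidecidable_choice:
  assumes "semidecidable (\<lambda>z. R (p1 z) (p2 z))" "\<And>x. \<exists>y. R x y"
  shows "\<exists>g. computable g \<and> (\<forall>x. R x (g x))"
proof -
  obtain f where f: "computable f" "\<And>x. R (p1 x) (p2 x) \<longleftrightarrow> (\<exists>w. f (pr x w) = 0)"
    using assms(1) unfolding semidecidable_def by metis
  define h where "h x m = f (pr (pr x (p1 m)) (p2 m))" for x m
  have ex: "\<exists>m. h x m = 0" for x
  proof -
    obtain y where "R x y" using assms(2) by blast
    then obtain w where "f (pr (pr x y) w) = 0" using f(2)[of "pr x y"] by auto
    then have "h x (pr y w) = 0" by (simp add: h_def)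
    then show ?thesis ..
  qed
  have "computable (\<lambda>x. LEAST m. h x m = 0)"
    by (rule computable_Least[OF _ ex]) (auto simp: h_def intro!: computable_intros computable_comp[OF f(1)])
  then have "computable (\<lambda>x. p1 (LEAST m. h x m = 0))" by (rule computable_p1)
  moreover have "R x (p1 (LEAST m. h x m = 0))" for x
    using LeastI_ex[OF ex[of x]] f(2)[of "pr x _"] unfolding h_def by auto
  ultimately show ?thesis by blast
qed

text \<open>The state of the recursion carries a witness of \<open>G\<close>; its validity is decidable, so that the
  search can be made total by accepting everything from an invalid state.\<close>

lemma semidecidable_dependent_choice:
  assumes G: "semidecidable (\<lambda>z. G (p1 z) (p2 z))" and R: "semidecidable (\<lambda>z. R (p1 z) (p1 (p2 z)) (p2 (p2 z)))"
    and G0: "G 0 s0" and step: "\<And>k s. G k s \<Longrightarrow> \<exists>s'. G (Suc k) s' \<and> R k s s'"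
  shows "\<exists>g. computable g \<and> (\<forall>k. G k (g k) \<and> R k (g k) (g (Suc k))) \<and> g 0 = s0"
proof -
  obtain f where f: "computable f" "\<And>x. G (p1 x) (p2 x) \<longleftrightarrow> (\<exists>w. f (pr x w) = 0)"
    using G unfolding semidecidable_def by metis
  have f2: "G k s \<longleftrightarrow> (\<exists>w. f (pr (pr k s) w) = 0)" for k s using f(2)[of "pr k s"] by simp
  define ok where "ok k z \<longleftrightarrow> f (pr (pr k (p1 z)) (p2 z)) = 0" for k z
  define R' where "R' x z \<longleftrightarrow> f (pr (pr (p1 x) (p1 (p2 x))) (p2 (p2 x))) > 0 \<or>
     (f (pr (pr (Suc (p1 x)) (p1 z)) (p2 z)) = 0 \<and> R (p1 x) (p1 (p2 x)) (p1 z))" for x z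
  have "semidecidable (\<lambda>z. R (p1 (p1 z)) (p1 (p2 (p1 z))) (p1 (p2 z)))"
    using semidecidable_comp[OF R, of "\<lambda>z. pr (p1 (p1 z)) (pr (p1 (p2 (p1 z))) (p1 (p2 z)))"]
    by (simp add: computable_intros)
  then have "semidecidable (\<lambda>z. R' (p1 z) (p2 z))" unfolding R'_def
    by (intro semidecidable_disj semidecidable_conj semidecidable_less semidecidable_eq computable_intros computable_comp[OF f(1)])
  moreover have "\<exists>z. R' x z" for x
  proof (cases "ok (p1 x) (p2 x)")
    case True
    then obtain s' where s: "G (Suc (p1 x)) s'" "R (p1 x) (p1 (p2 x)) s'"
      using step f2 unfolding ok_def by meson
    then obtain w where "f (pr (pr (Suc (p1 x)) s') w) = 0" unfolding f2 by auto
    then have "R' x (pr s' w)" using s by (simp add: R'_def)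
    then show ?thesis ..
  qed (auto simp: R'_def ok_def)
  ultimately obtain g where g: "computable g" "\<And>x. R' x (g x)" using semidecidable_choice by metis
  obtain w0 where w0: "f (pr (pr 0 s0) w0) = 0" using G0 f2 by auto
  define S where "S = rec_nat (pr s0 w0) (\<lambda>m r. g (pr m r))"
  have "computable (\<lambda>x. rec_nat (pr s0 w0) (\<lambda>m r. g (pr m r)) x)"
    using g by (intro computable_rec0) (auto intro: computable_intros)
  then have "computable (\<lambda>x. p1 (S x))" unfolding S_def by (rule computable_p1)
  moreover have ok: "ok k (S k)" for k
  proof (induction k)
    case 0 show ?case using w0 by (simp add: S_def ok_def)
  next
    case (Suc k)
    have "R' (pr k (S k)) (S (Suc k))" using g(2) by (simp add: S_def)
    then show ?case using Suc by (simp add: R'_def ok_def)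
  qed
  moreover have "R k (p1 (S k)) (p1 (S (Suc k)))" for k
  proof -
    have "R' (pr k (S k)) (S (Suc k))" using g(2) by (simp add: S_def)
    then show ?thesis using ok[of k] by (simp add: R'_def ok_def)
  qed
  moreover have "G k (p1 (S k))" for k using ok[of k] f2 unfolding ok_def by blast
  moreover have "p1 (S 0) = s0" by (simp add: S_def)
  ultimately show ?thesis by (intro exI[of _ "\<lambda>x. p1 (S x)"]) auto
qed

section \<open>Computable real functions\<close>

abbreviation rat_val :: "nat \<Rightarrow> real" where "rat_val q \<equiv> real_of_rat (rat_decode q)"

text \<open>A difference of naturals over a positive natural: field operations and comparisons then
  reduce to polynomials in naturals, without reduced fractions or coded signs.\<close>

definition computable_rat :: "(nat \<Rightarrow> real) \<Rightarrow> bool" where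
  "computable_rat r \<longleftrightarrow> (\<exists>a b c. computable a \<and> computable b \<and> computable c \<and>
     (\<forall>n. r n = (real (a n) - real (b n)) / (1 + real (c n))))"

lemma computable_ratE:
  assumes "computable_rat r"
  obtains a b c where "computable a" "computable b" "computable c" "\<And>n. r n = (real (a n) - real (b n)) / (1 + real (c n))"
  using assms unfolding computable_rat_def by auto

lemma computable_ratI:
  "computable a \<Longrightarrow> computable b \<Longrightarrow> computable c \<Longrightarrow> (\<And>n. r n = (real (a n) - real (b n)) / (1 + real (c n))) \<Longrightarrow> computable_rat r"
  unfolding computable_rat_def by blast

text \<open>An even code \<open>2 * a\<close> of an integer means \<open>a\<close> and an odd code
  \<open>2 * a + 1\<close> means \<open>- (a + 1)\<close>; the parity acts as a switch between the
  two numerators.\<close>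

lemma rat_val_eq: "rat_val n = (real ((1 - p1 n mod 2) * (p1 n div 2)) - real ((p1 n mod 2) * Suc (p1 n div 2)))
    / (1 + real (p2 n))"
proof -
  have "prod_decode n = (p1 n, p2 n)" by (simp add: p1_def p2_def)
  then have r: "rat_val n = of_int (int_decode (p1 n)) / (1 + real (p2 n))"
    by (simp add: rat_decode_def of_rat_divide of_rat_add)
  show ?thesis
  proof (cases "even (p1 n)")
    case True
    then show ?thesis unfolding r by (auto simp: int_decode_def sum_decode_def)
  next
    case False
    then have "p1 n mod 2 = 1" by presburger
    with False show ?thesis unfolding r by (simp add: int_decode_def sum_decode_def)
  qed
qed

lemma rat_val_surj: assumes "x \<in> \<rat>" obtains q where "rat_val q = x"
  using assms surj_rat_decode by (metis Rats_cases surjD)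

lemma rat_val_dense: assumes "e > 0" shows "\<exists>q. \<bar>x - rat_val q\<bar> < e"
proof -
  obtain y where "y \<in> \<rat>" "x < y" "y < x + e" using Rats_dense_in_real[of x "x + e"] assms by auto
  then show ?thesis by (metis rat_val_surj abs_diff_less_iff less_add_same_cancel1 add.commute
        abs_minus_commute diff_less_eq assms less_trans)
qed

lemma computable_rat_rat_val: "computable f \<Longrightarrow> computable_rat (\<lambda>n. rat_val (f n))"
  by (rule computable_ratI[OF _ _ _ rat_val_eq]) (intro computable_intros computable_mod2 computable_div2; assumption)+

lemma computable_rat_const: "x \<in> \<rat> \<Longrightarrow> computable_rat (\<lambda>n. x)"
  using computable_rat_rat_val[OF computable_const] rat_val_surj by metis

lemma computable_rat_comp: assumes "computable_rat r" "computable f" shows "computable_rat (\<lambda>n. r (f n))"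
proof -
  obtain a b c where r: "computable a" "computable b" "computable c" "\<And>n. r n = (real (a n) - real (b n)) / (1 + real (c n))"
    using computable_ratE[OF assms(1)] by blast
  show ?thesis
    by (rule computable_ratI[OF computable_comp[OF r(1) assms(2)] computable_comp[OF r(2) assms(2)] computable_comp[OF r(3) assms(2)]])
       (rule r(4))
qed

lemma computable_rat_plus: assumes "computable_rat r" "computable_rat s" shows "computable_rat (\<lambda>n. r n + s n)"
proof -
  obtain a b c where r: "computable a" "computable b" "computable c" "\<And>n. r n = (real (a n) - real (b n)) / (1 + real (c n))"
    using computable_ratE[OF assms(1)] by blast
  obtain a' b' c' where s: "computable a'" "computable b'" "computable c'" "\<And>n. s n = (real (a' n) - real (b' n)) / (1 + real (c' n))"
    using computable_ratE[OF assms(2)] by blast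
  show ?thesis
  proof (rule computable_ratI)
    fix n
    have ne: "1 + real (c n) \<noteq> 0" "1 + real (c' n) \<noteq> 0" by linarith+
    have "1 + real (c n + c' n + c n * c' n) = (1 + real (c n)) * (1 + real (c' n))"
      by (simp add: algebra_simps)
    then show "r n + s n = (real (a n * Suc (c' n) + a' n * Suc (c n)) - real (b n * Suc (c' n) + b' n * Suc (c n)))
        / (1 + real (c n + c' n + c n * c' n))"
      unfolding r(4) s(4) add_frac_eq[OF ne] by (simp add: algebra_simps)
  qed (intro computable_intros r(1-3) s(1-3))+
qed

lemma computable_rat_times: assumes "computable_rat r" "computable_rat s" shows "computable_rat (\<lambda>n. r n * s n)"
proof -
  obtain a b c where r: "computable a" "computable b" "computable c" "\<And>n. r n = (real (a n) - real (b n)) / (1 + real (c n))"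
    using computable_ratE[OF assms(1)] by blast
  obtain a' b' c' where s: "computable a'" "computable b'" "computable c'" "\<And>n. s n = (real (a' n) - real (b' n)) / (1 + real (c' n))"
    using computable_ratE[OF assms(2)] by blast
  show ?thesis
    by (rule computable_ratI[of "\<lambda>n. a n * a' n + b n * b' n" "\<lambda>n. a n * b' n + b n * a' n"
          "\<lambda>n. c n + c' n + c n * c' n"])
       (auto simp: r(4) s(4) algebra_simps diff_divide_distrib add_divide_distrib
         intro!: computable_intros r(1-3) s(1-3))
qed

lemma computable_rat_uminus: assumes "computable_rat r" shows "computable_rat (\<lambda>n. - r n)"
  using computable_rat_times[OF computable_rat_const[of "-1"] assms] by simp

lemma computable_rat_diff: assumes "computable_rat r" "computable_rat s" shows "computable_rat (\<lambda>n. r n - s n)"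
  using computable_rat_plus[OF assms(1) computable_rat_uminus[OF assms(2)]] by simp

lemma computable_rat_half_power: assumes "computable f" shows "computable_rat (\<lambda>n. (1 / 2) ^ f n)"
  by (rule computable_ratI[of "\<lambda>_. 1" "\<lambda>_. 0" "\<lambda>n. 2 ^ f n - 1"])
     (auto intro!: computable_intros computable_power2 assms simp: of_nat_diff power_one_over)

lemmas computable_rat_intros = computable_rat_rat_val computable_rat_plus computable_rat_times computable_rat_uminus
  computable_rat_diff computable_rat_half_power

lemma computable_rat_Rats: "computable_rat r \<Longrightarrow> r n \<in> \<rat>"
  by (erule computable_ratE) simp

lemma semidecidable_rat_less: assumes "computable_rat r" "computable_rat s" shows "semidecidable (\<lambda>n. r n < s n)"
proof -
  obtain a b c where r: "computable a" "computable b" "computable c" "\<And>n. s n - r n = (real (a n) - real (b n)) / (1 + real (c n))"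
    using computable_ratE[OF computable_rat_diff[OF assms(2,1)]] by blast
  have "0 < 1 + real (c n)" for n by simp
  then have "r n < s n \<longleftrightarrow> b n < a n" for n using r(4)[of n] by (smt (verit) divide_le_0_iff of_nat_less_iff zero_less_divide_iff)
  then show ?thesis using semidecidable_less[OF r(2,1)] by simp
qed

lemma semidecidable_rat_eq: assumes "computable_rat r" "computable_rat s" shows "semidecidable (\<lambda>n. r n = s n)"
proof -
  obtain a b c where r: "computable a" "computable b" "computable c" "\<And>n. s n - r n = (real (a n) - real (b n)) / (1 + real (c n))"
    using computable_ratE[OF computable_rat_diff[OF assms(2,1)]] by blast
  have "0 < 1 + real (c n)" for n by simp
  then have "r n = s n \<longleftrightarrow> b n = a n" for n using r(4)[of n] by (smt (verit) divide_eq_0_iff of_nat_eq_iff)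
  then show ?thesis using semidecidable_eq[OF r(2,1)] by simp
qed

text \<open>The function is only constrained on \<open>S\<close>, because the norm oracle of a presentation is only
  meaningful on valid codes. The approximating relation may fail to have a value outside \<open>S\<close>, so
  totality of algorithms has to be restored at the very end.\<close>

definition computable_real_on :: "nat set \<Rightarrow> (nat \<Rightarrow> real) \<Rightarrow> bool" where
  "computable_real_on S u \<longleftrightarrow> (\<exists>R. semidecidable (\<lambda>z. R (p1 z) (p1 (p2 z)) (p2 (p2 z))) \<and>
     (\<forall>n\<in>S. \<forall>k. (\<exists>q. R n k q) \<and> (\<forall>q. R n k q \<longrightarrow> \<bar>u n - rat_val q\<bar> < (1 / 2) ^ k)))"

lemma computable_real_onI:
  assumes "semidecidable (\<lambda>z. R (p1 z) (p1 (p2 z)) (p2 (p2 z)))"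
    "\<And>n k. n \<in> S \<Longrightarrow> \<exists>q. R n k q" "\<And>n k q. n \<in> S \<Longrightarrow> R n k q \<Longrightarrow> \<bar>u n - rat_val q\<bar> < (1 / 2) ^ k"
  shows "computable_real_on S u"
  unfolding computable_real_on_def using assms by blast

lemma semidecidable3_comp:
  assumes "semidecidable (\<lambda>z. R (p1 z) (p1 (p2 z)) (p2 (p2 z)))" "computable a" "computable b" "computable c"
  shows "semidecidable (\<lambda>z. R (a z) (b z) (c z))"
  using semidecidable_comp[OF assms(1), of "\<lambda>z. pr (a z) (pr (b z) (c z))"] assms(2-) by (simp add: computable_pr)

lemma computable_real_onE:
  assumes "computable_real_on S u"
  obtains R where "\<And>a b c. computable a \<Longrightarrow> computable b \<Longrightarrow> computable c \<Longrightarrow> semidecidable (\<lambda>z. R (a z) (b z) (c z))"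
    "\<And>n k. n \<in> S \<Longrightarrow> \<exists>q. R n k q" "\<And>n k q. n \<in> S \<Longrightarrow> R n k q \<Longrightarrow> \<bar>u n - rat_val q\<bar> < (1 / 2) ^ k"
proof -
  obtain R where "semidecidable (\<lambda>z. R (p1 z) (p1 (p2 z)) (p2 (p2 z)))"
    "\<forall>n\<in>S. \<forall>k. (\<exists>q. R n k q) \<and> (\<forall>q. R n k q \<longrightarrow> \<bar>u n - rat_val q\<bar> < (1 / 2) ^ k)"
    using assms unfolding computable_real_on_def by blast
  then show thesis by (intro that[of R]) (blast intro: semidecidable3_comp)+
qed

lemma computable_real_on_rat: assumes "computable_rat u" shows "computable_real_on S u"
proof (rule computable_real_onI)
  show "semidecidable (\<lambda>z. u (p1 z) = rat_val (p2 (p2 z)))"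
    by (intro semidecidable_rat_eq computable_rat_comp[OF assms] computable_rat_rat_val computable_intros)
  show "\<exists>q. u n = rat_val q" for n using rat_val_surj computable_rat_Rats[OF assms] by metis
qed simp

lemma computable_real_on_comp:
  assumes "computable_real_on S u" "computable f" "\<And>n. n \<in> S' \<Longrightarrow> f n \<in> S"
  shows "computable_real_on S' (\<lambda>n. u (f n))"
proof -
  obtain R where R: "\<And>a b c. computable a \<Longrightarrow> computable b \<Longrightarrow> computable c \<Longrightarrow> semidecidable (\<lambda>z. R (a z) (b z) (c z))"
    "\<And>n k. n \<in> S \<Longrightarrow> \<exists>q. R n k q" "\<And>n k q. n \<in> S \<Longrightarrow> R n k q \<Longrightarrow> \<bar>u n - rat_val q\<bar> < (1 / 2) ^ k"
    using computable_real_onE[OF assms(1)] by blast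
  show ?thesis
  proof (rule computable_real_onI[of "\<lambda>n. R (f n)"])
    show "semidecidable (\<lambda>z. R (f (p1 z)) (p1 (p2 z)) (p2 (p2 z)))"
      by (intro R(1) computable_comp[OF assms(2)] computable_intros)
  qed (use R assms(3) in blast)+
qed

lemma computable_real_on_oracle:
  assumes "effective f" "\<And>n k. n \<in> S \<Longrightarrow> \<bar>u n - rat_val (f n k)\<bar> < (1 / 2) ^ k"
  shows "computable_real_on S u"
proof (rule computable_real_onI[of "\<lambda>n k q. q = f n k"])
  show "semidecidable (\<lambda>z. p2 (p2 z) = f (p1 z) (p1 (p2 z)))"
    by (intro semidecidable_eq computable_effective[OF assms(1)] computable_intros)
qed (use assms(2) in auto)

lemma computable_real_on_plus:
  assumes "computable_real_on S u" "computable_real_on S v" shows "computable_real_on S (\<lambda>n. u n + v n)"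
proof -
  obtain R where R: "\<And>a b c. computable a \<Longrightarrow> computable b \<Longrightarrow> computable c \<Longrightarrow> semidecidable (\<lambda>z. R (a z) (b z) (c z))"
    "\<And>n k. n \<in> S \<Longrightarrow> \<exists>q. R n k q" "\<And>n k q. n \<in> S \<Longrightarrow> R n k q \<Longrightarrow> \<bar>u n - rat_val q\<bar> < (1 / 2) ^ k"
    using computable_real_onE[OF assms(1)] by blast
  obtain R' where R': "\<And>a b c. computable a \<Longrightarrow> computable b \<Longrightarrow> computable c \<Longrightarrow> semidecidable (\<lambda>z. R' (a z) (b z) (c z))"
    "\<And>n k. n \<in> S \<Longrightarrow> \<exists>q. R' n k q" "\<And>n k q. n \<in> S \<Longrightarrow> R' n k q \<Longrightarrow> \<bar>v n - rat_val q\<bar> < (1 / 2) ^ k"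
    using computable_real_onE[OF assms(2)] by blast
  show ?thesis
  proof (rule computable_real_onI[of "\<lambda>n k q. \<exists>q1 q2. R n (Suc k) q1 \<and> R' n (Suc k) q2 \<and> rat_val q = rat_val q1 + rat_val q2"])
    show "semidecidable (\<lambda>z. \<exists>q1 q2. R (p1 z) (Suc (p1 (p2 z))) q1 \<and> R' (p1 z) (Suc (p1 (p2 z))) q2 \<and>
              rat_val (p2 (p2 z)) = rat_val q1 + rat_val q2)"
      by (intro semidecidable_ex semidecidable_conj R R' semidecidable_rat_eq computable_rat_intros computable_intros)
    fix n k assume n: "n \<in> S"
    then obtain q1 q2 where "R n (Suc k) q1" "R' n (Suc k) q2" using R(2) R'(2) by meson
    moreover obtain q where "rat_val q = rat_val q1 + rat_val q2"
      by (metis rat_val_surj Rats_add Rats_of_rat)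
    ultimately show "\<exists>q q1 q2. R n (Suc k) q1 \<and> R' n (Suc k) q2 \<and> rat_val q = rat_val q1 + rat_val q2" by blast
    fix q assume "\<exists>q1 q2. R n (Suc k) q1 \<and> R' n (Suc k) q2 \<and> rat_val q = rat_val q1 + rat_val q2"
    then obtain q1 q2 where "R n (Suc k) q1" "R' n (Suc k) q2" and q: "rat_val q = rat_val q1 + rat_val q2" by blast
    then have "\<bar>u n - rat_val q1\<bar> < (1 / 2) ^ Suc k" "\<bar>v n - rat_val q2\<bar> < (1 / 2) ^ Suc k"
      using R(3) R'(3) n by blast+
    then show "\<bar>u n + v n - rat_val q\<bar> < (1 / 2) ^ k" unfolding q power_Suc by argo
  qed
qed

text \<open>The bound is a polynomial in the approximations, so that it can itself be evaluated as a
  computable rational; \<open>\<bar>c\<bar> \<le> c * c + 1\<close> removes the absolute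
  values.\<close>

lemma approx_times:
  fixes x y a b e :: real
  assumes x: "\<bar>x - a\<bar> < e" and y: "\<bar>y - b\<bar> < e" and e: "e \<le> 1"
  shows "\<bar>x * y - a * b\<bar> \<le> e * (a * a + b * b + 3)"
proof -
  have e0: "0 \<le> e" using x by linarith
  have sq: "\<bar>c\<bar> \<le> c * c + 1" for c :: real
  proof -
    have "0 \<le> (\<bar>c\<bar> - 1)\<^sup>2" by simp
    then have "2 * \<bar>c\<bar> \<le> c * c + 1" by (simp add: power2_eq_square algebra_simps)
    then show ?thesis by linarith
  qed
  have "x * y - a * b = (x - a) * (y - b) + (x - a) * b + a * (y - b)" by (simp add: algebra_simps)
  then have "\<bar>x * y - a * b\<bar> \<le> \<bar>(x - a) * (y - b)\<bar> + \<bar>(x - a) * b\<bar> + \<bar>a * (y - b)\<bar>" by linarith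
  also have "\<dots> \<le> e * 1 + e * \<bar>b\<bar> + \<bar>a\<bar> * e"
    unfolding abs_mult using x y e e0 by (intro add_mono mult_mono) auto
  also have "\<dots> = e * (1 + \<bar>b\<bar> + \<bar>a\<bar>)" by (simp add: algebra_simps)
  also have "\<dots> \<le> e * (a * a + b * b + 3)"
    using sq[of a] sq[of b] e0 by (intro mult_left_mono) auto
  finally show ?thesis .
qed

lemma computable_real_on_times:
  assumes "computable_real_on S u" "computable_real_on S v" shows "computable_real_on S (\<lambda>n. u n * v n)"
proof -
  obtain R where R: "\<And>a b c. computable a \<Longrightarrow> computable b \<Longrightarrow> computable c \<Longrightarrow> semidecidable (\<lambda>z. R (a z) (b z) (c z))"
    "\<And>n k. n \<in> S \<Longrightarrow> \<exists>q. R n k q" "\<And>n k q. n \<in> S \<Longrightarrow> R n k q \<Longrightarrow> \<bar>u n - rat_val q\<bar> < (1 / 2) ^ k"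
    using computable_real_onE[OF assms(1)] by blast
  obtain R' where R': "\<And>a b c. computable a \<Longrightarrow> computable b \<Longrightarrow> computable c \<Longrightarrow> semidecidable (\<lambda>z. R' (a z) (b z) (c z))"
    "\<And>n k. n \<in> S \<Longrightarrow> \<exists>q. R' n k q" "\<And>n k q. n \<in> S \<Longrightarrow> R' n k q \<Longrightarrow> \<bar>v n - rat_val q\<bar> < (1 / 2) ^ k"
    using computable_real_onE[OF assms(2)] by blast
  \<comment> \<open>The precision needed for the factors depends on their size, which is not known
    in advance, so \<open>j\<close> is part of the search and its adequacy is judged from the
    approximations alone. The constant 3 is written through a code of it so that the closure rules
    for \<open>rat_val\<close> apply.\<close>
  define T where "T n k q \<longleftrightarrow> (\<exists>q1 q2 j. R n j q1 \<and> R' n j q2 \<and>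
     (1 / 2) ^ j * (rat_val q1 * rat_val q1 + rat_val q2 * rat_val q2 + rat_val (pr 6 0)) < (1 / 2) ^ k \<and> rat_val q = rat_val q1 * rat_val q2)" for n k q
  have three: "rat_val (pr 6 0) = 3" by (simp add: rat_val_eq)
  show ?thesis
  proof (rule computable_real_onI[of T])
    show "semidecidable (\<lambda>z. T (p1 z) (p1 (p2 z)) (p2 (p2 z)))" unfolding T_def
      by (intro semidecidable_ex semidecidable_conj R R' semidecidable_rat_eq semidecidable_rat_less computable_rat_intros computable_intros)
    fix n k assume n: "n \<in> S"
    define B where "B = (\<bar>u n\<bar> + 1)\<^sup>2 + (\<bar>v n\<bar> + 1)\<^sup>2 + 3"
    have B: "B > 0" unfolding B_def by (simp add: add_nonneg_pos)
    obtain j where j: "(1 / 2) ^ j < (1 / 2) ^ k / B"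
      using real_arch_pow_inv[of "(1 / 2) ^ k / B" "1 / 2"] B by auto
    obtain q1 q2 where q12: "R n j q1" "R' n j q2" using R(2) R'(2) n by meson
    obtain q where q: "rat_val q = rat_val q1 * rat_val q2"
      by (metis rat_val_surj Rats_mult Rats_of_rat)
    have le1: "(1 / 2) ^ j \<le> (1 :: real)" by (simp add: power_le_one)
    have "\<bar>u n - rat_val q1\<bar> < (1 / 2) ^ j" "\<bar>v n - rat_val q2\<bar> < (1 / 2) ^ j"
      using q12 R(3) R'(3) n by blast+
    then have "\<bar>rat_val q1\<bar> \<le> \<bar>\<bar>u n\<bar> + 1\<bar>" "\<bar>rat_val q2\<bar> \<le> \<bar>\<bar>v n\<bar> + 1\<bar>" using le1 by linarith+
    then have "rat_val q1 * rat_val q1 + rat_val q2 * rat_val q2 + 3 \<le> B"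
      unfolding B_def power2_eq_square[symmetric] abs_le_square_iff by linarith
    then have "(1 / 2) ^ j * (rat_val q1 * rat_val q1 + rat_val q2 * rat_val q2 + 3) \<le> (1 / 2) ^ j * B"
      by (intro mult_left_mono) auto
    also have "\<dots> < (1 / 2) ^ k" using j B by (simp add: pos_less_divide_eq)
    finally show "\<exists>q. T n k q" unfolding T_def three using q q12 by blast
    fix q assume "T n k q"
    then obtain q1 q2 j where q12: "R n j q1" "R' n j q2" and q: "rat_val q = rat_val q1 * rat_val q2"
      and j: "(1 / 2) ^ j * (rat_val q1 * rat_val q1 + rat_val q2 * rat_val q2 + 3) < (1 / 2) ^ k"
      unfolding T_def three by blast
    have "\<bar>u n - rat_val q1\<bar> < (1 / 2) ^ j" "\<bar>v n - rat_val q2\<bar> < (1 / 2) ^ j"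
      using q12 R(3) R'(3) n by blast+
    from approx_times[OF this] j show "\<bar>u n * v n - rat_val q\<bar> < (1 / 2) ^ k"
      unfolding q by (simp add: power_le_one)
  qed
qed

lemma computable_real_on_rat_const: "x \<in> \<rat> \<Longrightarrow> computable_real_on S (\<lambda>n. x)" by (intro computable_real_on_rat computable_rat_const)

lemma computable_real_on_uminus: assumes "computable_real_on S u" shows "computable_real_on S (\<lambda>n. - u n)"
  using computable_real_on_times[OF computable_real_on_rat_const[of "-1"] assms] by simp

lemma computable_real_on_diff: assumes "computable_real_on S u" "computable_real_on S v" shows "computable_real_on S (\<lambda>n. u n - v n)"
  using computable_real_on_plus[OF assms(1) computable_real_on_uminus[OF assms(2)]] by simp

lemma computable_real_on_sum: "(\<And>i. i \<in> I \<Longrightarrow> computable_real_on S (u i)) \<Longrightarrow> computable_real_on S (\<lambda>n. \<Sum>i\<in>I. u i n)"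
  by (induction I rule: infinite_finite_induct) (auto intro: computable_real_on_rat_const computable_real_on_plus)

lemma computable_real_on_rat_val: "computable f \<Longrightarrow> computable_real_on S (\<lambda>n. rat_val (f n))" by (intro computable_real_on_rat computable_rat_rat_val)

text \<open>A strict inequality is confirmed once some approximation of the difference exceeds its
  own error bound; an error below half of the gap is enough for that.\<close>

lemma computable_real_on_less:
  assumes "computable_real_on S u" "computable_real_on S v" shows "\<exists>W. semidecidable W \<and> (\<forall>n\<in>S. W n \<longleftrightarrow> u n < v n)"
proof -
  obtain R where R: "\<And>a b c. computable a \<Longrightarrow> computable b \<Longrightarrow> computable c \<Longrightarrow> semidecidable (\<lambda>z. R (a z) (b z) (c z))"
    "\<And>n k. n \<in> S \<Longrightarrow> \<exists>q. R n k q" "\<And>n k q. n \<in> S \<Longrightarrow> R n k q \<Longrightarrow> \<bar>v n - u n - rat_val q\<bar> < (1 / 2) ^ k"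
    using computable_real_onE[OF computable_real_on_diff[OF assms(2,1)]] by blast
  define W where "W n \<longleftrightarrow> (\<exists>k q. R n k q \<and> (1 / 2) ^ k < rat_val q)" for n
  have "semidecidable (\<lambda>n. W n)" unfolding W_def by (intro semidecidable_ex semidecidable_conj R semidecidable_rat_less computable_rat_intros computable_intros)
  moreover have "W n \<longleftrightarrow> u n < v n" if n: "n \<in> S" for n
  proof
    assume "W n" then show "u n < v n" unfolding W_def using R(3)[OF n] by (smt (verit))
  next
    assume "u n < v n"
    then obtain k where k: "(1 / 2) ^ k < (v n - u n) / 2"
      using real_arch_pow_inv[of "(v n - u n) / 2" "1 / 2"] by auto
    obtain q where q: "R n k q" using R(2) n by blast
    from R(3)[OF n q] k have "(1 / 2) ^ k < rat_val q" by argo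
    then show "W n" using q unfolding W_def by blast
  qed
  ultimately show ?thesis by blast
qed

lemma computable_real_on_abs_less:
  assumes "computable_real_on S u" "computable_real_on S v" shows "\<exists>W. semidecidable W \<and> (\<forall>n\<in>S. W n \<longleftrightarrow> \<bar>u n\<bar> < v n)"
proof -
  obtain W W' where W: "semidecidable W" "\<forall>n\<in>S. W n \<longleftrightarrow> u n < v n" "semidecidable W'" "\<forall>n\<in>S. W' n \<longleftrightarrow> - u n < v n"
    using computable_real_on_less[OF assms] computable_real_on_less[OF computable_real_on_uminus[OF assms(1)] assms(2)] by metis
  show ?thesis by (rule exI[of _ "\<lambda>n. W n \<and> W' n"]) (use W in \<open>auto intro: semidecidable_conj\<close>)
qed

text \<open>The constant \<open>C\<close> costs only a shift of the index: with
  \<open>C < 2 ^ c\<close>, the approximation number \<open>k + c\<close> has error below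
  \<open>(1 / 2) ^ k\<close>.\<close>

lemma computable_real_on_limit:
  assumes "computable t" "\<And>k. \<bar>x - rat_val (t k)\<bar> \<le> C * (1 / 2) ^ k"
  shows "computable_real_on S (\<lambda>_. x)"
proof -
  obtain c :: nat where c: "C < 2 ^ c" using real_arch_pow[of 2 C] by auto
  have "\<bar>x - rat_val (t (k + c))\<bar> < (1 / 2) ^ k" for k
  proof -
    have "C * (1 / 2) ^ (k + c) < 2 ^ c * (1 / 2) ^ (k + c)" using c by (intro mult_strict_right_mono) auto
    also have "\<dots> = (1 / 2) ^ k" by (simp add: power_add power_one_over)
    finally show ?thesis using assms(2)[of "k + c"] by linarith
  qed
  then show ?thesis
    by (intro computable_real_on_oracle[of "\<lambda>n k. t (k + c)"]) (auto simp: effective_iff intro!: computable_comp[OF assms(1)] computable_intros)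
qed

text \<open>A number is read as an endless sequence by repeated unpairing. Every number thus codes a
  vector of every length, and searches over vectors or matrices need no test for well-formed
  codes.\<close>

fun component :: "nat \<Rightarrow> nat \<Rightarrow> nat" where
  "component 0 s = p1 s"
| "component (Suc i) s = component i (p2 s)"

lemma computable_component: "computable f \<Longrightarrow> computable (\<lambda>x. component i (f x))"
  by (induction i arbitrary: f) (auto intro: computable_intros)

lemma component_surj: "\<exists>s. \<forall>i<n. component i s = f i"
proof (induction n arbitrary: f)
  case (Suc n)
  then obtain s where "\<forall>i<n. component i s = f (Suc i)" by meson
  then have "\<forall>i<Suc n. component i (pr (f 0) s) = f i" by (auto simp: less_Suc_eq_0_disj)
  then show ?case by blast
qed simp

lemma component_dense:
  assumes "e > 0" shows "\<exists>s. \<forall>i<n. \<bar>f i - rat_val (component i s)\<bar> < e"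
proof -
  have "\<forall>i. \<exists>q. \<bar>f i - rat_val q\<bar> < e" using rat_val_dense[OF assms] by blast
  then obtain q where q: "\<And>i. \<bar>f i - rat_val (q i)\<bar> < e" by metis
  obtain s where "\<forall>i<n. component i s = q i" using component_surj by blast
  then show ?thesis using q by (intro exI[of _ s]) simp
qed

section \<open>Approximate automorphisms of finite-dimensional *-algebras\<close>

definition near :: "('a::real_normed_vector \<Rightarrow> 'a) \<Rightarrow> ('a \<Rightarrow> 'a) \<Rightarrow> real \<Rightarrow> bool" where
  "near S T r \<longleftrightarrow> (\<forall>x. norm (S x - T x) \<le> r * norm x)"

definition mult_defect :: "('a::real_normed_algebra \<Rightarrow> 'a) \<Rightarrow> 'a \<Rightarrow> 'a \<Rightarrow> 'a" where
  "mult_defect T x y = T (x * y) - T x * T y"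

lemma nearD: "near S T r \<Longrightarrow> norm (S x - T x) \<le> r * norm x"
  by (simp add: near_def)

lemma norm_mult_le:
  fixes a b :: "'a::real_normed_algebra"
  shows "norm a \<le> A \<Longrightarrow> norm b \<le> B \<Longrightarrow> norm (a * b) \<le> A * B"
  by (meson norm_ge_zero norm_mult_ineq mult_mono order_trans)

lemma norm_triangle5:
  fixes a :: "'a::real_normed_vector"
  shows "norm (a + b - c - d - f) \<le> norm a + norm b + norm c + norm d + norm f"
  using norm_triangle_ineq4[of "a + b - c - d" f] norm_triangle_ineq4[of "a + b - c" d]
    norm_triangle_ineq4[of "a + b" c] norm_triangle_ineq[of a b] by linarith

text \<open>The product \<open>T x * T y\<close> is quadratic in \<open>T\<close>, so averaging two
  maps averages their defects up to a term quadratic in their difference. This is why restoring a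
  symmetry by averaging does no harm to first order.\<close>

lemma mult_defect_average:
  assumes S: "\<And>x. S x = (1 / 2) *\<^sub>R (A x + B x)"
  shows "mult_defect S x y = (1 / 2) *\<^sub>R (mult_defect A x y + mult_defect B x y)
    + (1 / 4) *\<^sub>R ((A x - B x) * (A y - B y))"
proof -
  have "4 *\<^sub>R mult_defect S x y = 4 *\<^sub>R ((1 / 2) *\<^sub>R (mult_defect A x y + mult_defect B x y)
    + (1 / 4) *\<^sub>R ((A x - B x) * (A y - B y)))"
    unfolding mult_defect_def S by (simp add: algebra_simps scaleR_2[symmetric])
  then show ?thesis by simp
qed

lemma mult_defect_add:
  assumes S: "\<And>x. S x = T x + D x"
  shows "mult_defect S x y = mult_defect T x y + D (x * y) - T x * D y - D x * T y - D x * D y"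
  unfolding mult_defect_def S by (simp add: algebra_simps)

text \<open>Both ground fields are handled over the reals: \<open>J\<close> is multiplication by \<open>\<i>\<close> with \<open>\<epsilon> = -1\<close> in the complex
  case and the identity with \<open>\<epsilon> = 1\<close> in the real case.\<close>

locale fd_star_algebra =
  fixes star J :: "'a::real_normed_algebra \<Rightarrow> 'a" and \<epsilon> :: real
    and ip :: "'a \<Rightarrow> 'a \<Rightarrow> real" and N :: nat and e :: "nat \<Rightarrow> 'a" and c :: real
  assumes linear_star: "linear star" and star_mult: "star (x * y) = star y * star x"
    and star_star [simp]: "star (star x) = x" and norm_star [simp]: "norm (star x) = norm x"
    and star_proper: "star x * x = 0 \<Longrightarrow> x = 0"
    and linear_J: "linear J" and norm_J [simp]: "norm (J x) = norm x"
    and J_mult_right: "x * J y = J (x * y)"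
    and J_J: "J (J x) = \<epsilon> *\<^sub>R x" and \<epsilon>: "\<epsilon> = 1 \<or> \<epsilon> = -1"
    and star_J: "star (J x) = \<epsilon> *\<^sub>R J (star x)"
    and ip_add: "ip (x + y) z = ip x z + ip y z" and ip_scaleR: "ip (r *\<^sub>R x) y = r * ip x y"
    and ip_commute: "ip x y = ip y x" and ip_pos: "x \<noteq> 0 \<Longrightarrow> 0 < ip x x"
    and ip_mult: "ip (a * x) y = ip x (star a * y)"
    and ip_bound: "ip x x \<le> c * (norm x)\<^sup>2"
    and expansion: "x = (\<Sum>i<N. ip x (e i) *\<^sub>R e i)"
begin

lemma linear_ip: "linear (\<lambda>x. ip x y)"
  by (rule linearI) (simp_all add: ip_add ip_scaleR)

lemma ip_scaleR_right: "ip x (r *\<^sub>R y) = r * ip x y"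
  by (metis ip_commute ip_scaleR)

lemma ip_nonneg: "0 \<le> ip x x"
  using ip_pos[of x] ip_scaleR[of 0 x x] by (cases "x = 0") auto

lemma ip_cauchy: "(ip x y)\<^sup>2 \<le> ip x x * ip y y"
proof (cases "y = 0")
  case True
  then show ?thesis using ip_scaleR_right[of x 0 0] ip_scaleR[of 0 0 0] by simp
next
  case False
  define z where "z = ip y y *\<^sub>R x + (- ip x y) *\<^sub>R y"
  have add_r: "ip a (b + d) = ip a b + ip a d" for a b d by (metis ip_add ip_commute)
  have "ip z z = ip y y * (ip x x * ip y y - (ip x y)\<^sup>2)"
    unfolding z_def ip_add add_r ip_scaleR ip_scaleR_right
    by (simp add: ip_commute[of y x] power2_eq_square algebra_simps)
  then show ?thesis using ip_nonneg[of z] ip_pos[OF False] by (simp add: zero_le_mult_iff)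
qed

text \<open>The coordinates are bounded by Cauchy-Schwarz, so no compactness argument is needed.\<close>

lemma linear_bounded:
  fixes f :: "'a \<Rightarrow> 'b::real_normed_vector"
  assumes "linear f"
  shows "\<exists>C>0. \<forall>x. norm (f x) \<le> C * norm x"
proof -
  define C where "C = (\<Sum>i<N. sqrt (\<bar>c\<bar> * ip (e i) (e i)) * norm (f (e i)))"
  have C: "C \<ge> 0" unfolding C_def by (intro sum_nonneg mult_nonneg_nonneg) (auto simp: ip_nonneg)
  have coord: "\<bar>ip x y\<bar> \<le> sqrt (\<bar>c\<bar> * ip y y) * norm x" for x y
  proof -
    have "(ip x y)\<^sup>2 \<le> (c * (norm x)\<^sup>2) * ip y y"
      using ip_cauchy[of x y] ip_bound[of x] ip_nonneg[of y] by (meson mult_right_mono order_trans)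
    also have "\<dots> \<le> (\<bar>c\<bar> * (norm x)\<^sup>2) * ip y y"
      using ip_nonneg[of y] by (intro mult_right_mono) auto
    finally have "sqrt ((ip x y)\<^sup>2) \<le> sqrt ((\<bar>c\<bar> * ip y y) * (norm x)\<^sup>2)"
      by (intro real_sqrt_le_mono) (simp add: mult_ac)
    then show ?thesis by (simp add: real_sqrt_mult)
  qed
  have "norm (f x) \<le> C * norm x" for x
  proof -
    have "f x = (\<Sum>i<N. ip x (e i) *\<^sub>R f (e i))"
      using arg_cong[OF expansion[of x], of f] by (simp add: linear_sum[OF assms] linear_scale[OF assms])
    also have "norm \<dots> \<le> (\<Sum>i<N. \<bar>ip x (e i)\<bar> * norm (f (e i)))"
      by (rule norm_sum[THEN order_trans]) simp
    also have "\<dots> \<le> (\<Sum>i<N. (sqrt (\<bar>c\<bar> * ip (e i) (e i)) * norm x) * norm (f (e i)))"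
      by (intro sum_mono mult_right_mono coord) auto
    finally show ?thesis unfolding C_def by (simp add: sum_distrib_right sum_distrib_left mult_ac)
  qed
  then have "norm (f x) \<le> (C + 1) * norm x" for x
    by (smt (verit) mult_right_mono norm_ge_zero)
  then show ?thesis using C by (intro exI[of _ "C + 1"]) auto
qed

lemma linear_continuous: assumes "linear (f :: 'a \<Rightarrow> 'b::real_normed_vector)" shows "continuous_on S f"
proof -
  obtain C where "\<forall>x. norm (f x) \<le> C * norm x" using linear_bounded[OF assms] by blast
  then have "bounded_linear f"
    using assms by (intro bounded_linear_intro[of f C])
      (auto simp: linear_add linear_scale mult.commute)
  then show ?thesis by (simp add: linear_continuous_on)
qed

text \<open>A linear left inverse of the inclusion is a projection onto \<open>W\<close>. It is
  continuous, and \<open>W\<close> is the closed set of its fixed points.\<close>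

lemma subspace_closed: assumes "subspace (W :: 'a set)" shows "closed W"
proof -
  have "\<exists>g\<in>{g. linear g}. g ` UNIV \<subseteq> W \<and> (\<forall>v\<in>W. g (id v) = v)"
    using real_vector.linear_exists_left_inverse_on[of id W] assms linear_id by auto
  then obtain g :: "'a \<Rightarrow> 'a" where g: "linear g" "\<And>x. g x \<in> W" "\<And>x. x \<in> W \<Longrightarrow> g x = x"
    by auto
  have "W = {x. g x = x}" using g(2,3) by (auto, metis)
  also have "closed \<dots>" by (intro closed_Collect_eq linear_continuous g continuous_on_id)
  finally show ?thesis .
qed

lemma span_expansion: "span (e ` {..<N}) = UNIV"
proof -
  have "(\<Sum>i<N. ip x (e i) *\<^sub>R e i) \<in> span (e ` {..<N})" for x
    by (intro span_sum span_scale span_base) auto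
  then show ?thesis using expansion by auto
qed

lemma linear_inj_surj: assumes "linear (f :: 'a \<Rightarrow> 'a)" "inj f" shows "surj f"
proof -
  obtain B :: "'a set" where B: "B \<subseteq> e ` {..<N}" "independent B" "span B = UNIV"
    using real_vector.basis_exists[of "e ` {..<N}"] span_expansion
    by (metis real_vector.span_mono real_vector.span_span top.extremum_uniqueI)
  have "finite B" using B(1) finite_subset by blast
  then interpret F: finite_dimensional_vector_space "(*\<^sub>R) :: real \<Rightarrow> 'a \<Rightarrow> 'a" B
    by unfold_locales (use B in \<open>auto simp: dependent_raw_def span_raw_def\<close>)
  show ?thesis using F.linear_inj_imp_surj assms unfolding linear_def by blast
qed

text \<open>The sum of the \<open>e i \<otimes> star (e i)\<close> intertwines left and right multiplication for every
  orthonormal basis, since left multiplication by \<open>x\<close> has adjoint left multiplication by \<open>star x\<close>.\<close>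

lemma casimir:
  assumes "bilinear \<beta>"
  shows "(\<Sum>i<N. \<beta> (x * e i) (star (e i))) = (\<Sum>i<N. \<beta> (e i) (star (e i) * x))"
proof -
  have l: "linear (\<lambda>x. \<beta> x y)" "linear (\<beta> x)" for x y using assms by (simp_all add: bilinear_def)
  have "\<beta> (x * e i) (star (e i)) = (\<Sum>j<N. ip (x * e i) (e j) *\<^sub>R \<beta> (e j) (star (e i)))" for i
    using arg_cong[OF expansion[of "x * e i"], of "\<lambda>z. \<beta> z (star (e i))"]
    by (simp add: linear_sum[OF l(1)] linear_scale[OF l(1)])
  moreover have "\<beta> (e j) (star (e j) * x) = (\<Sum>i<N. ip (x * e i) (e j) *\<^sub>R \<beta> (e j) (star (e i)))" for j
  proof -
    have "star (e j) * x = star (star x * e j)" by (simp add: star_mult)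
    also have "\<dots> = (\<Sum>i<N. ip (star x * e j) (e i) *\<^sub>R star (e i))"
      using arg_cong[OF expansion[of "star x * e j"], of star]
      by (simp add: linear_sum[OF linear_star] linear_scale[OF linear_star])
    finally have "\<beta> (e j) (star (e j) * x) = (\<Sum>i<N. ip (star x * e j) (e i) *\<^sub>R \<beta> (e j) (star (e i)))"
      by (simp add: linear_sum[OF l(2)] linear_scale[OF l(2)])
    moreover have "ip (star x * e j) (e i) = ip (x * e i) (e j)" for i
      using ip_mult[of "star x" "e j" "e i"] ip_commute by simp
    ultimately show ?thesis by simp
  qed
  ultimately show ?thesis by simp (rule sum.swap)
qed

text \<open>The sum of the products \<open>e i * star (e i)\<close> is central, and multiplication
  by it is injective, hence bijective. Multiplying the second factors of the Casimir element by the
  inverse \<open>v\<close> of this sum makes the product the unit and keeps the intertwining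
  property, since \<open>v\<close> is central too.\<close>

lemma separability:
  "\<exists>f. (\<forall>\<beta>::'a \<Rightarrow> 'a \<Rightarrow> 'a. bilinear \<beta> \<longrightarrow> (\<forall>x. (\<Sum>i<N. \<beta> (x * e i) (f i)) = (\<Sum>i<N. \<beta> (e i) (f i * x))))
     \<and> (\<forall>x. (\<Sum>i<N. e i * f i) * x = x)"
proof -
  define u where "u = (\<Sum>i<N. e i * star (e i))"
  have u_central: "x * u = u * x" for x
    using casimir[of "(*)" x] by (simp add: u_def sum_distrib_left sum_distrib_right mult.assoc
        bilinear_def linear_iff distrib_left distrib_right)
  have u_inj: "x = 0" if "u * x = 0" for x
  proof -
    \<comment> \<open>A sum of squares vanishes, so every \<open>star (e i)\<close> annihilates
      \<open>x\<close>; since \<open>star x\<close> is a combination of these,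
      \<open>star x * x = 0\<close>.\<close>
    have "0 = ip (u * x) x" using that ip_scaleR[of 0 0 x] by simp
    also have "\<dots> = (\<Sum>i<N. ip (star (e i) * x) (star (e i) * x))"
      by (simp add: u_def sum_distrib_right linear_sum[OF linear_ip] mult.assoc ip_mult)
    finally have "\<forall>i<N. ip (star (e i) * x) (star (e i) * x) = 0"
      using sum_nonneg_eq_0_iff[of "{..<N}" "\<lambda>i. ip (star (e i) * x) (star (e i) * x)"]
      by (auto simp: ip_nonneg)
    then have z: "star (e i) * x = 0" if "i < N" for i
      using that ip_pos[of "star (e i) * x"] by force
    have "star x * x = (\<Sum>i<N. ip x (e i) *\<^sub>R (star (e i) * x))"
      by (subst (1) expansion) (simp add: linear_sum[OF linear_star] linear_scale[OF linear_star] sum_distrib_right)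
    also have "\<dots> = 0" by (simp add: z)
    finally show "x = 0" by (rule star_proper)
  qed
  have lin_u: "linear ((*) u)" by (rule linearI) (auto simp: distrib_left)
  have "inj ((*) u)" using u_inj linear_injective_0[OF lin_u] by blast
  then have surj: "surj ((*) u)" using linear_inj_surj[OF lin_u] by blast
  \<comment> \<open>The algebra is not assumed to be unital. A solution of \<open>u * w = u\<close>
    is a left unit because multiplication by \<open>u\<close> is injective, and it equals its
    adjoint, which is a right unit.\<close>
  then obtain w where w: "u * w = u" by (metis surjD)
  have w_left: "w * x = x" for x
    using u_inj[of "w * x - x"] w by (simp add: right_diff_distrib flip: mult.assoc)
  have w_right: "x * w = x" for x
  proof -
    have r: "x * star w = x" for x
      by (metis star_mult star_star w_left)
    then have "w = star w" using w_left by metis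
    then show ?thesis using r by metis
  qed
  obtain v where v: "u * v = w" using surj by (metis surjD)
  have v_central: "x * v = v * x" for x
  proof -
    have "u * (x * v - v * x) = x * (u * v) - (u * v) * x"
      by (simp add: right_diff_distrib mult.assoc[symmetric] u_central)
    also have "\<dots> = 0" by (simp add: v w_left w_right)
    finally show ?thesis using u_inj by fastforce
  qed
  show ?thesis
  proof (intro exI[of _ "\<lambda>i. star (e i) * v"] conjI allI impI)
    fix \<beta> :: "'a \<Rightarrow> 'a \<Rightarrow> 'a" and x assume "bilinear \<beta>"
    then have "bilinear (\<lambda>a b. \<beta> a (b * v))"
      by (simp add: bilinear_def linear_iff distrib_right)
    from casimir[OF this, of x]
    show "(\<Sum>i<N. \<beta> (x * e i) (star (e i) * v)) = (\<Sum>i<N. \<beta> (e i) (star (e i) * v * x))"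
      by (simp add: mult.assoc v_central)
  next
    fix x
    have "(\<Sum>i<N. e i * (star (e i) * v)) = u * v"
      by (simp add: u_def sum_distrib_right mult.assoc)
    then show "(\<Sum>i<N. e i * (star (e i) * v)) * x = x" by (simp add: v w_left)
  qed
qed

definition defect_le :: "('a \<Rightarrow> 'a) \<Rightarrow> real \<Rightarrow> bool" where
  "defect_le T \<eta> \<longleftrightarrow> (\<forall>x y. norm (mult_defect T x y) \<le> \<eta> * (norm x * norm y)) \<and>
     (\<forall>x. norm (T (star x) - star (T x)) \<le> \<eta> * norm x) \<and> (\<forall>x. norm (T (J x) - J (T x)) \<le> \<eta> * norm x)"

definition star_J_linear :: "('a \<Rightarrow> 'a) \<Rightarrow> bool" where
  "star_J_linear T \<longleftrightarrow> linear T \<and> (\<forall>x. T (star x) = star (T x)) \<and> (\<forall>x. T (J x) = J (T x))"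

text \<open>Conjugation by the involution preserves commutation with \<open>J\<close>: the factor
  \<epsilon> of \<open>star_J\<close> occurs twice and cancels.\<close>

lemma star_average:
  assumes T: "linear T" and TJ: "\<And>x. T (J x) = J (T x)"
  shows "star_J_linear (\<lambda>x. (1 / 2) *\<^sub>R (T x + star (T (star x))))"
proof -
  note lin = linear_add[OF T] linear_scale[OF T] linear_add[OF linear_star] linear_scale[OF linear_star]
    linear_add[OF linear_J] linear_scale[OF linear_J]
  have "star (T (star (J x))) = J (star (T (star x)))" for x
    using \<epsilon> by (auto simp: star_J lin TJ)
  then show ?thesis unfolding star_J_linear_def
    by (auto intro!: linearI simp: lin TJ algebra_simps)
qed

text \<open>On linear maps, \<open>T \<mapsto> \<epsilon> J T J\<close> and \<open>T \<mapsto> star T star\<close> are commuting involutions (\<open>J\<close> has inverse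
  \<open>\<epsilon> J\<close>), so averaging over both makes \<open>T\<close> compatible with \<open>J\<close> and the involution.\<close>

lemma symmetrize:
  assumes T: "linear T" and nr: "near T (\<lambda>x. x) 1" and df: "defect_le T \<eta>" and \<eta>: "0 \<le> \<eta>" "\<eta> \<le> 1"
  shows "\<exists>S. star_J_linear S \<and> near S T (2 * \<eta>) \<and> (\<forall>x y. norm (mult_defect S x y) \<le> 15 * \<eta> * (norm x * norm y))"
proof -
  note lin = linear_add[OF T] linear_scale[OF T] linear_add[OF linear_star] linear_scale[OF linear_star]
    linear_add[OF linear_J] linear_scale[OF linear_J] linear_diff[OF linear_J] linear_diff[OF linear_star]
  define T1 where "T1 x = (1 / 2) *\<^sub>R (T x + \<epsilon> *\<^sub>R J (T (J x)))" for x
  have T1: "linear T1" unfolding T1_def by (rule linearI) (auto simp: lin algebra_simps)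
  have T1J: "T1 (J x) = J (T1 x)" for x
    using \<epsilon> unfolding T1_def by (auto simp: lin J_J linear_neg[OF T] linear_neg[OF linear_J] algebra_simps)
  have near1: "norm (T1 x - T x) \<le> \<eta> / 2 * norm x" for x
  proof -
    have "T1 x - T x = (\<epsilon> / 2) *\<^sub>R J (T (J x) - J (T x))"
      using \<epsilon> unfolding T1_def by (auto simp: lin J_J algebra_simps) (simp_all add: scaleR_left_distrib[symmetric])
    then have "norm (T1 x - T x) = (1 / 2) * norm (T (J x) - J (T x))" using \<epsilon> by auto
    also have "\<dots> \<le> (1 / 2) * (\<eta> * norm x)" using df unfolding defect_le_def by (intro mult_left_mono) auto
    finally show ?thesis by simp
  qed
  define S where "S x = (1 / 2) *\<^sub>R (T1 x + star (T1 (star x)))" for x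
  have S: "star_J_linear S" using star_average[OF T1 T1J] unfolding S_def[abs_def] .
  \<comment> \<open>The average over \<open>J\<close> moves \<open>T\<close> by at most
    \<open>\<eta> / 2\<close>. The involution defect of \<open>T1\<close> is then at most
    \<open>2 * \<eta>\<close>, and half of it is the second displacement; the total of 3/2 is
    rounded up to 2.\<close>
  have near2: "norm (S x - T x) \<le> 2 * \<eta> * norm x" for x
  proof -
    have a: "norm (T1 (star x) - T (star x)) \<le> \<eta> / 2 * norm x" using near1[of "star x"] by simp
    have b: "norm (T (star x) - star (T x)) \<le> \<eta> * norm x" using df unfolding defect_le_def by blast
    have "norm (T1 (star x) - star (T1 x)) = norm ((T1 (star x) - T (star x)) + (T (star x) - star (T x)) - star (T1 x - T x))"
      by (simp add: lin)
    also have "\<dots> \<le> \<eta> / 2 * norm x + \<eta> * norm x + \<eta> / 2 * norm x"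
      using a b near1[of x] norm_triangle_ineq4 norm_triangle_ineq norm_star by (smt (verit))
    finally have d: "norm (T1 (star x) - star (T1 x)) \<le> 2 * \<eta> * norm x" by simp
    have "S x - T1 x = (1 / 2) *\<^sub>R star (T1 (star x) - star (T1 x))"
      unfolding S_def by (simp add: lin algebra_simps) (simp add: scaleR_left_distrib[symmetric])
    then have "norm (S x - T1 x) \<le> \<eta> * norm x" using d by simp
    then show ?thesis using near1[of x] norm_triangle_ineq[of "S x - T1 x" "T1 x - T x"] \<eta>
      by (smt (verit) add_diff_cancel_left' diff_add_cancel diff_add_eq mult_nonneg_nonneg norm_ge_zero field_sum_of_halves distrib_right)
  qed
  define D where "D x = S x - T x" for x
  have nT: "norm (T x) \<le> 2 * norm x" for x
    using nearD[OF nr, of x] norm_triangle_ineq2[of "T x" x] by simp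
  have nD: "norm (D x) \<le> 2 * \<eta> * norm x" for x using near2 by (simp add: D_def)
  \<comment> \<open>The factor 15 is 1 + 2 + 4 + 4 + 4, from the five terms of
    \<open>mult_defect_add\<close>, with \<open>T\<close> of norm at most 2, \<open>D\<close> of
    norm at most \<open>2 * \<eta>\<close>, and \<open>\<eta> \<le> 1\<close> absorbing the square
    in the last term.\<close>
  have "norm (mult_defect S x y) \<le> 15 * \<eta> * (norm x * norm y)" for x y
  proof -
    define p where "p = norm x * norm y"
    have p: "p \<ge> 0" by (simp add: p_def)
    have 1: "norm (mult_defect T x y) \<le> \<eta> * p" using df unfolding defect_le_def p_def by blast
    have "2 * \<eta> * norm (x * y) \<le> 2 * \<eta> * p"
      unfolding p_def using \<eta> norm_mult_ineq by (intro mult_left_mono) auto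
    with nD[of "x * y"] have 2: "norm (D (x * y)) \<le> 2 * \<eta> * p" by linarith
    have 3: "norm (T x * D y) \<le> 4 * \<eta> * p"
      using norm_mult_le[OF nT[of x] nD[of y]] by (simp add: p_def mult_ac)
    have 4: "norm (D x * T y) \<le> 4 * \<eta> * p"
      using norm_mult_le[OF nD[of x] nT[of y]] by (simp add: p_def mult_ac)
    have "norm (D x * D y) \<le> \<eta> * (4 * \<eta> * p)"
      using norm_mult_le[OF nD[of x] nD[of y]] by (simp add: p_def mult_ac)
    also have "\<dots> \<le> 1 * (4 * \<eta> * p)" using \<eta> p by (intro mult_right_mono) auto
    finally have 5: "norm (D x * D y) \<le> 4 * \<eta> * p" by simp
    have "mult_defect S x y = mult_defect T x y + D (x * y) - T x * D y - D x * T y - D x * D y"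
      by (rule mult_defect_add) (simp add: D_def)
    with 1 2 3 4 5 show ?thesis
      using norm_triangle5[of "mult_defect T x y" "D (x * y)" "T x * D y" "D x * T y" "D x * D y"]
      by (simp add: p_def)
  qed
  with S near2 show ?thesis unfolding near_def by blast
qed

end

context fd_star_algebra begin

text \<open>With a separability idempotent \<open>\<Sum> e i \<otimes> f i\<close>, the correction \<open>x \<mapsto> \<Sum> \<phi> (e i) * \<delta> (f i) x\<close> cancels the
  multiplicative defect \<open>\<delta>\<close> of \<open>\<phi>\<close> to first order. It spoils compatibility with the involution, which
  averaging restores at a cost quadratic in the correction.\<close>

lemma newton:
  "\<exists>K>0. \<forall>\<phi> \<eta> d. star_J_linear \<phi> \<and> near \<phi> (\<lambda>x. x) d \<and> 0 \<le> d \<and> d \<le> 1 \<and> 0 \<le> \<eta> \<and>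
      (\<forall>x y. norm (mult_defect \<phi> x y) \<le> \<eta> * (norm x * norm y)) \<longrightarrow>
      (\<exists>T. star_J_linear T \<and> near T \<phi> (K * \<eta>) \<and>
         (\<forall>x y. norm (mult_defect T x y) \<le> K * (d + \<eta>) * \<eta> * (norm x * norm y)))"
proof -
  obtain f where cas: "\<And>\<beta> :: 'a \<Rightarrow> 'a \<Rightarrow> 'a. \<And>x. bilinear \<beta> \<Longrightarrow> (\<Sum>i<N. \<beta> (x * e i) (f i)) = (\<Sum>i<N. \<beta> (e i) (f i * x))"
    and unit: "\<And>x. (\<Sum>i<N. e i * f i) * x = x"
    using separability by blast
  define u where "u = (\<Sum>i<N. e i * f i)"
  define M where "M = (\<Sum>i<N. norm (e i) * norm (f i))"
  \<comment> \<open>The displacement needs \<open>2 * M\<close>. The defect before averaging needs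
    \<open>norm u + 2 * M + 4 * M * M\<close>, and averaging adds another \<open>4 * M * M\<close>.
    The summand 1 makes \<open>K\<close> positive.\<close>
  define K where "K = norm u + 2 * M + 8 * M * M + 1"
  have M: "M \<ge> 0" unfolding M_def by (intro sum_nonneg) auto
  have K: "K > 0" unfolding K_def using M by (smt (verit) mult_nonneg_nonneg norm_ge_zero)
  have "\<exists>T. star_J_linear T \<and> near T \<phi> (K * \<eta>) \<and>
         (\<forall>x y. norm (mult_defect T x y) \<le> K * (d + \<eta>) * \<eta> * (norm x * norm y))"
    if \<phi>: "star_J_linear \<phi>" and nr: "near \<phi> (\<lambda>x. x) d" and d: "0 \<le> d" "d \<le> 1" and \<eta>: "0 \<le> \<eta>"
      and df: "\<And>x y. norm (mult_defect \<phi> x y) \<le> \<eta> * (norm x * norm y)" for \<phi> \<eta> d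
  proof -
    have lp: "linear \<phi>" and \<phi>s: "\<And>x. \<phi> (star x) = star (\<phi> x)" and \<phi>J: "\<And>x. \<phi> (J x) = J (\<phi> x)"
      using \<phi> unfolding star_J_linear_def by auto
    note lin = linear_add[OF lp] linear_scale[OF lp] linear_add[OF linear_star] linear_scale[OF linear_star]
      linear_add[OF linear_J] linear_scale[OF linear_J] linear_diff[OF linear_J] linear_diff[OF linear_star]
    define \<delta> where "\<delta> x y = mult_defect \<phi> x y" for x y
    define \<psi> where "\<psi> x = (\<Sum>i<N. \<phi> (e i) * \<delta> (f i) x)" for x
    have n\<phi>: "norm (\<phi> x) \<le> 2 * norm x" for x
      using nearD[OF nr, of x] norm_triangle_ineq2[of "\<phi> x" x] mult_right_mono[OF d(2), of "norm x"] by simp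
    have n\<psi>: "norm (\<psi> x) \<le> 2 * M * \<eta> * norm x" for x
    proof -
      have "norm (\<psi> x) \<le> (\<Sum>i<N. norm (\<phi> (e i) * \<delta> (f i) x))" unfolding \<psi>_def by (rule norm_sum)
      also have "\<dots> \<le> (\<Sum>i<N. (2 * norm (e i)) * (\<eta> * (norm (f i) * norm x)))"
        unfolding \<delta>_def by (intro sum_mono norm_mult_le n\<phi> df)
      also have "\<dots> = 2 * M * \<eta> * norm x"
        by (simp add: M_def sum_distrib_left sum_distrib_right mult_ac)
      finally show ?thesis .
    qed
    have l\<delta>: "linear (\<delta> x)" "linear (\<lambda>x. \<delta> x y)" for x y
      by (auto intro!: linearI simp: \<delta>_def mult_defect_def lin algebra_simps)
    have l\<psi>: "linear \<psi>" unfolding \<psi>_def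
      by (rule linearI) (simp_all add: linear_add[OF l\<delta>(1)] linear_scale[OF l\<delta>(1)] distrib_left sum.distrib scaleR_sum_right)
    \<comment> \<open>\<open>J\<close> passes through the right factor of a product, and
      \<open>x\<close> enters \<psi> only through the second argument of \<delta>; so the correction
      inherits compatibility with \<open>J\<close> directly, and only the involution has to be
      restored.\<close>
    have \<psi>J: "\<psi> (J x) = J (\<psi> x)" for x
      unfolding \<psi>_def \<delta>_def mult_defect_def
      by (simp add: J_mult_right \<phi>J linear_sum[OF linear_J] flip: linear_diff[OF linear_J])
    define T where "T x = \<phi> x + \<psi> x" for x
    have lT: "linear T" unfolding T_def using lp l\<psi> by (rule linear_compose_add)
    have TJ: "T (J x) = J (T x)" for x by (simp add: T_def \<phi>J \<psi>J lin)
    have n\<delta>T: "norm (mult_defect T x y) \<le> (norm u + 2 * M + 4 * M * M) * (d + \<eta>) * \<eta> * (norm x * norm y)" for x y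
    proof -
      define p where "p = norm x * norm y"
      have p: "p \<ge> 0" by (simp add: p_def)
      have "bilinear (\<lambda>a b. \<phi> a * \<delta> b y)"
        by (simp add: bilinear_def linear_iff linear_add[OF l\<delta>(2)] linear_scale[OF l\<delta>(2)] lin algebra_simps)
      from cas[OF this, of x]
      have 1: "(\<Sum>i<N. \<phi> (x * e i) * \<delta> (f i) y) = (\<Sum>i<N. \<phi> (e i) * \<delta> (f i * x) y)" .
      have 2: "\<phi> x * \<psi> y = (\<Sum>i<N. \<phi> (x * e i) * \<delta> (f i) y) - (\<Sum>i<N. \<delta> x (e i) * \<delta> (f i) y)"
        unfolding \<psi>_def sum_distrib_left sum_subtractf[symmetric] 
        by (rule sum.cong) (simp_all add: \<delta>_def mult_defect_def left_diff_distrib mult.assoc)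
      \<comment> \<open>This is the cocycle identity \<open>\<delta> f (x * y) + \<phi> f * \<delta>
        x y = \<delta> (f * x) y + \<delta> f x * \<phi> y\<close>, a consequence of associativity,
        summed against \<open>\<phi> (e i)\<close>.\<close>
      have 3: "\<psi> (x * y) - \<psi> x * \<phi> y = (\<Sum>i<N. \<phi> (e i) * \<delta> (f i * x) y) - (\<Sum>i<N. \<phi> (e i) * \<phi> (f i)) * \<delta> x y"
        unfolding \<psi>_def sum_distrib_right sum_subtractf[symmetric] 
        by (rule sum.cong) (simp_all add: \<delta>_def mult_defect_def algebra_simps)
      have 4: "(\<Sum>i<N. \<phi> (e i) * \<phi> (f i)) = \<phi> u - (\<Sum>i<N. \<delta> (e i) (f i))"
        unfolding u_def linear_sum[OF lp] sum_subtractf[symmetric]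
        by (rule sum.cong) (simp_all add: \<delta>_def mult_defect_def)
      have "mult_defect T x y = \<delta> x y + \<psi> (x * y) - \<phi> x * \<psi> y - \<psi> x * \<phi> y - \<psi> x * \<psi> y"
        unfolding \<delta>_def by (rule mult_defect_add) (simp add: T_def)
      also have "\<dots> = \<delta> x y + (\<psi> (x * y) - \<psi> x * \<phi> y) - \<phi> x * \<psi> y - \<psi> x * \<psi> y" by simp
      \<comment> \<open>The two sums that are linear in \<delta> agree by the intertwining property
        and cancel, and \<open>u\<close> acts as the unit, so \<open>\<delta> x y\<close> can be
        written \<open>u * \<delta> x y\<close>. What remains is quadratic in \<delta>, apart from
        the difference of \<open>u\<close> and \<open>\<phi> u\<close>.\<close>
      also have "\<dots> = u * \<delta> x y - \<phi> u * \<delta> x y + (\<Sum>i<N. \<delta> (e i) (f i)) * \<delta> x y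
          + (\<Sum>i<N. \<delta> x (e i) * \<delta> (f i) y) - \<psi> x * \<psi> y"
        unfolding 2 3 1 4 using unit[of "\<delta> x y"] by (simp add: u_def[symmetric] left_diff_distrib)
      finally have eq: "mult_defect T x y = (u - \<phi> u) * \<delta> x y + (\<Sum>i<N. \<delta> (e i) (f i)) * \<delta> x y
          + (\<Sum>i<N. \<delta> x (e i) * \<delta> (f i) y) - \<psi> x * \<psi> y" by (simp add: left_diff_distrib)
      \<comment> \<open>The one remaining term that is not quadratic in the defect; it is small
        because \<phi> is near the identity, and it brings \<open>d\<close> into the final
        estimate.\<close>
      have "norm (u - \<phi> u) \<le> d * norm u" using nearD[OF nr, of u] by (simp add: norm_minus_commute)
      from norm_mult_le[OF this df[of x y]]
      have n1: "norm ((u - \<phi> u) * \<delta> x y) \<le> norm u * d * \<eta> * p"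
        by (simp add: \<delta>_def p_def mult_ac)
      have "norm (\<Sum>i<N. \<delta> (e i) (f i)) \<le> (\<Sum>i<N. \<eta> * (norm (e i) * norm (f i)))"
        unfolding \<delta>_def by (rule order_trans[OF norm_sum]) (intro sum_mono df)
      also have "\<dots> = \<eta> * M" by (simp add: M_def sum_distrib_left)
      finally have "norm (\<Sum>i<N. \<delta> (e i) (f i)) \<le> \<eta> * M" .
      from norm_mult_le[OF this df[of x y]]
      have n2: "norm ((\<Sum>i<N. \<delta> (e i) (f i)) * \<delta> x y) \<le> M * \<eta> * \<eta> * p"
        by (simp add: \<delta>_def p_def mult_ac)
      have "norm (\<Sum>i<N. \<delta> x (e i) * \<delta> (f i) y) \<le> (\<Sum>i<N. (\<eta> * (norm x * norm (e i))) * (\<eta> * (norm (f i) * norm y)))"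
        unfolding \<delta>_def by (rule order_trans[OF norm_sum]) (intro sum_mono norm_mult_le df)
      also have "\<dots> = M * \<eta> * \<eta> * p"
        by (simp add: M_def p_def sum_distrib_left sum_distrib_right mult_ac)
      finally have n3: "norm (\<Sum>i<N. \<delta> x (e i) * \<delta> (f i) y) \<le> M * \<eta> * \<eta> * p" .
      have n4: "norm (\<psi> x * \<psi> y) \<le> 4 * M * M * \<eta> * \<eta> * p"
        using norm_mult_le[OF n\<psi>[of x] n\<psi>[of y]] by (simp add: p_def mult_ac)
      have "norm (mult_defect T x y) \<le> norm u * d * \<eta> * p + M * \<eta> * \<eta> * p + M * \<eta> * \<eta> * p + 4 * M * M * \<eta> * \<eta> * p"
        unfolding eq using n1 n2 n3 n4 
          norm_triangle_ineq4[of "(u - \<phi> u) * \<delta> x y + (\<Sum>i<N. \<delta> (e i) (f i)) * \<delta> x y + (\<Sum>i<N. \<delta> x (e i) * \<delta> (f i) y)" "\<psi> x * \<psi> y"]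
          norm_triangle_ineq[of "(u - \<phi> u) * \<delta> x y + (\<Sum>i<N. \<delta> (e i) (f i)) * \<delta> x y" "\<Sum>i<N. \<delta> x (e i) * \<delta> (f i) y"]
          norm_triangle_ineq[of "(u - \<phi> u) * \<delta> x y" "(\<Sum>i<N. \<delta> (e i) (f i)) * \<delta> x y"]
        by linarith
      also have "\<dots> = norm u * (d * \<eta> * p) + (2 * M + 4 * M * M) * (\<eta> * \<eta> * p)"
        by (simp add: algebra_simps)
      also have "\<dots> \<le> norm u * (d * \<eta> * p + \<eta> * \<eta> * p) + (2 * M + 4 * M * M) * (d * \<eta> * p + \<eta> * \<eta> * p)"
        using M p d \<eta> by (intro add_mono mult_left_mono) auto
      also have "\<dots> = (norm u + 2 * M + 4 * M * M) * (d + \<eta>) * \<eta> * p"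
        by (simp add: algebra_simps)
      finally show ?thesis by (simp add: p_def)
    qed
    define B where "B x = star (T (star x))" for x
    define U where "U x = (1 / 2) *\<^sub>R (T x + B x)" for x
    have U: "star_J_linear U" using star_average[OF lT TJ] unfolding U_def[abs_def] B_def .
    have nU: "norm (U x - \<phi> x) \<le> K * \<eta> * norm x" for x
    proof -
      have "U x - \<phi> x = (1 / 2) *\<^sub>R (\<psi> x + star (\<psi> (star x)))"
        by (simp add: U_def B_def T_def lin \<phi>s algebra_simps) (simp add: scaleR_left_distrib[symmetric])
      then have "norm (U x - \<phi> x) = (1 / 2) * norm (\<psi> x + star (\<psi> (star x)))" by simp
      also have "\<dots> \<le> 2 * M * \<eta> * norm x"
        using norm_triangle_ineq[of "\<psi> x" "star (\<psi> (star x))"] n\<psi>[of x] n\<psi>[of "star x"] by simp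
      also have "\<dots> \<le> K * \<eta> * norm x"
        using M \<eta> by (intro mult_right_mono) (auto simp: K_def)
      finally show ?thesis .
    qed
    have nUd: "norm (mult_defect U x y) \<le> K * (d + \<eta>) * \<eta> * (norm x * norm y)" for x y
    proof -
      define p where "p = norm x * norm y"
      have p: "p \<ge> 0" by (simp add: p_def)
      define k where "k = (norm u + 2 * M + 4 * M * M) * (d + \<eta>) * \<eta> * p"
      have "mult_defect B x y = star (mult_defect T (star y) (star x))"
        by (simp add: mult_defect_def B_def star_mult lin)
      then have b: "norm (mult_defect B x y) \<le> k"
        using n\<delta>T[of "star y" "star x"] by (simp add: k_def p_def mult_ac)
      have a: "norm (mult_defect T x y) \<le> k" using n\<delta>T[of x y] by (simp add: k_def p_def)
      \<comment> \<open>Since \<phi> already commutes with the involution, \<open>T\<close> and its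
        conjugate \<open>B\<close> differ only through the correction and its conjugate, each of
        size \<open>2 * M * \<eta>\<close>. The cross term of the average is therefore quadratic in
        \<eta>.\<close>
      have "norm (T x - B x) \<le> 4 * M * \<eta> * norm x" for x
      proof -
        have "T x - B x = \<psi> x - star (\<psi> (star x))" by (simp add: T_def B_def lin \<phi>s)
        then show ?thesis
          using norm_triangle_ineq4[of "\<psi> x" "star (\<psi> (star x))"] n\<psi>[of x] n\<psi>[of "star x"] by simp
      qed
      from norm_mult_le[OF this this]
      have c: "norm ((T x - B x) * (T y - B y)) \<le> 16 * M * M * \<eta> * \<eta> * p" by (simp add: p_def mult_ac)
      have "mult_defect U x y = (1 / 2) *\<^sub>R (mult_defect T x y + mult_defect B x y)
         + (1 / 4) *\<^sub>R ((T x - B x) * (T y - B y))"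
        by (rule mult_defect_average) (simp add: U_def)
      then have "norm (mult_defect U x y) \<le> norm ((1 / 2) *\<^sub>R (mult_defect T x y + mult_defect B x y))
          + norm ((1 / 4) *\<^sub>R ((T x - B x) * (T y - B y)))" using norm_triangle_ineq by metis
      also have "\<dots> \<le> k + 4 * M * M * \<eta> * \<eta> * p"
        using a b c norm_triangle_ineq[of "mult_defect T x y" "mult_defect B x y"] by simp
      also have "4 * M * M * \<eta> * \<eta> * p = (4 * M * M) * (\<eta> * \<eta> * p)" by simp
      also have "\<dots> \<le> (4 * M * M) * ((d + \<eta>) * \<eta> * p)"
        using M p d \<eta> by (intro mult_left_mono mult_right_mono) auto
      also have "k + \<dots> = (norm u + 2 * M + 8 * M * M) * ((d + \<eta>) * \<eta> * p)"
        by (simp add: k_def algebra_simps)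
      also have "\<dots> \<le> K * ((d + \<eta>) * \<eta> * p)"
        using p d \<eta> by (intro mult_right_mono) (auto simp: K_def)
      finally show ?thesis by (simp add: p_def mult_ac)
    qed
    show ?thesis using U nU nUd unfolding near_def by blast
  qed
  then show ?thesis using K by blast
qed

text \<open>The ratio \<rho> is left free because passing between maps and matrices will cost
  constant factors; a small ratio is bought by a small neighbourhood of the identity.\<close>

lemma improvement:
  assumes \<rho>: "\<rho> > 0"
  shows "\<exists>C>0. \<exists>\<delta>>0. \<forall>T \<eta>. linear T \<and> near T (\<lambda>x. x) \<delta> \<and> defect_le T \<eta> \<and> 0 \<le> \<eta> \<and> \<eta> \<le> \<delta> \<longrightarrow>
     (\<exists>S. linear S \<and> near S T (C * \<eta>) \<and> defect_le S (\<rho> * \<eta>))"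
proof -
  obtain K where K: "K > 0" and nt: "\<And>\<phi> \<eta> d. star_J_linear \<phi> \<Longrightarrow> near \<phi> (\<lambda>x. x) d \<Longrightarrow> 0 \<le> d \<Longrightarrow> d \<le> 1 \<Longrightarrow> 0 \<le> \<eta> \<Longrightarrow>
      (\<And>x y. norm (mult_defect \<phi> x y) \<le> \<eta> * (norm x * norm y)) \<Longrightarrow>
      (\<exists>T. star_J_linear T \<and> near T \<phi> (K * \<eta>) \<and>
         (\<forall>x y. norm (mult_defect T x y) \<le> K * (d + \<eta>) * \<eta> * (norm x * norm y)))"
    using newton by blast
  \<comment> \<open>After symmetrization the distance to the identity is at most
    \<open>3 * \<delta>\<close> and the multiplicative defect at most \<open>15 * \<eta>\<close>.
    The Newton bound is then at most \<open>K * (18 * \<delta>) * (15 * \<eta>)\<close>, whence 270;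
    the bound 1/3 ensures the requirement \<open>d \<le> 1\<close> of the Newton step.\<close>
  define \<delta> where "\<delta> = min (1 / 3) (\<rho> / (270 * K))"
  have \<delta>: "\<delta> > 0" "\<delta> \<le> 1 / 3" "270 * K * \<delta> \<le> \<rho>"
    using K \<rho> by (auto simp: \<delta>_def min_def field_simps)
  have "\<exists>S. linear S \<and> near S T ((2 + 15 * K) * \<eta>) \<and> defect_le S (\<rho> * \<eta>)"
    if T: "linear T" and nr: "near T (\<lambda>x. x) \<delta>" and df: "defect_le T \<eta>" and \<eta>: "0 \<le> \<eta>" "\<eta> \<le> \<delta>" for T \<eta>
  proof -
    have "norm (T x - x) \<le> 1 * norm x" for x
      using nearD[OF nr, of x] mult_right_mono[of \<delta> 1 "norm x"] \<delta> by simp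
    then have "near T (\<lambda>x. x) 1" unfolding near_def by blast
    from symmetrize[OF T this df] obtain S where S: "star_J_linear S" and SI: "near S T (2 * \<eta>)"
      and dS: "\<And>x y. norm (mult_defect S x y) \<le> 15 * \<eta> * (norm x * norm y)" using \<eta> \<delta> by auto
    have S3: "near S (\<lambda>x. x) (3 * \<delta>)" unfolding near_def
    proof
      fix x
      have "norm (S x - x) \<le> norm (S x - T x) + norm (T x - x)"
        using norm_triangle_ineq[of "S x - T x" "T x - x"] by simp
      also have "\<dots> \<le> 2 * \<eta> * norm x + \<delta> * norm x" using nearD[OF SI] nearD[OF nr] by (intro add_mono)
      also have "\<dots> \<le> 3 * \<delta> * norm x" using mult_right_mono[OF \<eta>(2), of "norm x"] by simp
      finally show "norm (S x - x) \<le> 3 * \<delta> * norm x" .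
    qed
    obtain U where U: "star_J_linear U" and US: "near U S (K * (15 * \<eta>))"
      and dU: "\<And>x y. norm (mult_defect U x y) \<le> K * (3 * \<delta> + 15 * \<eta>) * (15 * \<eta>) * (norm x * norm y)"
      using nt[OF S S3 _ _ _ dS] \<delta> \<eta> by auto
    have "K * (3 * \<delta> + 15 * \<eta>) * (15 * \<eta>) \<le> K * (18 * \<delta>) * (15 * \<eta>)"
      using K \<eta> by (intro mult_right_mono mult_left_mono) auto
    also have "\<dots> = (270 * K * \<delta>) * \<eta>" by simp
    also have "\<dots> \<le> \<rho> * \<eta>" using \<delta>(3) \<eta> by (intro mult_right_mono)
    finally have le: "K * (3 * \<delta> + 15 * \<eta>) * (15 * \<eta>) \<le> \<rho> * \<eta>" .
    have "norm (mult_defect U x y) \<le> \<rho> * \<eta> * (norm x * norm y)" for x y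
      using dU[of x y] mult_right_mono[OF le, of "norm x * norm y"] by simp
    then have "defect_le U (\<rho> * \<eta>)" using U \<eta> \<rho> unfolding defect_le_def star_J_linear_def by simp
    moreover have "near U T ((2 + 15 * K) * \<eta>)" unfolding near_def
    proof
      fix x
      have "norm (U x - T x) \<le> norm (U x - S x) + norm (S x - T x)"
        using norm_triangle_ineq[of "U x - S x" "S x - T x"] by simp
      also have "\<dots> \<le> K * (15 * \<eta>) * norm x + 2 * \<eta> * norm x" using nearD[OF SI] nearD[OF US] by (intro add_mono)
      finally show "norm (U x - T x) \<le> (2 + 15 * K) * \<eta> * norm x" by (simp add: algebra_simps)
    qed
    ultimately show ?thesis using U unfolding star_J_linear_def by blast
  qed
  then show ?thesis using K \<delta> by (intro exI[of _ "2 + 15 * K"] conjI exI[of _ \<delta>]) auto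
qed

end

section \<open>Finite-dimensional C*-algebras\<close>

text \<open>One new generator enlarges the common kernel of the chosen maps to at most a line. If it
  becomes a line, one more map that does not vanish on it is added.\<close>

lemma finite_separating_family:
  fixes F :: "'i \<Rightarrow> 'a::real_vector \<Rightarrow> 'b::real_vector"
  assumes lin: "\<And>i. linear (F i)" and sep: "\<And>x. x \<noteq> 0 \<Longrightarrow> \<exists>i. F i x \<noteq> 0" and "finite B"
  shows "\<exists>X. finite X \<and> (\<forall>x\<in>span B. (\<forall>i\<in>X. F i x = 0) \<longrightarrow> x = 0)"
  using \<open>finite B\<close>
proof (induction B)
  case empty then show ?case by auto
next
  case (insert b B)
  then obtain X where X: "finite X" "\<And>x. x \<in> span B \<Longrightarrow> (\<forall>i\<in>X. F i x = 0) \<Longrightarrow> x = 0" by blast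
  show ?case
  proof (cases "\<exists>a\<in>span (insert b B). a \<noteq> 0 \<and> (\<forall>i\<in>X. F i a = 0)")
    case False then show ?thesis using X(1) by blast
  next
    case True
    then obtain a where a: "a \<in> span (insert b B)" "a \<noteq> 0" "\<And>i. i \<in> X \<Longrightarrow> F i a = 0" by blast
    obtain r where r: "a - r *\<^sub>R b \<in> span B" using a(1) by (auto simp: span_breakdown_eq)
    have "r \<noteq> 0" using X(2)[of a] a r by auto
    obtain j where j: "F j a \<noteq> 0" using sep a(2) by blast
    have "x = 0" if x: "x \<in> span (insert b B)" and Fx: "\<forall>i\<in>insert j X. F i x = 0" for x
    proof -
      obtain s where s: "x - s *\<^sub>R b \<in> span B" using x by (auto simp: span_breakdown_eq)
      have "x - (s / r) *\<^sub>R a = (x - s *\<^sub>R b) - (s / r) *\<^sub>R (a - r *\<^sub>R b)"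
        using \<open>r \<noteq> 0\<close> by (simp add: algebra_simps)
      then have "x - (s / r) *\<^sub>R a \<in> span B" using r s by (metis span_diff span_scale)
      moreover have "\<forall>i\<in>X. F i (x - (s / r) *\<^sub>R a) = 0"
        using Fx a(3) by (simp add: linear_diff[OF lin] linear_scale[OF lin])
      ultimately have eq: "x = (s / r) *\<^sub>R a" using X(2) by force
      then have "(s / r) *\<^sub>R F j a = 0" using Fx linear_scale[OF lin] by (metis insertI1)
      then have "s / r = 0" using j by simp
      then show ?thesis using eq by simp
    qed
    then show ?thesis using X(1) by (intro exI[of _ "insert j X"]) auto
  qed
qed

text \<open>Gram-Schmidt, with only the reproducing formula recorded. A generator whose orthogonal
  remainder \<open>p\<close> vanishes contributes no new vector, so \<open>B\<close> may be linearly
  dependent.\<close>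

lemma orthonormal_expansion:
  fixes ip :: "'a::real_vector \<Rightarrow> 'a \<Rightarrow> real"
  assumes add: "\<And>x y z. ip (x + y) z = ip x z + ip y z" and scale: "\<And>r x y. ip (r *\<^sub>R x) y = r * ip x y"
    and sym: "\<And>x y. ip x y = ip y x" and pos: "\<And>x. x \<noteq> 0 \<Longrightarrow> 0 < ip x x" and "finite B"
  shows "\<exists>N e. (\<forall>i<N. e i \<in> span B) \<and> (\<forall>x\<in>span B. x = (\<Sum>i<(N::nat). ip x (e i) *\<^sub>R e i))"
  using \<open>finite B\<close>
proof (induction B)
  case empty then show ?case by (intro exI[of _ 0]) auto
next
  case (insert b B)
  then obtain N e where e: "\<And>i. i < N \<Longrightarrow> e i \<in> span B"
    and ex: "\<And>x. x \<in> span B \<Longrightarrow> x = (\<Sum>i<(N::nat). ip x (e i) *\<^sub>R e i)" by blast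
  have lin: "linear (\<lambda>x. ip x y)" for y by (rule linearI) (simp_all add: add scale)
  have lin2: "linear (ip x)" for x by (rule linearI) (simp_all add: sym[of x] add scale)
  define q where "q = (\<Sum>i<N. ip b (e i) *\<^sub>R e i)"
  have q: "q \<in> span B" unfolding q_def by (intro span_sum span_scale) (use e in auto)
  define p where "p = b - q"
  have orth: "ip p y = 0" if "y \<in> span B" for y
  proof -
    have "ip q y = (\<Sum>i<N. ip b (e i) * ip (e i) y)"
      unfolding q_def by (simp add: linear_sum[OF lin] scale)
    also have "\<dots> = ip b (\<Sum>i<N. ip y (e i) *\<^sub>R e i)"
      by (simp add: linear_sum[OF lin2] linear_scale[OF lin2] mult.commute sym[of y])
    finally have "ip q y = ip b y" using ex[OF that] by simp
    then show ?thesis by (simp add: p_def linear_diff[OF lin])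
  qed
  have sub: "span B \<subseteq> span (insert b B)" by (intro span_mono) auto
  show ?case
  proof (cases "p = 0")
    case True
    then have "span (insert b B) = span B" using q by (simp add: p_def span_redundant)
    then show ?thesis using e ex by metis
  next
    case False
    define s where "s = sqrt (ip p p)"
    have s: "s > 0" "s * s = ip p p" using pos[OF False] by (auto simp: s_def)
    define e' where "e' i = (if i < N then e i else (1 / s) *\<^sub>R p)" for i
    have pin: "p \<in> span (insert b B)" unfolding p_def using q sub by (intro span_diff) (auto simp: span_base)
    have "x = (\<Sum>i<Suc N. ip x (e' i) *\<^sub>R e' i)" if x: "x \<in> span (insert b B)" for x
    proof -
      obtain r where r: "x - r *\<^sub>R b \<in> span B" using x by (auto simp: span_breakdown_eq)
      define y where "y = (x - r *\<^sub>R b) + r *\<^sub>R q"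
      have y: "y \<in> span B" unfolding y_def using r q by (intro span_add span_scale)
      have xy: "x = y + r *\<^sub>R p" by (simp add: y_def p_def algebra_simps)
      have c1: "ip x (e i) = ip y (e i)" if "i < N" for i
        using orth[OF e[OF that]] by (simp add: xy add scale)
      have c2: "ip x ((1 / s) *\<^sub>R p) = r * s"
        using orth[OF y] s by (simp add: xy add scale linear_scale[OF lin2] sym[of y p] field_simps)
      have "(\<Sum>i<Suc N. ip x (e' i) *\<^sub>R e' i) = (\<Sum>i<N. ip y (e i) *\<^sub>R e i) + (r * s) *\<^sub>R ((1 / s) *\<^sub>R p)"
        by (simp add: e'_def c1 c2)
      also have "\<dots> = x" using ex[OF y] s by (simp add: xy)
      finally show ?thesis by simp
    qed
    moreover have "\<forall>i<Suc N. e' i \<in> span (insert b B)"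
      using e sub pin by (auto simp: e'_def span_scale)
    ultimately show ?thesis by blast
  qed
qed

locale fd_cstar = banach_star_algebra K sc star + fd: fd_star_algebra star J \<epsilon> ip N e c
  for K :: "complex set" and sc :: "complex \<Rightarrow> 'a::{real_normed_algebra, banach} \<Rightarrow> 'a"
    and star J :: "'a \<Rightarrow> 'a" and \<epsilon> :: real and ip :: "'a \<Rightarrow> 'a \<Rightarrow> real" and N :: nat
    and e :: "nat \<Rightarrow> 'a" and c :: real +
  assumes K_cases: "K = \<real> \<or> K = UNIV"
    and sc_eq: "d \<in> K \<Longrightarrow> sc d x = Re d *\<^sub>R x + Im d *\<^sub>R J x"
    and J_real: "K \<noteq> UNIV \<Longrightarrow> J x = x"

text \<open>The inner product is the real part of a sum of vector functionals of the representation.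
  Finitely many vectors suffice to separate the points, which is positive definiteness, and left
  multiplications by \<open>a\<close> and \<open>star a\<close> are adjoint because the
  corresponding operators are.\<close>

lemma fd_cstar_exists:
  fixes sc :: "complex \<Rightarrow> 'a::{real_normed_algebra, banach} \<Rightarrow> 'a"
  assumes K: "K = \<real> \<or> K = UNIV" and cs: "cstar_algebra K sc star TYPE('h::banach)"
    and fd: "finite_dimensional_over K sc"
  shows "\<exists>J \<epsilon> ip N e c. fd_cstar K sc star J \<epsilon> ip N e c"
proof -
  interpret banach_star_algebra K sc star using cs unfolding cstar_algebra_def by blast
  obtain scH :: "complex \<Rightarrow> 'h \<Rightarrow> 'h" and ipH S \<pi> where H: "hilbert_space_over K scH ipH"
    and bij: "bij_betw \<pi> UNIV S" and n\<pi>: "\<And>x. norm (\<pi> x) = norm x"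
    and \<pi>add: "\<And>x y. \<pi> (x + y) = \<pi> x + \<pi> y"
    and \<pi>sc: "\<And>d x. d \<in> K \<Longrightarrow> is_scaled_operator scH d (\<pi> x) (\<pi> (sc d x))"
    and \<pi>mult: "\<And>x y. \<pi> (x * y) = \<pi> x o\<^sub>L \<pi> y"
    and \<pi>star: "\<And>x. is_adjoint_operator ipH (\<pi> x) (\<pi> (star x))"
    using cs unfolding cstar_algebra_def by blast
  interpret H: hilbert_space_over K scH ipH by (rule H)
  have realK: "complex_of_real r \<in> K" for r using K by auto
  define J where "J = (if K = UNIV then sc \<i> else id)"
  define \<epsilon> :: real where "\<epsilon> = (if K = UNIV then -1 else 1)"
  have minus1: "sc (-1) x = - x" for x using sc_of_real[of "-1" x] by simp
  have linear_sc: "linear (sc d)" if d: "d \<in> K" for d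
  proof (rule linearI)
    fix r x
    have "sc d (r *\<^sub>R x) = sc (d * of_real r) x"
      using sc_sc[OF d realK, of r x] by (simp add: sc_of_real)
    also have "\<dots> = r *\<^sub>R sc d x"
      using sc_sc[OF realK d, of r x] by (simp add: sc_of_real mult.commute)
    finally show "sc d (r *\<^sub>R x) = r *\<^sub>R sc d x" .
  qed (rule sc_add_right[OF d])
  have sc_eq: "sc d x = Re d *\<^sub>R x + Im d *\<^sub>R J x" if d: "d \<in> K" for d x
  proof (cases "K = UNIV")
    case True
    have "sc d x = sc (of_real (Re d) + of_real (Im d) * \<i>) x"
      by (simp add: complex_eq[symmetric] mult.commute)
    also have "\<dots> = sc (of_real (Re d)) x + sc (of_real (Im d)) (sc \<i> x)"
      using True by (simp add: sc_add_left sc_sc)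
    finally show ?thesis using True by (simp add: J_def sc_of_real)
  next
    case False
    then have "d \<in> \<real>" using K d by auto
    then have "d = of_real (Re d)" "Im d = 0" by (auto simp: complex_is_Real_iff complex_eq_iff)
    then show ?thesis using sc_of_real[of "Re d" x] by simp
  qed
  have linJ: "linear J" using linear_sc[of \<i>] by (auto simp: J_def linear_id)
  define F where "F h a = blinfun_apply (\<pi> a) h" for h a
  have linF: "linear (F h)" for h
  proof (rule linearI)
    show "F h (r *\<^sub>R x) = r *\<^sub>R F h x" for r x
      using \<pi>sc[OF realK, of r x] by (simp add: F_def is_scaled_operator_def sc_of_real H.sc_of_real)
  qed (simp add: F_def \<pi>add blinfun.add_left)
  have sep: "\<exists>h. F h x \<noteq> 0" if "x \<noteq> 0" for x
  proof (rule ccontr)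
    assume "\<not> ?thesis"
    then have "\<pi> x = 0" by (intro blinfun_eqI) (simp add: F_def)
    then show False using n\<pi>[of x] that by simp
  qed
  obtain B where B: "finite B" "\<And>x. \<exists>u. (\<forall>b\<in>B. u b \<in> K) \<and> x = (\<Sum>b\<in>B. sc (u b) b)"
    using fd unfolding finite_dimensional_over_def by blast
  \<comment> \<open>Adjoining the images under \<open>J\<close> turns generators over
    \<open>K\<close> into generators over the reals.\<close>
  define B' where "B' = B \<union> J ` B"
  have finB': "finite B'" using B by (simp add: B'_def)
  have spanB': "span B' = UNIV"
  proof -
    have "x \<in> span B'" for x
    proof -
      obtain u where u: "\<forall>b\<in>B. u b \<in> K" "x = (\<Sum>b\<in>B. sc (u b) b)" using B by blast
      have "sc (u b) b \<in> span B'" if "b \<in> B" for b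
        using u that by (simp add: sc_eq B'_def span_add span_scale span_base)
      then show ?thesis unfolding u(2) by (rule span_sum)
    qed
    then show ?thesis by blast
  qed
  obtain X where X: "finite X" "\<And>x. (\<forall>h\<in>X. F h x = 0) \<Longrightarrow> x = 0"
    using finite_separating_family[of F, OF linF sep finB'] spanB' by auto
  define ip where "ip a b = (\<Sum>h\<in>X. Re (ipH (F h a) (F h b)))" for a b
  have ip_self: "ip a a = (\<Sum>h\<in>X. (norm (F h a))\<^sup>2)" for a
    by (simp add: ip_def H.ip_self)
  have ip_add: "ip (x + y) z = ip x z + ip y z" for x y z
    by (simp add: ip_def linear_add[OF linF] H.ip_add sum.distrib)
  have ip_scale: "ip (r *\<^sub>R x) y = r * ip x y" for r x y
  proof -
    have "ipH (r *\<^sub>R a) b = of_real r * ipH a b" for a b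
      using H.ip_sc[OF realK, of r a b] by (simp add: H.sc_of_real)
    then show ?thesis by (simp add: ip_def linear_scale[OF linF] sum_distrib_left)
  qed
  have ip_commute: "ip x y = ip y x" for x y
    unfolding ip_def by (rule sum.cong) (simp_all add: H.ip_commute[of "F _ x" "F _ y"])
  have ip_pos: "0 < ip x x" if "x \<noteq> 0" for x
  proof -
    have "\<not> (\<forall>h\<in>X. F h x = 0)" using X(2)[of x] that by blast
    then obtain h where "h \<in> X" "F h x \<noteq> 0" by blast
    then show ?thesis unfolding ip_self by (intro sum_pos2[OF X(1)]) auto
  qed
  obtain N e where ex: "\<And>x. x = (\<Sum>i<(N::nat). ip x (e i) *\<^sub>R e i)"
    using orthonormal_expansion[of ip, OF ip_add ip_scale ip_commute ip_pos finB'] spanB' by auto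
  have "fd_cstar K sc star J \<epsilon> ip N e (\<Sum>h\<in>X. (norm h)\<^sup>2)"
  proof (intro fd_cstar.intro fd_star_algebra.intro fd_cstar_axioms.intro)
    show "banach_star_algebra K sc star" by unfold_locales
    show "linear star"
    proof (rule linearI)
      show "star (r *\<^sub>R x) = r *\<^sub>R star x" for r x
        using star_sc[OF realK, of r x] by (simp add: sc_of_real)
    qed (rule star_add)
    show "x = 0" if "star x * x = 0" for x
    proof -
      have "F h x = 0" for h
      proof -
        have z: "ipH 0 h = 0" using H.ip_add[of 0 0 h] by simp
        have "blinfun_apply (\<pi> (star x)) (F h x) = F h (star x * x)"
          by (simp add: F_def \<pi>mult)
        also have "\<dots> = 0" unfolding that by (rule linear_0[OF linF])
        finally have "blinfun_apply (\<pi> (star x)) (F h x) = 0" .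
        \<comment> \<open>The pointwise form of the C*-identity: the norm of \<open>F h x\<close> is
          read off from the operator of \<open>star x * x\<close>, which is zero here.\<close>
        moreover have "ipH (blinfun_apply (\<pi> (star x)) (F h x)) h = ipH (F h x) (F h x)"
          using \<pi>star[of "star x"] by (simp add: is_adjoint_operator_def F_def star_star)
        ultimately have "ipH (F h x) (F h x) = 0" using z by simp
        then show ?thesis using H.ip_self[of "F h x"] by simp
      qed
      then show ?thesis using sep by blast
    qed
    show "linear J" by (rule linJ)
    show "norm (J x) = norm x" for x by (simp add: J_def norm_sc)
    show "x * J y = J (x * y)" for x y
      by (simp add: J_def sc_mult_right)
    show "J (J x) = \<epsilon> *\<^sub>R x" for x by (auto simp: J_def \<epsilon>_def sc_sc minus1)
    show "\<epsilon> = 1 \<or> \<epsilon> = -1" by (simp add: \<epsilon>_def)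
    show "star (J x) = \<epsilon> *\<^sub>R J (star x)" for x
      using sc_sc[of "-1" \<i> "star x"] by (auto simp: J_def \<epsilon>_def star_sc minus1)
    show "ip (a * x) y = ip x (star a * y)" for a x y
      using \<pi>star[of a] by (simp add: ip_def F_def \<pi>mult is_adjoint_operator_def)
    show "ip x x \<le> (\<Sum>h\<in>X. (norm h)\<^sup>2) * (norm x)\<^sup>2" for x
    proof -
      have "(norm (F h x))\<^sup>2 \<le> (norm h)\<^sup>2 * (norm x)\<^sup>2" for h
        using power_mono[OF norm_blinfun[of "\<pi> x" h] norm_ge_zero, of 2]
        by (simp add: F_def n\<pi> power_mult_distrib mult.commute)
      then show ?thesis unfolding ip_self sum_distrib_right by (rule sum_mono)
    qed
    show "x = (\<Sum>i<N. ip x (e i) *\<^sub>R e i)" for x by (rule ex)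
    show "sc d x = Re d *\<^sub>R x + Im d *\<^sub>R J x" if "d \<in> K" for d x using sc_eq[OF that] .
    show "J x = x" if "K \<noteq> UNIV" for x using that by (simp add: J_def)
    show "ip x y = ip y x" for x y by (rule ip_commute)
  qed (simp_all add: star_mult star_star norm_star ip_add ip_scale ip_pos K)
  then show ?thesis by blast
qed

section \<open>Monomials and coordinates\<close>

definition word_eval :: "('a \<Rightarrow> 'a) \<Rightarrow> (nat \<Rightarrow> 'a) \<Rightarrow> letter \<Rightarrow> letter list \<Rightarrow> 'a::real_normed_algebra" where
  "word_eval star a l ls = foldl (\<lambda>x l'. x * letter_eval star a l') (letter_eval star a l) ls"

lemma word_eval_snoc: "word_eval star a l (ls @ [m]) = word_eval star a l ls * letter_eval star a m"
  by (simp add: word_eval_def)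

lemma word_eval_mult: "word_eval star a l ls * word_eval star a l' ls' = word_eval star a l (ls @ l' # ls')"
proof (induction ls' rule: rev_induct)
  case Nil show ?case by (simp add: word_eval_def)
next
  case (snoc m ls')
  show ?case unfolding word_eval_snoc mult.assoc[symmetric] snoc
    using word_eval_snoc[of star a l "ls @ l' # ls'" m] by simp
qed

definition valid_word :: "'a presentation \<Rightarrow> letter \<Rightarrow> letter list \<Rightarrow> bool" where
  "valid_word P l ls \<longleftrightarrow> letter_index ` set (l # ls) \<subseteq> special_indices P"

definition valid_term :: "complex set \<Rightarrow> 'a presentation \<Rightarrow> rat_term \<Rightarrow> bool" where
  "valid_term K P t \<longleftrightarrow> (case t of (c, l, ls) \<Rightarrow> coefficient c \<in> K \<and> valid_word P l ls)"

lemma rational_code_iff: "rational_code K P n \<longleftrightarrow> (\<forall>t\<in>set (poly_decode n). valid_term K P t)"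
  unfolding rational_code_def poly_over_def poly_indices_def valid_term_def valid_word_def
  by (fastforce split: prod.splits)

lemma poly_decode_Suc: "poly_decode (Suc (pr t n)) = term_decode t # poly_decode n"
  by (simp add: poly_decode_def)

lemma poly_decode_0: "poly_decode 0 = []"
  by (simp add: poly_decode_def)

lemma rational_code_0: "rational_code K P 0"
  by (simp add: rational_code_iff poly_decode_0)

lemma rational_point_0: "rational_point sc star P 0 = 0"
  by (simp add: rational_point_def poly_eval_def poly_decode_0)

lemma coefficient_mult:
  "coefficient (a * c - b * d, a * d + b * c) = coefficient (a, b) * coefficient (c, d)"
  by (simp add: coefficient_def complex_eq_iff of_rat_mult of_rat_diff of_rat_add)

lemma coefficient_cnj: "coefficient (a, - b) = cnj (coefficient (a, b))"
  by (simp add: coefficient_def complex_eq_iff of_rat_minus)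

context fd_cstar begin

lemma K_1: "1 \<in> K" and K_mult: "d \<in> K \<Longrightarrow> d' \<in> K \<Longrightarrow> d * d' \<in> K" and K_cnj: "d \<in> K \<Longrightarrow> cnj d \<in> K"
  and K_of_real: "of_real r \<in> K"
  using K_cases by (auto simp: complex_is_Real_iff)

text \<open>The scalar factors make this set closed under products, adjoints and \<open>J\<close>
  while each element keeps a code; its real span is then invariant under all operations of the
  algebra.\<close>

definition monomials :: "'a presentation \<Rightarrow> 'a set" where
  "monomials P = {term_eval sc star (points P) t | t. valid_term K P t}"

lemma monomialsI: "coefficient d \<in> K \<Longrightarrow> valid_word P l ls \<Longrightarrow>
    sc (coefficient d) (word_eval star (points P) l ls) \<in> monomials P"
  unfolding monomials_def word_eval_def by (rule CollectI, rule exI[of _ "(d, l, ls)"]) (simp add: valid_term_def)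

lemma monomialsE:
  assumes "x \<in> monomials P"
  obtains d l ls where "coefficient d \<in> K" "valid_word P l ls"
    "x = sc (coefficient d) (word_eval star (points P) l ls)"
  using assms unfolding monomials_def word_eval_def valid_term_def by auto

lemma word_in_monomials: "valid_word P l ls \<Longrightarrow> word_eval star (points P) l ls \<in> monomials P"
  using monomialsI[of "(1, 0)" P l ls] K_1 sc_of_real[of 1] by (simp add: coefficient_def complex_eq_iff flip: one_complex.code)

lemma monomials_mult: assumes "x \<in> monomials P" "y \<in> monomials P" shows "x * y \<in> monomials P"
proof -
  obtain d l ls where x: "coefficient d \<in> K" "valid_word P l ls"
    "x = sc (coefficient d) (word_eval star (points P) l ls)" using monomialsE[OF assms(1)] .
  obtain d' l' ls' where y: "coefficient d' \<in> K" "valid_word P l' ls'"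
    "y = sc (coefficient d') (word_eval star (points P) l' ls')" using monomialsE[OF assms(2)] .
  obtain d'' where d'': "coefficient d'' = coefficient d * coefficient d'"
    by (metis coefficient_mult prod.collapse)
  have "x * y = sc (coefficient d'') (word_eval star (points P) l (ls @ l' # ls'))"
    using x y by (simp add: d'' sc_mult_left sc_mult_right sc_sc word_eval_mult mult.commute)
  moreover have "valid_word P l (ls @ l' # ls')" using x y by (auto simp: valid_word_def)
  ultimately show ?thesis using monomialsI d'' K_mult x(1) y(1) by metis
qed

lemma monomials_star: assumes "x \<in> monomials P" shows "star x \<in> monomials P"
proof -
  obtain d l ls where x: "coefficient d \<in> K" "valid_word P l ls"
    "x = sc (coefficient d) (word_eval star (points P) l ls)" using monomialsE[OF assms(1)] .
  have letter: "\<exists>m. valid_word P m [] \<and> star (letter_eval star (points P) l) = letter_eval star (points P) m"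
    if "valid_word P l []" for l
    using that by (cases l) (auto simp: valid_word_def intro: exI[of _ "Adj _"] exI[of _ "Gen _"] star_star)
  have "\<exists>m ms. valid_word P m ms \<and> star (word_eval star (points P) l ls) = word_eval star (points P) m ms"
    using x(2)
  proof (induction ls rule: rev_induct)
    case Nil
    then show ?case using letter by (fastforce simp: word_eval_def intro: exI[of _ "[]"])
  next
    case (snoc a ls)
    then obtain m ms where m: "valid_word P m ms" "star (word_eval star (points P) l ls) = word_eval star (points P) m ms"
      by (auto simp: valid_word_def)
    obtain b where b: "valid_word P b []" "star (letter_eval star (points P) a) = letter_eval star (points P) b"
      using letter[of a] snoc.prems by (auto simp: valid_word_def)
    have "letter_eval star (points P) b * word_eval star (points P) m ms = word_eval star (points P) b (m # ms)"
      using word_eval_mult[of star "points P" b "[]" m ms] by (simp add: word_eval_def)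
    then have "star (word_eval star (points P) l (ls @ [a])) = word_eval star (points P) b (m # ms)"
      by (simp add: word_eval_snoc star_mult m b)
    moreover have "valid_word P b (m # ms)" using m b by (auto simp: valid_word_def)
    ultimately show ?case by blast
  qed
  then obtain m ms where m: "valid_word P m ms" "star (word_eval star (points P) l ls) = word_eval star (points P) m ms"
    by blast
  obtain d' where d': "coefficient d' = cnj (coefficient d)"
    by (metis coefficient_cnj prod.collapse)
  have "star x = sc (coefficient d') (word_eval star (points P) m ms)"
    using x by (simp add: star_sc m d')
  then show ?thesis using monomialsI[of d' P m ms] d' K_cnj x(1) m(1) by metis
qed

lemma monomials_J: assumes "x \<in> monomials P" shows "J x \<in> monomials P"
proof (cases "K = UNIV")
  case True
  obtain d l ls where x: "coefficient d \<in> K" "valid_word P l ls"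
    "x = sc (coefficient d) (word_eval star (points P) l ls)" using monomialsE[OF assms(1)] .
  obtain d' where d': "coefficient d' = \<i> * coefficient d"
    using coefficient_mult[of 0 "fst d" 1 "snd d"] by (auto simp: coefficient_def complex_eq_iff)
  have "J x = sc \<i> x" using sc_eq[of \<i> x] True by simp
  then have "J x = sc (coefficient d') (word_eval star (points P) l ls)"
    using True x by (simp add: sc_sc d')
  then show ?thesis using monomialsI[of d' P l ls] True x by simp
qed (use assms J_real in simp)

lemma monomial_code: assumes "x \<in> monomials P" shows "\<exists>n. rational_code K P n \<and> rational_point sc star P n = x"
proof -
  obtain t where t: "valid_term K P t" "x = term_eval sc star (points P) t"
    using assms unfolding monomials_def by blast
  obtain n where "poly_decode n = [t]" using surj_poly_decode by (metis surjD)
  then show ?thesis using t by (intro exI[of _ n]) (simp add: rational_code_iff rational_point_def poly_eval_def)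
qed

lemma span_mult:
  assumes "\<And>x y. x \<in> M \<Longrightarrow> y \<in> M \<Longrightarrow> x * y \<in> span M" "x \<in> span M" "y \<in> span (M :: 'a set)"
  shows "x * y \<in> span M"
proof -
  have 1: "x * y \<in> span M" if x: "x \<in> M" and y: "y \<in> span M" for x y
    using y by (induction rule: span_induct_alt) 
      (use assms(1) x in \<open>auto simp: distrib_left span_zero intro!: span_add span_scale\<close>)
  show ?thesis using assms(2)
    by (induction rule: span_induct_alt) 
      (use 1 assms(3) in \<open>auto simp: distrib_right span_zero intro!: span_add span_scale\<close>)
qed

lemma span_linear: assumes "linear f" "\<And>x. x \<in> M \<Longrightarrow> f x \<in> span M" "x \<in> span M" shows "f x \<in> span M"
  using assms linear_span_image[OF assms(1), of M]
  by (metis image_eqI image_subset_iff span_minimal subspace_span subsetD)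

text \<open>The real span is a *-subalgebra over \<open>K\<close>, and it is closed because every
  subspace here is; so the presentation forces it to be everything, and no limits of rational points
  are involved.\<close>

lemma span_monomials: assumes "is_presentation K sc star P" shows "span (monomials P) = UNIV"
proof -
  have "closed_star_subalgebra K sc star (span (monomials P))"
    unfolding closed_star_subalgebra_def
  proof (intro conjI ballI)
    show "closed (span (monomials P))" by (intro fd.subspace_closed subspace_span)
    fix d x assume "d \<in> K" and x: "x \<in> span (monomials P)"
    moreover have "J x \<in> span (monomials P)"
      by (rule span_linear[OF fd.linear_J span_base[OF monomials_J] x])
    ultimately show "sc d x \<in> span (monomials P)" using x by (simp add: sc_eq span_add span_scale)
  next
    fix x y assume "x \<in> span (monomials P)" "y \<in> span (monomials P)"
    then show "x * y \<in> span (monomials P)"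
      by (auto intro: span_mult[OF span_base[OF monomials_mult]])
  next
    fix x assume "x \<in> span (monomials P)"
    from fd.linear_star span_base[OF monomials_star] this show "star x \<in> span (monomials P)"
      by (rule span_linear)
  qed (auto intro: span_zero span_add)
  moreover have "points P ` special_indices P \<subseteq> span (monomials P)"
  proof
    fix x assume "x \<in> points P ` special_indices P"
    then obtain i where "i \<in> special_indices P" "x = points P i" by blast
    then have "x \<in> monomials P"
      using word_in_monomials[of P "Gen i" "[]"] by (simp add: valid_word_def word_eval_def)
    then show "x \<in> span (monomials P)" by (rule span_base)
  qed
  ultimately show ?thesis using assms unfolding is_presentation_def by blast
qed

text \<open>\<open>\<tau> i q\<close> is a code of the term that is \<open>q\<close> times the basis vector \<open>b i\<close>.\<close>

definition coded_basis :: "'a presentation \<Rightarrow> nat \<Rightarrow> (nat \<Rightarrow> 'a) \<Rightarrow> (nat \<Rightarrow> 'a \<Rightarrow> real) \<Rightarrow> (nat \<Rightarrow> nat \<Rightarrow> nat) \<Rightarrow> bool" where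
  "coded_basis P D b co \<tau> \<longleftrightarrow> (\<forall>x. x = (\<Sum>i<D. co i x *\<^sub>R b i)) \<and>
     (\<forall>i<D. linear (co i) \<and> (\<forall>j<D. co i (b j) = (if i = j then 1 else 0)) \<and> b i \<in> monomials P \<and>
        computable (\<tau> i) \<and> (\<forall>q. valid_term K P (term_decode (\<tau> i q)) \<and>
          term_eval sc star (points P) (term_decode (\<tau> i q)) = rat_val q *\<^sub>R b i))"

text \<open>The basis is drawn from bare words and their images under \<open>J\<close>. A rational
  multiple of a basis vector is then a single term with a real or a purely imaginary coefficient,
  and its code is obtained by inserting the code of the rational.\<close>

lemma coded_basis_exists:
  assumes "is_presentation K sc star P"
  shows "\<exists>D b co \<tau>. coded_basis P D b co \<tau>"
proof -
  define W where "W = {word_eval star (points P) l ls | l ls. valid_word P l ls}"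
  define M where "M = W \<union> J ` W"
  have WM: "W \<subseteq> monomials P" unfolding W_def using word_in_monomials by blast
  then have MM: "M \<subseteq> monomials P" unfolding M_def using monomials_J by blast
  have "monomials P \<subseteq> span M"
  proof
    fix x assume "x \<in> monomials P"
    then obtain d l ls where x: "coefficient d \<in> K" "valid_word P l ls"
      "x = sc (coefficient d) (word_eval star (points P) l ls)" by (rule monomialsE)
    then have "word_eval star (points P) l ls \<in> W" unfolding W_def by blast
    then show "x \<in> span M" unfolding x(3) sc_eq[OF x(1)]
      by (intro span_add span_scale span_base) (auto simp: M_def)
  qed
  then have "span M = UNIV"
    using span_monomials[OF assms] by (metis span_minimal subspace_span top.extremum_uniqueI)
  then obtain B where B: "B \<subseteq> M" "independent B" "span B = UNIV"
    using real_vector.basis_exists[of M] by (metis real_vector.span_mono real_vector.span_span top.extremum_uniqueI)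
  have finB: "finite B"
    using real_vector.independent_span_bound[of "e ` {..<N}" B] B(2) fd.span_expansion by auto
  obtain b :: "nat \<Rightarrow> 'a" where b: "bij_betw b {..<card B} B"
    using ex_bij_betw_nat_finite[OF finB] by (auto simp: atLeast0LessThan)
  define D where "D = card B"
  define co where "co i x = representation B x (b i)" for i x
  have bB: "b i \<in> B" if "i < D" for i using b that unfolding D_def by (auto simp: bij_betw_def)
  have b_inj: "b i = b j \<longleftrightarrow> i = j" if "i < D" "j < D" for i j
    using b that unfolding D_def by (auto simp: bij_betw_def inj_on_def)
  have exp: "x = (\<Sum>i<D. co i x *\<^sub>R b i)" for x
  proof -
    have "x = (\<Sum>v\<in>B. representation B x v *\<^sub>R v)"
      using real_vector.sum_representation_eq[OF B(2) _ finB, of x] B(3) by simp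
    also have "\<dots> = (\<Sum>i<D. co i x *\<^sub>R b i)"
      unfolding co_def D_def using sum.reindex_bij_betw[OF b, of "\<lambda>v. representation B x v *\<^sub>R v"] by simp
    finally show ?thesis .
  qed
  have lin: "linear (co i)" for i
    unfolding co_def by (rule linearI)
      (simp_all add: real_vector.representation_add[OF B(2)] real_vector.representation_scale[OF B(2)] B(3))
  have dual: "co i (b j) = (if i = j then 1 else 0)" if "i < D" "j < D" for i j
    using that bB b_inj by (simp add: co_def real_vector.representation_basis[OF B(2)])
  have tau: "\<exists>f. computable f \<and> (\<forall>q. valid_term K P (term_decode (f q)) \<and>
          term_eval sc star (points P) (term_decode (f q)) = rat_val q *\<^sub>R b i)" if i: "i < D" for i
  proof -
    obtain l ls where w: "valid_word P l ls"
      and or: "b i = word_eval star (points P) l ls \<or> b i = J (word_eval star (points P) l ls)"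
      using bB[OF i] B(1) unfolding M_def W_def by blast
    obtain w where "map_prod letter_decode (map letter_decode \<circ> list_decode) (prod_decode w) = (l, ls)"
    proof -
      obtain m where "letter_decode m = l" by (metis surjD surj_letter_decode)
      moreover obtain ms where "map letter_decode ms = ls" by (metis ex_map_conv surjD surj_letter_decode)
      ultimately show thesis by (intro that[of "pr m (list_encode ms)"]) simp
    qed
    then have td: "term_decode (pr (pr p q) w) = ((rat_decode p, rat_decode q), l, ls)" for p q
      by (simp add: term_decode_def)
    \<comment> \<open>The code 0 denotes the rational 0 and fills the vanishing part of the
      coefficient.\<close>
    have r0: "rat_decode 0 = 0" by (simp add: rat_decode_def prod_decode_def prod_decode_aux.simps int_decode_def sum_decode_def)
    show ?thesis
    proof (cases "b i = word_eval star (points P) l ls")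
      case True
      have "coefficient (rat_decode q, 0) = of_real (rat_val q)" for q by (simp add: coefficient_def complex_eq_iff)
      then show ?thesis using w True K_of_real
        by (intro exI[of _ "\<lambda>q. pr (pr q 0) w"])
          (auto simp: td r0 valid_term_def sc_of_real word_eval_def intro!: computable_intros)
    next
      case False
      then have U: "K = UNIV" and bi: "b i = J (word_eval star (points P) l ls)" using or J_real by auto
      have "coefficient (0, rat_decode q) = Complex 0 (rat_val q)" for q by (simp add: coefficient_def)
      then show ?thesis using w U bi 
        by (intro exI[of _ "\<lambda>q. pr (pr 0 q) w"])
          (auto simp: td r0 valid_term_def sc_eq word_eval_def intro!: computable_intros)
    qed
  qed
  obtain \<tau> where "\<And>i. i < D \<Longrightarrow> computable (\<tau> i) \<and> (\<forall>q. valid_term K P (term_decode (\<tau> i q)) \<and>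
          term_eval sc star (points P) (term_decode (\<tau> i q)) = rat_val q *\<^sub>R b i)"
    using tau by metis
  moreover have "b i \<in> monomials P" if "i < D" for i using bB[OF that] B(1) MM by blast
  ultimately have "coded_basis P D b co \<tau>" unfolding coded_basis_def
    by (intro conjI allI impI exp lin dual) auto
  then show ?thesis by blast
qed

end

section \<open>Coordinates are computable\<close>

lemma semidecidable_ball: "finite I \<Longrightarrow> (\<And>i. i \<in> I \<Longrightarrow> semidecidable (P i)) \<Longrightarrow> semidecidable (\<lambda>x. \<forall>i\<in>I. P i x)"
  by (induction I rule: finite_induct) (auto intro: semidecidable_const semidecidable_conj)

lemma computable_real_on_ball_abs_less:
  assumes "finite I" "\<And>i. i \<in> I \<Longrightarrow> computable_real_on S (u i)" "computable_real_on S v"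
  shows "\<exists>W. semidecidable W \<and> (\<forall>n\<in>S. W n \<longleftrightarrow> (\<forall>i\<in>I. \<bar>u i n\<bar> < v n))"
proof -
  have "\<forall>i. \<exists>W. i \<in> I \<longrightarrow> semidecidable W \<and> (\<forall>n\<in>S. W n \<longleftrightarrow> \<bar>u i n\<bar> < v n)"
    using computable_real_on_abs_less[OF assms(2,3)] by blast
  then obtain W where W: "\<And>i. i \<in> I \<Longrightarrow> semidecidable (W i) \<and> (\<forall>n\<in>S. W i n \<longleftrightarrow> \<bar>u i n\<bar> < v n)"
    by metis
  show ?thesis
    by (rule exI[of _ "\<lambda>n. \<forall>i\<in>I. W i n"]) (use W in \<open>auto intro!: semidecidable_ball assms(1)\<close>)
qed

lemma semidecidable_ball_abs_less:
  assumes "finite I" "\<And>i. i \<in> I \<Longrightarrow> computable_real_on UNIV (u i)" "computable_real_on UNIV v"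
  shows "semidecidable (\<lambda>n. \<forall>i\<in>I. \<bar>u i n\<bar> < v n)"
proof -
  obtain W where W: "semidecidable W" "\<forall>n\<in>UNIV. W n \<longleftrightarrow> (\<forall>i\<in>I. \<bar>u i n\<bar> < v n)"
    using computable_real_on_ball_abs_less[of I UNIV u v, OF assms] by blast
  then have "W = (\<lambda>n. \<forall>i\<in>I. \<bar>u i n\<bar> < v n)" by auto
  then show ?thesis using W(1) by simp
qed

text \<open>A nonempty list is coded by \<open>Suc (pr x n)\<close> with head \<open>x\<close> and
  tail \<open>n\<close>, so the iterates are the codes of the tails. Running past the end is
  harmless, since 0 is mapped to 0.\<close>

lemma list_decode_tails:
  "x \<in> set (list_decode n) \<longleftrightarrow>
     (\<exists>j. ((\<lambda>n. p2 (n - 1)) ^^ j) n \<noteq> 0 \<and> x = p1 (((\<lambda>n. p2 (n - 1)) ^^ j) n - 1))"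
proof (induction n rule: list_decode.induct)
  case 1
  have "p2 0 = 0" by (simp add: p2_def prod_decode_def prod_decode_aux.simps)
  then have "((\<lambda>n. p2 (n - 1)) ^^ j) 0 = 0" for j by (induction j) auto
  then show ?case by simp
next
  case (2 n)
  have d: "prod_decode n = (p1 n, p2 n)" by (simp add: p1_def p2_def)
  have "(\<exists>j. ((\<lambda>n. p2 (n - 1)) ^^ j) (Suc n) \<noteq> 0 \<and> x = p1 (((\<lambda>n. p2 (n - 1)) ^^ j) (Suc n) - 1)) \<longleftrightarrow>
     x = p1 n \<or> (\<exists>j. ((\<lambda>n. p2 (n - 1)) ^^ j) (p2 n) \<noteq> 0 \<and> x = p1 (((\<lambda>n. p2 (n - 1)) ^^ j) (p2 n) - 1))"
    (is "(\<exists>j. ?Q j) \<longleftrightarrow> _")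
  proof -
    have "(\<exists>j. ?Q j) \<longleftrightarrow> ?Q 0 \<or> (\<exists>j. ?Q (Suc j))" by (metis not0_implies_Suc)
    then show ?thesis by (simp only: funpow_Suc_right o_apply) simp
  qed
  then show ?case using 2[OF d[symmetric]] by (simp add: d)
qed

lemma semidecidable_list_ex: assumes "semidecidable P" "computable f" shows "semidecidable (\<lambda>n. \<exists>x\<in>set (list_decode (f n)). P x)"
proof -
  have "computable (\<lambda>x. ((\<lambda>n. p2 (n - 1)) ^^ p1 (pr (p2 x) (f (p1 x)))) (p2 (pr (p2 x) (f (p1 x)))))"
    by (intro computable_comp[OF computable_funpow, of "\<lambda>n. p2 (n - 1)"] computable_intros computable_comp[OF assms(2)])
  then have t: "computable (\<lambda>x. ((\<lambda>n. p2 (n - 1)) ^^ p2 x) (f (p1 x)))" by simp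
  have "semidecidable (\<lambda>n. \<exists>j. 0 < ((\<lambda>n. p2 (n - 1)) ^^ j) (f n) \<and> P (p1 (((\<lambda>n. p2 (n - 1)) ^^ j) (f n) - 1)))"
    by (intro semidecidable_ex semidecidable_conj semidecidable_less semidecidable_comp[OF assms(1)] computable_intros t)
  moreover have "(\<exists>x\<in>set (list_decode (f n)). P x) \<longleftrightarrow>
     (\<exists>j. 0 < ((\<lambda>n. p2 (n - 1)) ^^ j) (f n) \<and> P (p1 (((\<lambda>n. p2 (n - 1)) ^^ j) (f n) - 1)))" for n
    unfolding Bex_def list_decode_tails by auto
  ultimately show ?thesis by simp
qed

lemma semidecidable_not_special: assumes "computable f" shows "semidecidable (\<lambda>n. f n \<notin> special_indices P)"
proof (cases "num_points P")
  case (enat M)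
  then show ?thesis using semidecidable_le[OF computable_const[of M] assms] by (simp add: special_indices_def not_less)
qed (simp add: special_indices_def semidecidable_const)

lemma letter_index_decode: "letter_index (letter_decode n) = n div 2"
  by (simp add: letter_decode_def)

text \<open>Algorithms have to halt on every number. This lets the final search stop on inputs that
  are not codes of rational points; a single bad term is enough to detect them.\<close>

lemma semidecidable_not_rational_code:
  assumes K: "K = \<real> \<or> K = UNIV"
  shows "semidecidable (\<lambda>n. \<not> rational_code K P n)"
proof -
  have "semidecidable (\<lambda>t. coefficient (map_prod rat_decode rat_decode (prod_decode (p1 t))) \<notin> K)"
  proof (cases "K = UNIV")
    case False
    have "coefficient (map_prod rat_decode rat_decode (prod_decode (p1 t))) \<notin> K \<longleftrightarrow>
        rat_val (p2 (p1 t)) < rat_val 0 \<or> rat_val 0 < rat_val (p2 (p1 t))" for t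
    proof -
      have "prod_decode (p1 t) = (p1 (p1 t), p2 (p1 t))" by (simp add: p1_def p2_def)
      moreover have "rat_val 0 = 0" by (simp add: rat_val_eq p1_def p2_def prod_decode_def prod_decode_aux.simps)
      moreover have "K = \<real>" using False K by blast
      ultimately show ?thesis by (auto simp: coefficient_def complex_is_Real_iff)
    qed
    then show ?thesis by (simp only:) (intro semidecidable_disj semidecidable_rat_less computable_rat_rat_val computable_intros)
  qed (simp add: semidecidable_const)
  then have ceT: "semidecidable (\<lambda>t. coefficient (map_prod rat_decode rat_decode (prod_decode (p1 t))) \<notin> K \<or>
      p1 (p2 t) div 2 \<notin> special_indices P \<or> (\<exists>l\<in>set (list_decode (p2 (p2 t))). l div 2 \<notin> special_indices P))"
    by (intro semidecidable_disj semidecidable_not_special semidecidable_list_ex computable_div2 computable_intros)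
  moreover have "\<not> valid_term K P (term_decode t) \<longleftrightarrow> (coefficient (map_prod rat_decode rat_decode (prod_decode (p1 t))) \<notin> K \<or>
      p1 (p2 t) div 2 \<notin> special_indices P \<or> (\<exists>l\<in>set (list_decode (p2 (p2 t))). l div 2 \<notin> special_indices P))" for t
  proof -
    have "prod_decode t = (p1 t, p2 t)" "prod_decode (p2 t) = (p1 (p2 t), p2 (p2 t))" by (simp_all add: p1_def p2_def)
    then show ?thesis by (auto simp: valid_term_def term_decode_def valid_word_def letter_index_decode image_subset_iff)
  qed
  ultimately have "semidecidable (\<lambda>t. \<not> valid_term K P (term_decode t))" by simp
  from semidecidable_list_ex[OF this computable_id]
  show ?thesis by (simp add: rational_code_iff poly_decode_def)
qed

text \<open>Addition of a coded combination of basis vectors is performed on codes by prepending one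
  term for each basis vector to the polynomial \<open>n\<close>.\<close>

fun extend_code :: "(nat \<Rightarrow> nat \<Rightarrow> nat) \<Rightarrow> nat \<Rightarrow> nat \<Rightarrow> nat \<Rightarrow> nat" where
  "extend_code \<tau> 0 s n = n"
| "extend_code \<tau> (Suc i) s n = Suc (pr (\<tau> i (component i s)) (extend_code \<tau> i s n))"

lemma computable_extend_code:
  assumes "\<And>i. i < D \<Longrightarrow> computable (\<tau> i)" "computable f" "computable g" shows "computable (\<lambda>x. extend_code \<tau> D (f x) (g x))"
  using assms(1)
proof (induction D)
  case 0 show ?case using assms(3) by simp
next
  case (Suc D)
  have "computable (\<lambda>x. extend_code \<tau> D (f x) (g x))" by (rule Suc.IH[OF Suc.prems]) simp
  moreover have "computable (\<lambda>x. \<tau> D (component D (f x)))"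
    by (rule computable_comp[OF Suc.prems computable_component[OF assms(2)]]) simp
  ultimately show ?case unfolding extend_code.simps by (intro computable_Suc computable_pr)
qed

context fd_cstar begin

context
  fixes P D b co \<tau> assumes basis: "coded_basis P D b co \<tau>"
begin

lemma basis_expansion: "x = (\<Sum>i<D. co i x *\<^sub>R b i)"
  and basis_linear: "i < D \<Longrightarrow> linear (co i)"
  and basis_dual: "i < D \<Longrightarrow> j < D \<Longrightarrow> co i (b j) = (if i = j then 1 else 0)"
  and basis_monomials: "i < D \<Longrightarrow> b i \<in> monomials P"
  and basis_cf: "i < D \<Longrightarrow> computable (\<tau> i)"
  and basis_valid: "i < D \<Longrightarrow> valid_term K P (term_decode (\<tau> i q))"
  and basis_eval: "i < D \<Longrightarrow> term_eval sc star (points P) (term_decode (\<tau> i q)) = rat_val q *\<^sub>R b i"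
  using basis unfolding coded_basis_def by blast+

lemma rational_code_extend: "rational_code K P n \<Longrightarrow> rational_code K P (extend_code \<tau> D s n)"
proof -
  assume n: "rational_code K P n"
  have "i \<le> D \<Longrightarrow> rational_code K P (extend_code \<tau> i s n)" for i
    using n by (induction i) (auto simp: rational_code_iff poly_decode_Suc basis_valid)
  then show ?thesis by simp
qed

lemma rational_point_extend:
  "rational_point sc star P (extend_code \<tau> D s n) =
     (\<Sum>i<D. rat_val (component i s) *\<^sub>R b i) + rational_point sc star P n"
proof -
  have "i \<le> D \<Longrightarrow> rational_point sc star P (extend_code \<tau> i s n) =
     (\<Sum>i<i. rat_val (component i s) *\<^sub>R b i) + rational_point sc star P n" for i
    by (induction i) (auto simp: rational_point_def poly_eval_def poly_decode_Suc basis_eval)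
  then show ?thesis by simp
qed

lemma coord_sum: "i < D \<Longrightarrow> co i (\<Sum>j<D. r j *\<^sub>R b j) = r i"
  by (simp add: linear_sum[OF basis_linear] linear_scale[OF basis_linear] basis_dual if_distrib cong: if_cong)

text \<open>The norm oracle suffices: search for a rational combination of basis vectors which,
  added to the given point, leaves a vector of small norm. The negated coefficients are then close
  to the coordinates, because the coordinate functionals are bounded.\<close>

lemma coord_computable:
  assumes P: "computable_presentation K sc star P" and i: "i < D"
  shows "computable_real_on {n. rational_code K P n} (\<lambda>n. co i (rational_point sc star P n))"
proof -
  define V where "V = {n. rational_code K P n}"
  obtain f where f: "effective f"
    "\<And>n k. rational_code K P n \<Longrightarrow> \<bar>norm (rational_point sc star P n) - rat_val (f n k)\<bar> < (1 / 2) ^ k"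
    using P unfolding computable_presentation_def by blast
  have norm: "computable_real_on V (\<lambda>n. norm (rational_point sc star P n))"
    by (rule computable_real_on_oracle[OF f(1)]) (use f(2) in \<open>simp add: V_def\<close>)
  obtain C where C: "C > 0" "\<And>x. \<bar>co i x\<bar> \<le> C * norm x"
    using fd.linear_bounded[OF basis_linear[OF i]] by auto
  \<comment> \<open>The bound \<open>C\<close> of the coordinate functional is absorbed by
    \<open>c0\<close> extra binary digits in the norm test.\<close>
  obtain c0 :: nat where c0: "C < 2 ^ c0" using real_arch_pow[of 2 C] by auto
  define u where "u z = norm (rational_point sc star P (extend_code \<tau> D (p2 (p2 z)) (p1 z)))" for z
  have "computable_real_on {z. p1 z \<in> V} u" unfolding u_def
    by (rule computable_real_on_comp[OF norm])
       (auto simp: V_def rational_code_extend intro!: computable_extend_code basis_cf computable_intros)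
  moreover have "computable_real_on {z. p1 z \<in> V} (\<lambda>z. (1 / 2) ^ (p1 (p2 z) + c0))"
    by (intro computable_real_on_rat computable_rat_half_power computable_intros)
  ultimately obtain W where W: "semidecidable W" "\<And>z. p1 z \<in> V \<Longrightarrow> W z \<longleftrightarrow> u z < (1 / 2) ^ (p1 (p2 z) + c0)"
    using computable_real_on_less by blast
  show ?thesis unfolding V_def[symmetric]
  proof (rule computable_real_onI[of "\<lambda>n k q. \<exists>s. W (pr n (pr k s)) \<and> rat_val q = - rat_val (component i s)"])
    show "semidecidable (\<lambda>z. \<exists>s. W (pr (p1 z) (pr (p1 (p2 z)) s)) \<and> rat_val (p2 (p2 z)) = - rat_val (component i s))"
      by (intro semidecidable_ex semidecidable_conj semidecidable_comp[OF W(1)] semidecidable_rat_eq computable_rat_intros computable_component computable_intros)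
    fix n k assume n: "n \<in> V"
    define x where "x = rational_point sc star P n"
    have uW: "W (pr n (pr k s)) \<longleftrightarrow> norm ((\<Sum>j<D. rat_val (component j s) *\<^sub>R b j) + x) < (1 / 2) ^ (k + c0)" for s
      using W(2)[of "pr n (pr k s)"] n by (simp add: u_def rational_point_extend x_def)
    \<comment> \<open>The summand 1 keeps \<open>L\<close> positive and makes
      \<open>(L - 1) / L\<close> less than 1, hence the norm strictly below the threshold.\<close>
    define L where "L = 1 + (\<Sum>j<D. norm (b j))"
    have L: "L > 0" unfolding L_def by (intro add_pos_nonneg sum_nonneg) auto
    obtain s where s: "\<forall>j<D. \<bar>- co j x - rat_val (component j s)\<bar> < (1 / 2) ^ (k + c0) / L"
      using component_dense[of "(1 / 2) ^ (k + c0) / L" D "\<lambda>j. - co j x"] L by auto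
    have "(\<Sum>j<D. rat_val (component j s) *\<^sub>R b j) + x = (\<Sum>j<D. (rat_val (component j s) + co j x) *\<^sub>R b j)"
      by (simp add: scaleR_left_distrib sum.distrib basis_expansion[of x, symmetric])
    also have "norm \<dots> \<le> (\<Sum>j<D. (1 / 2) ^ (k + c0) / L * norm (b j))"
    proof (intro order_trans[OF norm_sum] sum_mono)
      fix j assume "j \<in> {..<D}"
      then have "j < D" by simp
      then have "\<bar>rat_val (component j s) + co j x\<bar> \<le> (1 / 2) ^ (k + c0) / L"
        using s[rule_format, of j] by linarith
      then show "norm ((rat_val (component j s) + co j x) *\<^sub>R b j) \<le> (1 / 2) ^ (k + c0) / L * norm (b j)"
        unfolding norm_scaleR by (intro mult_right_mono) auto
    qed
    also have "\<dots> = (1 / 2) ^ (k + c0) / L * (L - 1)"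
      by (simp add: L_def sum_distrib_left)
    also have "\<dots> < (1 / 2) ^ (k + c0)" using L by (simp add: field_simps)
    finally have "W (pr n (pr k s))" using uW by blast
    moreover obtain q where "rat_val q = - rat_val (component i s)"
      by (metis rat_val_surj Rats_minus_iff Rats_of_rat)
    ultimately show "\<exists>q s. W (pr n (pr k s)) \<and> rat_val q = - rat_val (component i s)" by blast
    fix q assume "\<exists>s. W (pr n (pr k s)) \<and> rat_val q = - rat_val (component i s)"
    then obtain s where s: "norm ((\<Sum>j<D. rat_val (component j s) *\<^sub>R b j) + x) < (1 / 2) ^ (k + c0)"
      and q: "rat_val q = - rat_val (component i s)" using uW by blast
    have "co i x - rat_val q = co i ((\<Sum>j<D. rat_val (component j s) *\<^sub>R b j) + x)"
      using i by (simp add: q linear_add[OF basis_linear] coord_sum)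
    then have "\<bar>co i x - rat_val q\<bar> \<le> C * norm ((\<Sum>j<D. rat_val (component j s) *\<^sub>R b j) + x)"
      using C(2) by simp
    also have "\<dots> < C * (1 / 2) ^ (k + c0)" using s C(1) by (intro mult_strict_left_mono)
    also have "\<dots> < 2 ^ c0 * (1 / 2) ^ (k + c0)" using c0 by (intro mult_strict_right_mono) auto
    also have "\<dots> = (1 / 2) ^ k" by (simp add: power_add power_one_over)
    finally show "\<bar>co i (rational_point sc star P n) - rat_val q\<bar> < (1 / 2) ^ k" by (simp add: x_def)
  qed
qed

text \<open>This makes the structure constants computable reals: products, adjoints and
  \<open>J\<close>-images of basis vectors are again monomials, each with a fixed code.\<close>

lemma coord_monomial_computable:
  assumes P: "computable_presentation K sc star P" and i: "i < D" and x: "x \<in> monomials P"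
  shows "computable_real_on S (\<lambda>_. co i x)"
proof -
  obtain n where n: "rational_code K P n" "rational_point sc star P n = x"
    using monomial_code[OF x] by blast
  show ?thesis
    using computable_real_on_comp[OF coord_computable[OF P i] computable_const[of n], of S] n by simp
qed

end

end

lemma geometric_cauchy_limit:
  fixes x :: "nat \<Rightarrow> real"
  assumes "\<And>k. \<bar>x (Suc k) - x k\<bar> \<le> C * (1 / 2) ^ k"
  shows "\<exists>l. \<forall>k. \<bar>l - x k\<bar> \<le> 2 * C * (1 / 2) ^ k"
proof -
  have d: "\<bar>x (k + m) - x k\<bar> \<le> 2 * C * (1 / 2) ^ k - 2 * C * (1 / 2) ^ (k + m)" for k m
  proof (induction m)
    case (Suc m)
    then show ?case using assms[of "k + m"] by simp
  qed simp
  have C: "C \<ge> 0" using assms[of 0] by simp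
  have b: "\<bar>x (k + m) - x k\<bar> \<le> 2 * C * (1 / 2) ^ k" for k m
    using d[of k m] C by (smt (verit) zero_le_power mult_nonneg_nonneg divide_nonneg_nonneg)
  have lim0: "(\<lambda>k. 2 * C * (1 / 2) ^ k) \<longlonglongrightarrow> 0"
    by (intro tendsto_mult_right_zero LIMSEQ_power_zero) auto
  have "Cauchy x"
  proof (rule CauchyI')
    fix e :: real assume "0 < e"
    then obtain M where M: "2 * C * (1 / 2) ^ M < e / 2"
      using order_tendstoD(2)[OF lim0, of "e / 2"] by (auto simp: eventually_sequentially)
    have "dist (x m) (x n) < e" if "M \<le> m" "m < n" for m n
      using b[of M "m - M"] b[of M "n - M"] that M by (simp add: dist_real_def)
    then show "\<exists>M. \<forall>m\<ge>M. \<forall>n>m. dist (x m) (x n) < e" by blast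
  qed
  then obtain l where l: "x \<longlonglongrightarrow> l" using Cauchy_convergent convergent_def by blast
  have "\<bar>l - x k\<bar> \<le> 2 * C * (1 / 2) ^ k" for k
  proof (rule tendsto_upperbound)
    show "(\<lambda>n. \<bar>x n - x k\<bar>) \<longlonglongrightarrow> \<bar>l - x k\<bar>" by (intro tendsto_intros l)
    show "\<forall>\<^sub>F n in sequentially. \<bar>x n - x k\<bar> \<le> 2 * C * (1 / 2) ^ k"
      unfolding eventually_sequentially using b[of k] by (metis le_Suc_ex)
  qed simp
  then show ?thesis by blast
qed

section \<open>A computable automorphism\<close>

locale two_bases = fd_cstar K sc star J \<epsilon> ip N e c
  for K :: "complex set" and sc :: "complex \<Rightarrow> 'a::{real_normed_algebra, banach} \<Rightarrow> 'a"
    and star J :: "'a \<Rightarrow> 'a" and \<epsilon> :: real and ip :: "'a \<Rightarrow> 'a \<Rightarrow> real" and N :: nat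
    and e :: "nat \<Rightarrow> 'a" and c :: real +
  fixes P Q :: "'a presentation" and D D' :: nat and m n :: "nat \<Rightarrow> 'a" and co co' :: "nat \<Rightarrow> 'a \<Rightarrow> real"
    and \<tau> \<tau>' :: "nat \<Rightarrow> nat \<Rightarrow> nat"
  assumes P: "computable_presentation K sc star P" and Q: "computable_presentation K sc star Q"
    and basis_P: "coded_basis P D m co \<tau>" and basis_Q: "coded_basis Q D' n co' \<tau>'"
begin

lemmas expP = basis_expansion[OF basis_P] and linP = basis_linear[OF basis_P]
  and dualP = basis_dual[OF basis_P] and monP = basis_monomials[OF basis_P]
  and expQ = basis_expansion[OF basis_Q] and linQ = basis_linear[OF basis_Q]
  and monQ = basis_monomials[OF basis_Q]
  and coord_sumQ = coord_sum[OF basis_Q]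

definition map_of_matrix :: "(nat \<Rightarrow> nat \<Rightarrow> real) \<Rightarrow> 'a \<Rightarrow> 'a" where
  "map_of_matrix t x = (\<Sum>j<D'. (\<Sum>i<D. co i x * t i j) *\<^sub>R n j)"

definition matrix_of_map :: "('a \<Rightarrow> 'a) \<Rightarrow> nat \<Rightarrow> nat \<Rightarrow> real" where
  "matrix_of_map S i j = co' j (S (m i))"

text \<open>For \<open>k = 0, 1, 2\<close>: the failure on basis vectors to respect products, the involution and \<open>J\<close>.\<close>

definition err :: "(nat \<Rightarrow> nat \<Rightarrow> real) \<Rightarrow> nat \<Rightarrow> nat \<Rightarrow> nat \<Rightarrow> 'a" where
  "err t k i j = (let T = map_of_matrix t in
     if k = 0 then mult_defect T (m i) (m j)
     else if k = 1 then T (star (m i)) - star (T (m i)) else T (J (m i)) - J (T (m i)))"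

definition index :: "(nat \<times> nat \<times> nat \<times> nat) set" where
  "index = {..<3} \<times> {..<D} \<times> {..<D} \<times> {..<D'}"

definition cerr :: "(nat \<Rightarrow> nat \<Rightarrow> real) \<Rightarrow> nat \<times> nat \<times> nat \<times> nat \<Rightarrow> real" where
  "cerr t = (\<lambda>(k, i, j, l). co' l (err t k i j))"

lemma finite_index: "finite index" by (simp add: index_def)

lemma linear_map_of_matrix: "linear (map_of_matrix t)"
  unfolding map_of_matrix_def
  by (rule linearI) (simp_all add: linear_add[OF linP] linear_scale[OF linP] distrib_right sum.distrib
      scaleR_left_distrib scaleR_sum_right sum_distrib_left mult.assoc)

lemma co_map: "l < D' \<Longrightarrow> co' l (map_of_matrix t x) = (\<Sum>i<D. co i x * t i l)"
  unfolding map_of_matrix_def by (rule coord_sumQ)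

lemma map_basis: "i < D \<Longrightarrow> map_of_matrix t (m i) = (\<Sum>j<D'. t i j *\<^sub>R n j)"
  unfolding map_of_matrix_def by (simp add: dualP if_distrib[of "\<lambda>x. x * _"] cong: if_cong)

lemma map_matrix: assumes "linear S" shows "map_of_matrix (matrix_of_map S) = S"
proof
  fix x
  have "S x = (\<Sum>i<D. co i x *\<^sub>R S (m i))"
    using arg_cong[OF expP[of x], of S] by (simp add: linear_sum[OF assms] linear_scale[OF assms])
  also have "\<dots> = (\<Sum>i<D. \<Sum>j<D'. (co i x * co' j (S (m i))) *\<^sub>R n j)"
    using arg_cong[OF expQ[of "S (m _)"], of "\<lambda>z. co _ x *\<^sub>R z"]
    by (intro sum.cong refl) (simp add: scaleR_sum_right)
  also have "\<dots> = map_of_matrix (matrix_of_map S) x"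
    unfolding map_of_matrix_def matrix_of_map_def scaleR_sum_left by (rule sum.swap)
  finally show "map_of_matrix (matrix_of_map S) x = S x" by simp
qed

text \<open>In coordinates the errors are polynomials of degree at most two in the matrix entries,
  with coordinates of monomials as coefficients. The one formula yields both their computability on
  coded matrices and their continuity under entrywise limits.\<close>

lemma cerr_eq:
  assumes "(k, i, j, l) \<in> index"
  shows "cerr t (k, i, j, l) = (if k = 0
     then (\<Sum>a<D. co a (m i * m j) * t a l) - (\<Sum>a<D'. \<Sum>b<D'. (t i a * t j b) * co' l (n a * n b))
     else if k = 1 then (\<Sum>a<D. co a (star (m i)) * t a l) - (\<Sum>a<D'. t i a * co' l (star (n a)))
     else (\<Sum>a<D. co a (J (m i)) * t a l) - (\<Sum>a<D'. t i a * co' l (J (n a))))"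
proof -
  have i: "i < D" "j < D" and l: "l < D'" using assms by (auto simp: index_def)
  note lin = linear_diff[OF linQ[OF l]] linear_sum[OF linQ[OF l]] linear_scale[OF linQ[OF l]]
    linear_sum[OF fd.linear_star] linear_scale[OF fd.linear_star] linear_sum[OF fd.linear_J] linear_scale[OF fd.linear_J]
  have "co' l (map_of_matrix t (m i) * map_of_matrix t (m j)) =
      (\<Sum>a<D'. \<Sum>b<D'. (t i a * t j b) * co' l (n a * n b))"
    by (simp add: map_basis i sum_product lin) (simp add: mult_ac)
  moreover have "co' l (star (map_of_matrix t (m i))) = (\<Sum>a<D'. t i a * co' l (star (n a)))"
    by (simp add: map_basis i lin)
  moreover have "co' l (J (map_of_matrix t (m i))) = (\<Sum>a<D'. t i a * co' l (J (n a)))"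
    by (simp add: map_basis i lin)
  ultimately show ?thesis
    by (auto simp: cerr_def err_def mult_defect_def lin co_map l Let_def)
qed

definition decode_matrix :: "nat \<Rightarrow> nat \<Rightarrow> nat \<Rightarrow> real" where
  "decode_matrix s i j = rat_val (component (i * D' + j) s)"

lemma computable_real_on_decode_matrix: "computable f \<Longrightarrow> computable_real_on S (\<lambda>z. decode_matrix (f z) i j)"
  unfolding decode_matrix_def by (intro computable_real_on_rat_val computable_component)

lemma computable_real_on_cerr: assumes "q \<in> index" "computable f" shows "computable_real_on S (\<lambda>z. cerr (decode_matrix (f z)) q)"
proof -
  obtain k i j l where q: "q = (k, i, j, l)" by (cases q) auto
  then have i: "(k, i, j, l) \<in> index" using assms by simp
  then have ix: "i < D" "j < D" "l < D'" by (auto simp: index_def)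
  note cp = coord_monomial_computable[OF basis_P P] and cq = coord_monomial_computable[OF basis_Q Q]
  show ?thesis unfolding q cerr_eq[OF i]
    by (cases "k = 0"; cases "k = 1")
      (auto intro!: computable_real_on_diff computable_real_on_sum computable_real_on_times computable_real_on_decode_matrix assms(2) cp cq ix
        monomials_mult monomials_star monomials_J monP monQ)
qed

lemma tendsto_cerr:
  assumes "q \<in> index" "\<And>i j. i < D \<Longrightarrow> j < D' \<Longrightarrow> (\<lambda>k. t k i j) \<longlonglongrightarrow> t' i j"
  shows "(\<lambda>k. cerr (t k) q) \<longlonglongrightarrow> cerr t' q"
proof -
  obtain k i j l where q: "q = (k, i, j, l)" by (cases q) auto
  then have i: "(k, i, j, l) \<in> index" using assms by simp
  then have ix: "i < D" "j < D" "l < D'" by (auto simp: index_def)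
  show ?thesis unfolding q cerr_eq[OF i]
    by (cases "k = 0"; cases "k = 1")
      (auto intro!: tendsto_diff tendsto_sum tendsto_mult tendsto_const assms(2) ix)
qed

definition small :: "(nat \<Rightarrow> nat \<Rightarrow> real) \<Rightarrow> real \<Rightarrow> bool" where
  "small t \<eta> \<longleftrightarrow> (\<forall>q\<in>index. \<bar>cerr t q\<bar> < \<eta>)"

definition dist_less :: "(nat \<Rightarrow> nat \<Rightarrow> real) \<Rightarrow> (nat \<Rightarrow> nat \<Rightarrow> real) \<Rightarrow> real \<Rightarrow> bool" where
  "dist_less t t' r \<longleftrightarrow> (\<forall>p\<in>{..<D} \<times> {..<D'}. \<bar>t (fst p) (snd p) - t' (fst p) (snd p)\<bar> < r)"

lemma dist_lessD: "dist_less t t' r \<Longrightarrow> i < D \<Longrightarrow> j < D' \<Longrightarrow> \<bar>t i j - t' i j\<bar> < r"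
  unfolding dist_less_def by force

lemma decode_matrix_dense:
  assumes "\<epsilon>' > 0" shows "\<exists>s. dist_less (decode_matrix s) t \<epsilon>'"
proof -
  obtain s where s: "\<forall>p<D * D'. \<bar>t (p div D') (p mod D') - rat_val (component p s)\<bar> < \<epsilon>'"
    using component_dense[OF assms, of "D * D'" "\<lambda>p. t (p div D') (p mod D')"] by blast
  have "\<bar>decode_matrix s i j - t i j\<bar> < \<epsilon>'" if "i < D" "j < D'" for i j
  proof -
    have "i * D' + j < Suc i * D'" using that by simp
    also have "\<dots> \<le> D * D'" using that by (intro mult_right_mono) auto
    finally show ?thesis using s[rule_format, of "i * D' + j"] that
      by (simp add: decode_matrix_def abs_minus_commute)
  qed
  then show ?thesis unfolding dist_less_def by auto
qed

text \<open>Being \<open>small\<close> is a finite set of strict inequalities between continuous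
  functions of the entries, so it survives a fine enough rational approximation.\<close>

lemma approximate_by_decoded:
  assumes "small t \<eta>" "\<epsilon>' > 0"
  shows "\<exists>s. small (decode_matrix s) \<eta> \<and> dist_less (decode_matrix s) t \<epsilon>'"
proof -
  have "\<exists>s. dist_less (decode_matrix s) t (min \<epsilon>' (inverse (real (Suc k))))" for k
    using assms(2) by (intro decode_matrix_dense) auto
  then obtain s where s: "\<And>k. dist_less (decode_matrix (s k)) t (min \<epsilon>' (inverse (real (Suc k))))" by metis
  have lim: "(\<lambda>k. decode_matrix (s k) i j) \<longlonglongrightarrow> t i j" if "i < D" "j < D'" for i j
  proof (rule LIM_zero_cancel, rule tendsto_rabs_zero_cancel,
      rule tendsto_sandwich[of "\<lambda>_. 0" _ _ "\<lambda>k. inverse (real (Suc k))"])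
    show "\<forall>\<^sub>F k in sequentially. \<bar>decode_matrix (s k) i j - t i j\<bar> \<le> inverse (real (Suc k))"
      using dist_lessD[OF s that] by (intro always_eventually allI) (simp add: less_imp_le)
  qed (use LIMSEQ_inverse_real_of_nat in auto)
  have "\<forall>\<^sub>F k in sequentially. \<forall>q\<in>index. \<bar>cerr (decode_matrix (s k)) q\<bar> < \<eta>"
  proof (intro eventually_ball_finite finite_index ballI)
    fix q assume q: "q \<in> index"
    have "(\<lambda>k. \<bar>cerr (decode_matrix (s k)) q\<bar>) \<longlonglongrightarrow> \<bar>cerr t q\<bar>"
      by (intro tendsto_rabs tendsto_cerr q lim)
    then show "\<forall>\<^sub>F k in sequentially. \<bar>cerr (decode_matrix (s k)) q\<bar> < \<eta>"
      using assms(1) q unfolding small_def by (intro order_tendstoD(2)) auto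
  qed
  then obtain k where "small (decode_matrix (s k)) \<eta>"
    unfolding small_def eventually_sequentially by auto
  moreover have "dist_less (decode_matrix (s k)) t \<epsilon>'" using s[of k] unfolding dist_less_def by auto
  ultimately show ?thesis by blast
qed

section \<open>Comparison of entrywise bounds on matrices with norm bounds on maps\<close>

lemma coordP_bound: "\<exists>C>0. \<forall>x. (\<Sum>i<D. \<bar>co i x\<bar>) \<le> C * norm x"
proof -
  have "\<forall>i. \<exists>C. i < D \<longrightarrow> C > 0 \<and> (\<forall>x. \<bar>co i x\<bar> \<le> C * norm x)"
    using fd.linear_bounded[OF linP] by (metis real_norm_def)
  then obtain C where C: "\<And>i x. i < D \<Longrightarrow> C i > 0 \<and> \<bar>co i x\<bar> \<le> C i * norm x" by metis
  have "(\<Sum>i<D. \<bar>co i x\<bar>) \<le> (1 + sum C {..<D}) * norm x" for x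
  proof -
    have "(\<Sum>i<D. \<bar>co i x\<bar>) \<le> (\<Sum>i<D. C i * norm x)" using C by (intro sum_mono) auto
    then show ?thesis by (simp add: sum_distrib_right distrib_right) (smt (verit) norm_ge_zero)
  qed
  moreover have "1 + sum C {..<D} > 0" using C by (intro add_pos_nonneg sum_nonneg) (auto simp: less_imp_le)
  ultimately show ?thesis by blast
qed

lemma coordQ_bound: "\<exists>C>0. \<forall>x. \<forall>i<D'. \<bar>co' i x\<bar> \<le> C * norm x"
proof -
  have "\<forall>i. \<exists>C. i < D' \<longrightarrow> C > 0 \<and> (\<forall>x. \<bar>co' i x\<bar> \<le> C * norm x)"
    using fd.linear_bounded[OF linQ] by (metis real_norm_def)
  then obtain C where C: "\<And>i x. i < D' \<Longrightarrow> C i > 0 \<and> \<bar>co' i x\<bar> \<le> C i * norm x" by metis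
  have "\<bar>co' i x\<bar> \<le> (1 + sum C {..<D'}) * norm x" if "i < D'" for i x
  proof -
    have "C i \<le> sum C {..<D'}" using that C by (intro member_le_sum) (auto simp: less_imp_le)
    then have "C i * norm x \<le> (1 + sum C {..<D'}) * norm x" by (intro mult_right_mono) auto
    then show ?thesis using C[OF that, of x] by linarith
  qed
  moreover have "1 + sum C {..<D'} > 0" using C by (intro add_pos_nonneg sum_nonneg) (auto simp: less_imp_le)
  ultimately show ?thesis by blast
qed

lemma norm_le_coords:
  assumes "\<And>l. l < D' \<Longrightarrow> \<bar>co' l x\<bar> \<le> r"
  shows "norm x \<le> r * (\<Sum>l<D'. norm (n l))"
proof -
  have "norm (\<Sum>l<D'. co' l x *\<^sub>R n l) \<le> (\<Sum>l<D'. r * norm (n l))"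
    by (intro order_trans[OF norm_sum] sum_mono) (auto intro!: mult_right_mono assms)
  then show ?thesis unfolding expQ[symmetric] by (simp add: sum_distrib_left)
qed

lemma small_defect: "\<exists>C>0. \<forall>t \<eta>. \<eta> > 0 \<longrightarrow> small t \<eta> \<longrightarrow> fd.defect_le (map_of_matrix t) (C * \<eta>)"
proof -
  obtain c0 where c0: "c0 > 0" "\<And>x. (\<Sum>i<D. \<bar>co i x\<bar>) \<le> c0 * norm x" using coordP_bound by blast
  define L where "L = (\<Sum>l<D'. norm (n l))"
  have L: "L \<ge> 0" unfolding L_def by (intro sum_nonneg) auto
  \<comment> \<open>Each argument costs a factor \<open>c0\<close>, and \<open>L\<close> turns a
    bound on the coordinates of the value into a norm bound: the bilinear defect needs
    \<open>c0 * c0 * L\<close>, the linear ones \<open>c0 * L\<close>.\<close>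
  define C where "C = (c0 * c0 + c0) * L + 1"
  have C: "C > 0" "c0 * c0 * L \<le> C" "c0 * L \<le> C"
    unfolding C_def using c0(1) L by (auto simp: distrib_right intro!: add_nonneg_pos)
  have "fd.defect_le (map_of_matrix t) (C * \<eta>)" if \<eta>: "\<eta> > 0" and sm: "small t \<eta>" for t \<eta>
  proof -
    define T where "T = map_of_matrix t"
    have T: "linear T" unfolding T_def by (rule linear_map_of_matrix)
    have ne: "norm (err t k i j) \<le> \<eta> * L" if "k < 3" "i < D" "j < D" for k i j
      unfolding L_def
      by (rule norm_le_coords) (use sm that in \<open>force simp: small_def index_def cerr_def\<close>)
    have single: "norm (F x) \<le> C * \<eta> * norm x"
      if F: "linear F" and b: "\<And>i. i < D \<Longrightarrow> norm (F (m i)) \<le> \<eta> * L" for F :: "'a \<Rightarrow> 'a" and x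
    proof -
      have "F x = (\<Sum>i<D. co i x *\<^sub>R F (m i))"
        using arg_cong[OF expP[of x], of F] by (simp add: linear_sum[OF F] linear_scale[OF F])
      also have "norm \<dots> \<le> (\<Sum>i<D. \<bar>co i x\<bar> * (\<eta> * L))"
        by (intro order_trans[OF norm_sum] sum_mono) (auto intro!: mult_left_mono b)
      also have "\<dots> = (\<Sum>i<D. \<bar>co i x\<bar>) * (\<eta> * L)" by (simp add: sum_distrib_right)
      also have "\<dots> \<le> (c0 * norm x) * (\<eta> * L)" using \<eta> L c0(2) by (intro mult_right_mono) auto
      also have "\<dots> = (c0 * L) * (\<eta> * norm x)" by simp
      also have "\<dots> \<le> C * (\<eta> * norm x)" using C \<eta> by (intro mult_right_mono) auto
      finally show ?thesis by (simp add: mult.assoc)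
    qed
    have "norm (mult_defect T x y) \<le> C * \<eta> * (norm x * norm y)" for x y
    proof -
      have 1: "linear (\<lambda>x. mult_defect T x y)" for y
        by (rule linearI) (simp_all add: mult_defect_def linear_add[OF T] linear_scale[OF T] algebra_simps)
      have 2: "linear (mult_defect T x)" for x
        by (rule linearI) (simp_all add: mult_defect_def linear_add[OF T] linear_scale[OF T] algebra_simps)
      have "mult_defect T x y = (\<Sum>i<D. co i x *\<^sub>R mult_defect T (m i) y)"
        using arg_cong[OF expP[of x], of "\<lambda>x. mult_defect T x y"] by (simp add: linear_sum[OF 1] linear_scale[OF 1])
      also have "\<dots> = (\<Sum>i<D. \<Sum>j<D. (co i x * co j y) *\<^sub>R mult_defect T (m i) (m j))"
      proof (intro sum.cong refl)
        fix i
        have "mult_defect T (m i) y = (\<Sum>j<D. co j y *\<^sub>R mult_defect T (m i) (m j))"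
          using arg_cong[OF expP[of y], of "mult_defect T (m i)"] by (simp add: linear_sum[OF 2] linear_scale[OF 2])
        then show "co i x *\<^sub>R mult_defect T (m i) y = (\<Sum>j<D. (co i x * co j y) *\<^sub>R mult_defect T (m i) (m j))"
          by (simp add: scaleR_sum_right)
      qed
      also have "norm \<dots> \<le> (\<Sum>i<D. \<Sum>j<D. (\<bar>co i x\<bar> * \<bar>co j y\<bar>) * (\<eta> * L))"
      proof (intro order_trans[OF norm_sum] sum_mono)
        fix i j assume "i \<in> {..<D}" "j \<in> {..<D}"
        then have "norm (mult_defect T (m i) (m j)) \<le> \<eta> * L" using ne[of 0 i j] by (simp add: err_def T_def Let_def)
        then show "norm ((co i x * co j y) *\<^sub>R mult_defect T (m i) (m j)) \<le> (\<bar>co i x\<bar> * \<bar>co j y\<bar>) * (\<eta> * L)"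
          by (simp add: abs_mult mult_left_mono)
      qed
      also have "\<dots> = ((\<Sum>i<D. \<bar>co i x\<bar>) * (\<Sum>j<D. \<bar>co j y\<bar>)) * (\<eta> * L)"
        unfolding sum_product by (simp add: sum_distrib_right)
      also have "\<dots> \<le> ((c0 * norm x) * (c0 * norm y)) * (\<eta> * L)"
        using \<eta> L c0 by (intro mult_right_mono mult_mono sum_nonneg) auto
      also have "\<dots> = (c0 * c0 * L) * (\<eta> * (norm x * norm y))" by simp
      also have "\<dots> \<le> C * (\<eta> * (norm x * norm y))" using C \<eta> by (intro mult_right_mono) auto
      finally show ?thesis by (simp add: mult.assoc)
    qed
    moreover have "norm (T (star x) - star (T x)) \<le> C * \<eta> * norm x" for x
    proof (rule single)
      show "linear (\<lambda>x. T (star x) - star (T x))"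
        by (rule linearI) (simp_all add: linear_add[OF T] linear_scale[OF T]
            linear_add[OF fd.linear_star] linear_scale[OF fd.linear_star] algebra_simps)
      show "norm (T (star (m i)) - star (T (m i))) \<le> \<eta> * L" if "i < D" for i
        using ne[of 1 i i] that by (simp add: err_def T_def Let_def)
    qed
    moreover have "norm (T (J x) - J (T x)) \<le> C * \<eta> * norm x" for x
    proof (rule single)
      show "linear (\<lambda>x. T (J x) - J (T x))"
        by (rule linearI) (simp_all add: linear_add[OF T] linear_scale[OF T]
            linear_add[OF fd.linear_J] linear_scale[OF fd.linear_J] algebra_simps)
      show "norm (T (J (m i)) - J (T (m i))) \<le> \<eta> * L" if "i < D" for i
        using ne[of 2 i i] that by (simp add: err_def T_def Let_def)
    qed
    ultimately show ?thesis unfolding fd.defect_le_def T_def by blast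
  qed
  then show ?thesis using C by blast
qed

lemma defect_small:
  "\<exists>C>0. \<forall>S \<eta>. \<eta> > 0 \<longrightarrow> linear S \<longrightarrow> fd.defect_le S \<eta> \<longrightarrow> small (matrix_of_map S) (C * \<eta>)"
proof -
  obtain c1 where c1: "c1 > 0" "\<And>x i. i < D' \<Longrightarrow> \<bar>co' i x\<bar> \<le> c1 * norm x" using coordQ_bound by blast
  define M where "M = 1 + (\<Sum>i<D. norm (m i))"
  have M1: "M \<ge> 1" unfolding M_def by (simp add: sum_nonneg)
  have mM: "norm (m i) \<le> M" if "i < D" for i
    using member_le_sum[of i "{..<D}" "\<lambda>i. norm (m i)"] that by (simp add: M_def)
  \<comment> \<open>As \<open>M \<ge> 1\<close>, the product \<open>M * M\<close> bounds both
    \<open>norm (m i) * norm (m j)\<close> and \<open>norm (m i)\<close>; the factor 2 provides the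
    strict inequality in \<open>small\<close>.\<close>
  define C where "C = 2 * c1 * M * M"
  have C: "C > 0" using c1 M1 by (simp add: C_def)
  have "small (matrix_of_map S) (C * \<eta>)" if \<eta>: "\<eta> > 0" and S: "linear S" and df: "fd.defect_le S \<eta>" for S \<eta>
    unfolding small_def
  proof
    fix q assume q: "q \<in> index"
    obtain k i j l where q': "q = (k, i, j, l)" by (cases q) auto
    then have i: "i < D" "j < D" "l < D'" using q by (auto simp: index_def)
    have one: "\<eta> * norm (m i) \<le> \<eta> * (M * M)"
      using \<eta> M1 mM[OF i(1)] by (intro mult_left_mono) (auto intro: order_trans[of _ "M * 1"] mult_left_mono)
    have two: "\<eta> * (norm (m i) * norm (m j)) \<le> \<eta> * (M * M)"
      using \<eta> M1 mM i by (intro mult_left_mono mult_mono) auto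
    have "norm (err (matrix_of_map S) k i j) \<le> \<eta> * (M * M)"
      using df one two unfolding fd.defect_le_def err_def map_matrix[OF S] Let_def
      by (auto split: if_splits intro: order_trans)
    then have "c1 * norm (err (matrix_of_map S) k i j) \<le> c1 * (\<eta> * (M * M))"
      using c1 by (intro mult_left_mono) auto
    then have "\<bar>cerr (matrix_of_map S) q\<bar> \<le> c1 * (\<eta> * (M * M))"
      using c1(2)[OF i(3), of "err (matrix_of_map S) k i j"] by (simp add: cerr_def q')
    also have "\<dots> < C * \<eta>" using c1 M1 \<eta> by (simp add: C_def)
    finally show "\<bar>cerr (matrix_of_map S) q\<bar> < C * \<eta>" .
  qed
  then show ?thesis using C by blast
qed

lemma near_matrix:
  "\<exists>C>0. \<forall>t t' r. r > 0 \<longrightarrow> (\<forall>i<D. \<forall>j<D'. \<bar>t i j - t' i j\<bar> \<le> r) \<longrightarrow> near (map_of_matrix t) (map_of_matrix t') (C * r)"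
proof -
  obtain c0 where c0: "c0 > 0" "\<And>x. (\<Sum>i<D. \<bar>co i x\<bar>) \<le> c0 * norm x" using coordP_bound by blast
  define L where "L = (\<Sum>l<D'. norm (n l))"
  have L: "L \<ge> 0" unfolding L_def by (intro sum_nonneg) auto
  have "near (map_of_matrix t) (map_of_matrix t') (c0 * (L + 1) * r)"
    if r: "r > 0" and tt: "\<And>i j. i < D \<Longrightarrow> j < D' \<Longrightarrow> \<bar>t i j - t' i j\<bar> \<le> r" for t t' r
    unfolding near_def
  proof
    fix x
    have "norm (map_of_matrix t x - map_of_matrix t' x) \<le> (c0 * norm x * r) * L"
      unfolding L_def
    proof (rule norm_le_coords)
      fix l assume l: "l < D'"
      have "co' l (map_of_matrix t x - map_of_matrix t' x) = (\<Sum>i<D. co i x * (t i l - t' i l))"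
        using l by (simp add: linear_diff[OF linQ] co_map right_diff_distrib sum_subtractf)
      also have "\<bar>\<dots>\<bar> \<le> (\<Sum>i<D. \<bar>co i x\<bar> * r)"
        by (intro order_trans[OF sum_abs] sum_mono) (auto simp: abs_mult intro!: mult_left_mono tt l)
      also have "\<dots> \<le> c0 * norm x * r"
        using c0(2)[of x] r by (simp add: mult_right_mono flip: sum_distrib_right)
      finally show "\<bar>co' l (map_of_matrix t x - map_of_matrix t' x)\<bar> \<le> c0 * norm x * r" .
    qed
    also have "\<dots> = (c0 * L) * (r * norm x)" by simp
    also have "\<dots> \<le> (c0 * (L + 1)) * (r * norm x)" using c0 r by (intro mult_right_mono) auto
    finally show "norm (map_of_matrix t x - map_of_matrix t' x) \<le> c0 * (L + 1) * r * norm x"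
      by (simp add: mult.assoc)
  qed
  moreover have "c0 * (L + 1) > 0" using c0 L by (intro mult_pos_pos) auto
  ultimately show ?thesis by blast
qed

lemma matrix_near:
  "\<exists>C>0. \<forall>S T r. r > 0 \<longrightarrow> near S T r \<longrightarrow> dist_less (matrix_of_map S) (matrix_of_map T) (C * r)"
proof -
  obtain c1 where c1: "c1 > 0" "\<And>x i. i < D' \<Longrightarrow> \<bar>co' i x\<bar> \<le> c1 * norm x" using coordQ_bound by blast
  \<comment> \<open>The summand 1 gives \<open>norm (m i) < M\<close> and thereby the strict
    inequality in \<open>dist_less\<close>.\<close>
  define M where "M = 1 + (\<Sum>i<D. norm (m i))"
  have mM: "norm (m i) < M" if "i < D" for i
    using member_le_sum[of i "{..<D}" "\<lambda>i. norm (m i)"] that by (simp add: M_def)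
  have M1: "M \<ge> 1" unfolding M_def by (simp add: sum_nonneg)
  have "dist_less (matrix_of_map S) (matrix_of_map T) (c1 * M * r)" if r: "r > 0" and nr: "near S T r" for S T r
  proof -
    have "\<bar>matrix_of_map S i j - matrix_of_map T i j\<bar> < c1 * M * r" if i: "i < D" "j < D'" for i j
    proof -
      have "\<bar>matrix_of_map S i j - matrix_of_map T i j\<bar> \<le> c1 * norm (S (m i) - T (m i))"
        using c1(2)[OF i(2)] by (simp add: matrix_of_map_def flip: linear_diff[OF linQ[OF i(2)]])
      also have "\<dots> \<le> c1 * (r * norm (m i))" using c1 nearD[OF nr] by (intro mult_left_mono) auto
      also have "\<dots> < c1 * (r * M)" using c1 r mM[OF i(1)] by simp
      finally show ?thesis by (simp add: mult_ac)
    qed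
    then show ?thesis unfolding dist_less_def by auto
  qed
  moreover have "c1 * M > 0" using c1 M1 by simp
  ultimately show ?thesis by blast
qed

end

lemma near_mono: "near S T r \<Longrightarrow> r \<le> r' \<Longrightarrow> near S T r'"
  unfolding near_def by (meson mult_right_mono norm_ge_zero order_trans)

lemma eq_zero_if_norm_le:
  fixes a :: "'a::real_normed_vector"
  assumes "\<And>\<eta>. \<eta> > 0 \<Longrightarrow> norm a \<le> C * \<eta> * r" "C > 0" "r \<ge> 0"
  shows "a = 0"
proof (rule ccontr)
  assume "a \<noteq> 0"
  define R where "R = r + 1"
  have R: "R > 0" "r \<le> R" using assms(3) by (simp_all add: R_def)
  define \<eta> where "\<eta> = norm a / (2 * C * R)"
  have "\<eta> > 0" using \<open>a \<noteq> 0\<close> assms(2) R by (simp add: \<eta>_def)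
  have "norm a \<le> C * \<eta> * r" using assms(1)[OF \<open>\<eta> > 0\<close>] .
  also have "\<dots> \<le> C * \<eta> * R" using \<open>\<eta> > 0\<close> assms(2) R by (intro mult_left_mono) auto
  also have "\<dots> = norm a / 2" using assms(2) R by (simp add: \<eta>_def)
  finally show False using \<open>a \<noteq> 0\<close> by simp
qed

context two_bases begin

lemma matrix_of_map_of_matrix: "i < D \<Longrightarrow> j < D' \<Longrightarrow> matrix_of_map (map_of_matrix t) i j = t i j"
  by (simp add: matrix_of_map_def map_basis coord_sumQ)

text \<open>A coded matrix is turned into a map, improved, turned back into a matrix and rounded to
  rational entries. Only the existence of the result matters, since it will be found by
  search.\<close>

lemma refinement:
  "\<exists>A>0. \<exists>\<delta>>0. \<forall>s \<eta>. 0 < \<eta> \<and> \<eta> \<le> \<delta> \<and> small (decode_matrix s) \<eta> \<and>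
     near (map_of_matrix (decode_matrix s)) (\<lambda>x. x) \<delta> \<longrightarrow>
     (\<exists>s'. small (decode_matrix s') (\<eta> / 2) \<and> dist_less (decode_matrix s') (decode_matrix s) (A * \<eta>))"
proof -
  obtain C1 where C1: "C1 > 0" "\<And>t \<eta>. \<eta> > 0 \<Longrightarrow> small t \<eta> \<Longrightarrow> fd.defect_le (map_of_matrix t) (C1 * \<eta>)"
    using small_defect by blast
  obtain C2 where C2: "C2 > 0" "\<And>S \<eta>. \<eta> > 0 \<Longrightarrow> linear S \<Longrightarrow> fd.defect_le S \<eta> \<Longrightarrow> small (matrix_of_map S) (C2 * \<eta>)"
    using defect_small by blast
  obtain C4 where C4: "C4 > 0" "\<And>S T r. r > 0 \<Longrightarrow> near S T r \<Longrightarrow> dist_less (matrix_of_map S) (matrix_of_map T) (C4 * r)"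
    using matrix_near by blast
  \<comment> \<open>The conversions from matrix to map and back multiply the defect by
    \<open>C1\<close> and \<open>C2\<close>; this ratio leaves exactly one half.\<close>
  define \<rho> where "\<rho> = 1 / (2 * C1 * C2)"
  have \<rho>: "\<rho> > 0" using C1 C2 by (simp add: \<rho>_def)
  obtain C \<delta>0 where C: "C > 0" and \<delta>0: "\<delta>0 > 0"
    and imp: "\<And>T \<eta>. linear T \<Longrightarrow> near T (\<lambda>x. x) \<delta>0 \<Longrightarrow> fd.defect_le T \<eta> \<Longrightarrow> 0 \<le> \<eta> \<Longrightarrow> \<eta> \<le> \<delta>0 \<Longrightarrow>
      \<exists>S. linear S \<and> near S T (C * \<eta>) \<and> fd.defect_le S (\<rho> * \<eta>)"
    using fd.improvement[OF \<rho>] by blast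
  define \<delta> where "\<delta> = min \<delta>0 (\<delta>0 / C1)"
  have \<delta>: "\<delta> > 0" "\<delta> \<le> \<delta>0" "C1 * \<delta> \<le> \<delta>0"
    using \<delta>0 C1(1) by (auto simp: \<delta>_def min_def field_simps)
  \<comment> \<open>The first term is the displacement of the improved matrix in terms of \<eta>;
    the summand 1 pays for rounding within \<eta>.\<close>
  define A where "A = C4 * C * C1 + 1"
  have A: "A > 0" using C4 C C1 by (simp add: A_def add_pos_pos)
  have "\<exists>s'. small (decode_matrix s') (\<eta> / 2) \<and> dist_less (decode_matrix s') (decode_matrix s) (A * \<eta>)"
    if \<eta>: "0 < \<eta>" "\<eta> \<le> \<delta>" and sm: "small (decode_matrix s) \<eta>"
      and nr: "near (map_of_matrix (decode_matrix s)) (\<lambda>x. x) \<delta>" for s \<eta>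
  proof -
    let ?T = "map_of_matrix (decode_matrix s)"
    have "C1 * \<eta> \<le> \<delta>0" using \<eta> \<delta>(3) C1(1) by (meson mult_left_mono less_imp_le order_trans)
    then obtain S where S: "linear S" "near S ?T (C * (C1 * \<eta>))" "fd.defect_le S (\<rho> * (C1 * \<eta>))"
      using imp[OF linear_map_of_matrix near_mono[OF nr \<delta>(2)] C1(2)[OF \<eta>(1) sm]] C1(1) \<eta>(1) by auto
    have "small (matrix_of_map S) (C2 * (\<rho> * (C1 * \<eta>)))"
      using S C1 \<rho> \<eta> by (intro C2) auto
    moreover have "C2 * (\<rho> * (C1 * \<eta>)) = \<eta> / 2" using C1(1) C2(1) by (simp add: \<rho>_def)
    ultimately have "small (matrix_of_map S) (\<eta> / 2)" by simp
    from approximate_by_decoded[OF this \<eta>(1)] obtain s' where s': "small (decode_matrix s') (\<eta> / 2)"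
      "dist_less (decode_matrix s') (matrix_of_map S) \<eta>" by blast
    have d: "dist_less (matrix_of_map S) (matrix_of_map ?T) (C4 * (C * (C1 * \<eta>)))"
      using C C1 \<eta> S by (intro C4) auto
    have "\<bar>decode_matrix s' i j - decode_matrix s i j\<bar> < A * \<eta>" if "i < D" "j < D'" for i j
      using dist_lessD[OF s'(2) that] dist_lessD[OF d that] matrix_of_map_of_matrix[OF that, of "decode_matrix s"]
      by (simp add: A_def algebra_simps)
    then show ?thesis using s'(1) unfolding dist_less_def by auto
  qed
  then show ?thesis using A \<delta> by blast
qed

lemma computable_automorphism:
  "\<exists>t. (\<forall>i<D. \<forall>j<D'. \<forall>S. computable_real_on S (\<lambda>_. t i j)) \<and> (\<forall>q\<in>index. cerr t q = 0) \<and> near (map_of_matrix t) (\<lambda>x. x) (1 / 2)"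
proof -
  obtain A \<delta> where A: "A > 0" and \<delta>: "\<delta> > 0"
    and ref: "\<And>s \<eta>. 0 < \<eta> \<Longrightarrow> \<eta> \<le> \<delta> \<Longrightarrow> small (decode_matrix s) \<eta> \<Longrightarrow>
       near (map_of_matrix (decode_matrix s)) (\<lambda>x. x) \<delta> \<Longrightarrow>
     (\<exists>s'. small (decode_matrix s') (\<eta> / 2) \<and> dist_less (decode_matrix s') (decode_matrix s) (A * \<eta>))"
    using refinement by blast
  obtain C3 where C3_pos: "C3 > 0" and C3_near: "\<forall>t t' r. r > 0 \<longrightarrow> (\<forall>i<D. \<forall>j<D'. \<bar>t i j - t' i j\<bar> \<le> r) \<longrightarrow>
      near (map_of_matrix t) (map_of_matrix t') (C3 * r)"
    using near_matrix by blast
  have C3: "C3 > 0" "\<And>t t' r. r > 0 \<Longrightarrow> (\<And>i j. i < D \<Longrightarrow> j < D' \<Longrightarrow> \<bar>t i j - t' i j\<bar> \<le> r) \<Longrightarrow>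
      near (map_of_matrix t) (map_of_matrix t') (C3 * r)"
    using C3_pos C3_near by simp_all
  \<comment> \<open>Entries within \<open>r\<close> of those of the identity give a map within
    \<delta> of it, where \<open>refinement\<close> applies, and within 1/2 of it, from which
    injectivity will follow.\<close>
  define r where "r = min \<delta> (1 / 2) / C3"
  have r: "r > 0" "C3 * r \<le> \<delta>" "C3 * r \<le> 1 / 2" using \<delta> C3(1) by (auto simp: r_def)
  define t0 where "t0 = matrix_of_map (\<lambda>x. x)"
  have t0: "map_of_matrix t0 = (\<lambda>x. x)" unfolding t0_def by (rule map_matrix) (simp add: linear_ident)
  \<comment> \<open>The identity has no defect at all, so rational matrices near its matrix can
    start the recursion with any prescribed defect.\<close>
  have small0: "small t0 \<eta>" if "\<eta> > 0" for \<eta>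
    using that linear_0[OF linQ] unfolding small_def
    by (auto simp: cerr_def err_def t0 mult_defect_def index_def)
  \<comment> \<open>\<open>A\<close> is merely some real number. A power of two above it is
    rational, so the bounds in \<open>G\<close> and \<open>R\<close> are computable
    rationals.\<close>
  obtain a :: nat where a: "A < 2 ^ a" using real_arch_pow[of 2 A] by auto
  define B :: real where "B = 2 ^ a"
  have B: "B > 0" "A < B" using a by (auto simp: B_def)
  \<comment> \<open>The displacements \<open>B * \<eta> k\<close> sum to
    \<open>2 * B * \<eta> 0\<close>. This choice puts even \<open>3 * B * \<eta> 0\<close> below
    \<open>r / 2\<close>; the other half of \<open>r\<close> is the distance of the initial matrix
    from that of the identity.\<close>
  obtain h where h: "(1 / 2) ^ h < min \<delta> (r / (6 * B))"
    using real_arch_pow_inv[of "min \<delta> (r / (6 * B))" "1 / 2"] \<delta> r B by auto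
  define \<eta> :: "nat \<Rightarrow> real" where "\<eta> k = (1 / 2) ^ (k + h)" for k
  have \<eta>0: "\<eta> 0 < \<delta>" "3 * B * \<eta> 0 < r / 2" using h B by (auto simp: \<eta>_def field_simps)
  have \<eta>pos: "\<eta> k > 0" for k by (simp add: \<eta>_def)
  have \<eta>Suc: "\<eta> (Suc k) = \<eta> k / 2" for k by (simp add: \<eta>_def)
  have \<eta>le: "\<eta> k \<le> \<eta> 0" for k unfolding \<eta>_def by (intro power_decreasing) auto
  obtain s0 where s0: "small (decode_matrix s0) (\<eta> 0)" "dist_less (decode_matrix s0) t0 (r / 2)"
    using approximate_by_decoded[OF small0[OF \<eta>pos[of 0]], of "r / 2"] r by auto
  \<comment> \<open>The radius grows by
    \<open>2 * B * \<eta> k - 2 * B * \<eta> (Suc k) = B * \<eta> k\<close> from step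
    \<open>k\<close> to the next, exactly the allowed displacement. The coefficient 3 makes the
    radius \<open>B * \<eta> 0\<close> at the start, so that the strict condition holds for
    \<open>s0\<close> itself.\<close>
  define G where "G k s \<longleftrightarrow> small (decode_matrix s) (\<eta> k) \<and>
     dist_less (decode_matrix s) (decode_matrix s0) (3 * B * \<eta> 0 - 2 * B * \<eta> k)" for k s
  define R where "R k s s' \<longleftrightarrow> dist_less (decode_matrix s') (decode_matrix s) (B * \<eta> k)" for k s s'
  have near_id: "near (map_of_matrix t) (\<lambda>x. x) (C3 * r)"
    if "\<And>i j. i < D \<Longrightarrow> j < D' \<Longrightarrow> \<bar>t i j - decode_matrix s0 i j\<bar> \<le> 3 * B * \<eta> 0" for t
  proof -
    have "\<bar>t i j - t0 i j\<bar> \<le> r" if "i < D" "j < D'" for i j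
      using \<open>\<And>i j. i < D \<Longrightarrow> j < D' \<Longrightarrow> \<bar>t i j - decode_matrix s0 i j\<bar> \<le> 3 * B * \<eta> 0\<close>[OF that]
        dist_lessD[OF s0(2) that] \<eta>0 by linarith
    then show ?thesis using C3(2)[OF r(1), of t t0] by (simp add: t0)
  qed
  have Grange: "\<bar>decode_matrix s i j - decode_matrix s0 i j\<bar> \<le> 3 * B * \<eta> 0" if "G k s" "i < D" "j < D'" for k s i j
  proof -
    have "dist_less (decode_matrix s) (decode_matrix s0) (3 * B * \<eta> 0 - 2 * B * \<eta> k)"
      using that unfolding G_def by blast
    from dist_lessD[OF this that(2,3)] show ?thesis using B \<eta>pos[of k] by (smt (verit) mult_pos_pos)
  qed
  have \<eta>_rat: "computable_rat (\<lambda>x. \<eta> (f x))" if "computable f" for f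
    unfolding \<eta>_def using that by (intro computable_rat_half_power computable_intros)
  have [simp]: "B \<in> \<rat>" "\<eta> k \<in> \<rat>" for k by (simp_all add: B_def \<eta>_def Rats_divide Rats_power)
  have "semidecidable (\<lambda>z. G (p1 z) (p2 z))" unfolding G_def small_def dist_less_def
    by (intro semidecidable_conj semidecidable_ball_abs_less finite_index finite_SigmaI finite_lessThan computable_real_on_cerr computable_real_on_diff
        computable_real_on_decode_matrix computable_real_on_rat computable_rat_diff computable_rat_times \<eta>_rat computable_intros; simp add: computable_rat_const Rats_mult)
  moreover have "semidecidable (\<lambda>z. R (p1 z) (p1 (p2 z)) (p2 (p2 z)))" unfolding R_def dist_less_def
    by (intro semidecidable_conj semidecidable_ball_abs_less finite_index finite_SigmaI finite_lessThan computable_real_on_cerr computable_real_on_diff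
        computable_real_on_decode_matrix computable_real_on_rat computable_rat_diff computable_rat_times \<eta>_rat computable_intros; simp add: computable_rat_const)
  moreover have "G 0 s0" using s0(1) B \<eta>pos[of 0] unfolding G_def dist_less_def by simp
  moreover have "\<exists>s'. G (Suc k) s' \<and> R k s s'" if G: "G k s" for k s
  proof -
    have "near (map_of_matrix (decode_matrix s)) (\<lambda>x. x) \<delta>"
      using near_mono[OF near_id r(2)] Grange[OF G] by blast
    then obtain s' where s': "small (decode_matrix s') (\<eta> k / 2)"
      "dist_less (decode_matrix s') (decode_matrix s) (A * \<eta> k)"
      using ref[of "\<eta> k" s] G \<eta>le[of k] \<eta>0(1) \<eta>pos[of k] unfolding G_def by fastforce
    have AB: "A * \<eta> k < B * \<eta> k" using B \<eta>pos by simp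
    have R: "R k s s'" using s'(2) AB unfolding R_def dist_less_def by force
    have "\<bar>decode_matrix s' i j - decode_matrix s0 i j\<bar> < 3 * B * \<eta> 0 - 2 * B * \<eta> (Suc k)" if "i < D" "j < D'" for i j
    proof -
      have "dist_less (decode_matrix s) (decode_matrix s0) (3 * B * \<eta> 0 - 2 * B * \<eta> k)"
        using G unfolding G_def by blast
      from dist_lessD[OF this that] dist_lessD[OF R[unfolded R_def] that]
      show ?thesis by (simp add: \<eta>Suc)
    qed
    then have "G (Suc k) s'" using s'(1) unfolding G_def dist_less_def \<eta>Suc by auto
    then show ?thesis using R by blast
  qed
  ultimately obtain g where g: "computable g" "\<And>k. G k (g k)" "\<And>k. R k (g k) (g (Suc k))"
    using semidecidable_dependent_choice[of G R s0] by blast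
  have "\<exists>l. \<forall>k. \<bar>l - decode_matrix (g k) i j\<bar> \<le> 2 * (B * \<eta> 0) * (1 / 2) ^ k" if "i < D" "j < D'" for i j
  proof (rule geometric_cauchy_limit)
    show "\<bar>decode_matrix (g (Suc k)) i j - decode_matrix (g k) i j\<bar> \<le> B * \<eta> 0 * (1 / 2) ^ k" for k
      using dist_lessD[OF g(3)[unfolded R_def] that, of k] by (simp add: \<eta>_def power_add mult_ac)
  qed
  then obtain t where t: "\<And>i j k. i < D \<Longrightarrow> j < D' \<Longrightarrow> \<bar>t i j - decode_matrix (g k) i j\<bar> \<le> 2 * (B * \<eta> 0) * (1 / 2) ^ k"
    by metis
  have lim: "(\<lambda>k. decode_matrix (g k) i j) \<longlonglongrightarrow> t i j" if "i < D" "j < D'" for i j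
  proof (rule LIM_zero_cancel, rule tendsto_rabs_zero_cancel,
      rule tendsto_sandwich[of "\<lambda>_. 0" _ _ "\<lambda>k. 2 * (B * \<eta> 0) * (1 / 2) ^ k"])
    show "\<forall>\<^sub>F k in sequentially. \<bar>decode_matrix (g k) i j - t i j\<bar> \<le> 2 * (B * \<eta> 0) * (1 / 2) ^ k"
      using t[OF that] by (simp add: abs_minus_commute)
    show "(\<lambda>k. 2 * (B * \<eta> 0) * (1 / 2) ^ k) \<longlonglongrightarrow> 0"
      by (intro tendsto_mult_right_zero LIMSEQ_power_zero) auto
  qed auto
  have "computable_real_on S (\<lambda>_. t i j)" if "i < D" "j < D'" for S i j
    using t[OF that] unfolding decode_matrix_def by (rule computable_real_on_limit[OF computable_component[OF g(1)]])
  moreover have "cerr t q = 0" if q: "q \<in> index" for q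
  proof -
    have "(\<lambda>k. cerr (decode_matrix (g k)) q) \<longlonglongrightarrow> cerr t q" by (intro tendsto_cerr q lim)
    moreover have "(\<lambda>k. cerr (decode_matrix (g k)) q) \<longlonglongrightarrow> 0"
    proof (rule tendsto_rabs_zero_cancel, rule tendsto_sandwich[of "\<lambda>_. 0" _ _ \<eta>])
      show "\<forall>\<^sub>F k in sequentially. \<bar>cerr (decode_matrix (g k)) q\<bar> \<le> \<eta> k"
        using g(2) q unfolding G_def small_def by (force intro: always_eventually less_imp_le)
      show "\<eta> \<longlonglongrightarrow> 0" unfolding \<eta>_def power_add by (intro tendsto_mult_left_zero LIMSEQ_power_zero) auto
    qed auto
    ultimately show ?thesis using LIMSEQ_unique by blast
  qed
  moreover have "near (map_of_matrix t) (\<lambda>x. x) (1 / 2)"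
  proof (rule near_mono[OF near_id r(3)])
    show "\<bar>t i j - decode_matrix s0 i j\<bar> \<le> 3 * B * \<eta> 0" if "i < D" "j < D'" for i j
    proof (rule tendsto_upperbound)
      show "(\<lambda>k. \<bar>decode_matrix (g k) i j - decode_matrix s0 i j\<bar>) \<longlonglongrightarrow> \<bar>t i j - decode_matrix s0 i j\<bar>"
        by (intro tendsto_intros lim that)
      show "\<forall>\<^sub>F k in sequentially. \<bar>decode_matrix (g k) i j - decode_matrix s0 i j\<bar> \<le> 3 * B * \<eta> 0"
        using Grange[OF g(2) that] by simp
    qed simp
  qed
  ultimately show ?thesis by blast
qed

section \<open>From the computable matrix to a computable isomorphism\<close>

lemma computable_isomorphism_exists: "\<exists>\<phi>. computable_isomorphism K sc star sc star P Q \<phi>"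
proof -
  obtain t where computable_real_on_t: "\<And>S i j. i < D \<Longrightarrow> j < D' \<Longrightarrow> computable_real_on S (\<lambda>_. t i j)"
    and t0: "\<And>q. q \<in> index \<Longrightarrow> cerr t q = 0" and nr: "near (map_of_matrix t) (\<lambda>x. x) (1 / 2)"
    using computable_automorphism by blast
  define \<phi> where "\<phi> = map_of_matrix t"
  have lin: "linear \<phi>" unfolding \<phi>_def by (rule linear_map_of_matrix)
  \<comment> \<open>Vanishing errors are \<open>small\<close> for every positive \<eta>, so the
    defect of \<phi> lies below every positive bound and is zero.\<close>
  obtain C where C: "C > 0" "\<And>\<eta>. \<eta> > 0 \<Longrightarrow> fd.defect_le \<phi> (C * \<eta>)"
    using small_defect t0 unfolding \<phi>_def small_def by (metis abs_zero)
  have "mult_defect \<phi> x y = 0" for x y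
    by (rule eq_zero_if_norm_le[OF _ C(1), of _ "norm x * norm y"]) (use C(2) in \<open>auto simp: fd.defect_le_def\<close>)
  then have \<phi>_mult: "\<phi> (x * y) = \<phi> x * \<phi> y" for x y by (simp add: mult_defect_def)
  have "\<phi> (star x) - star (\<phi> x) = 0" for x
    by (rule eq_zero_if_norm_le[OF _ C(1), of _ "norm x"]) (use C(2) in \<open>auto simp: fd.defect_le_def\<close>)
  then have \<phi>_star: "\<phi> (star x) = star (\<phi> x)" for x by simp
  have "\<phi> (J x) - J (\<phi> x) = 0" for x
    by (rule eq_zero_if_norm_le[OF _ C(1), of _ "norm x"]) (use C(2) in \<open>auto simp: fd.defect_le_def\<close>)
  then have \<phi>_J: "\<phi> (J x) = J (\<phi> x)" for x by simp
  have hom: "star_homomorphism K sc star sc star \<phi>"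
    unfolding star_homomorphism_def
    by (auto simp: \<phi>_mult \<phi>_star \<phi>_J sc_eq linear_add[OF lin] linear_scale[OF lin])
  \<comment> \<open>If \<open>\<phi> x = 0\<close>, nearness to the identity gives
    \<open>norm x \<le> norm x / 2\<close>.\<close>
  have "x = 0" if "\<phi> x = 0" for x
    using nearD[OF nr, of x] that by (simp add: \<phi>_def)
  then have "inj \<phi>" using linear_injective_0[OF lin] by blast
  then have bij: "bij \<phi>" using fd.linear_inj_surj[OF lin] by (simp add: bij_def)
  define V where "V = {k. rational_code K P k}"
  define L where "L = 1 + (\<Sum>j<D'. norm (n j))"
  have L: "L > 0" unfolding L_def by (intro add_pos_nonneg sum_nonneg) auto
  \<comment> \<open>Passing from coordinates to the norm costs a factor below \<open>2 ^ a\<close>,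
    so the coordinates are matched with \<open>a\<close> extra binary digits.\<close>
  obtain a :: nat where a: "L < 2 ^ a" using real_arch_pow[of 2 L] by auto
  define y where "y j k = co' j (\<phi> (rational_point sc star P k))" for j k
  have yV: "computable_real_on V (y j)" if "j < D'" for j
    unfolding y_def \<phi>_def co_map[OF that] V_def
    using that by (intro computable_real_on_sum computable_real_on_times computable_real_on_t coord_computable[OF basis_P P]) auto
  have "computable_real_on {z. p1 (p1 z) \<in> V} (\<lambda>z. y j (p1 (p1 z)) - rat_val (component j (p2 z)))" if "j < D'" for j
  proof (intro computable_real_on_diff computable_real_on_rat_val computable_component computable_intros)
    show "computable_real_on {z. p1 (p1 z) \<in> V} (\<lambda>z. y j (p1 (p1 z)))"
      by (rule computable_real_on_comp[OF yV[OF that]]) (simp_all add: computable_intros)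
  qed
  moreover have "computable_real_on {z. p1 (p1 z) \<in> V} (\<lambda>z. (1 / 2) ^ (p2 (p1 z) + a))"
    by (intro computable_real_on_rat computable_rat_half_power computable_intros)
  ultimately obtain W where W: "semidecidable W" "\<And>z. p1 (p1 z) \<in> V \<Longrightarrow> W z \<longleftrightarrow>
      (\<forall>j\<in>{..<D'}. \<bar>y j (p1 (p1 z)) - rat_val (component j (p2 z))\<bar> < (1 / 2) ^ (p2 (p1 z) + a))"
    using computable_real_on_ball_abs_less[of "{..<D'}" "{z. p1 (p1 z) \<in> V}" "\<lambda>j z. y j (p1 (p1 z)) - rat_val (component j (p2 z))"
        "\<lambda>z. (1 / 2) ^ (p2 (p1 z) + a)"] by auto
  \<comment> \<open>\<open>W\<close> is only meaningful when \<open>p1 x\<close> is a valid code.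
    For an invalid one any answer is accepted, so that the search is total.\<close>
  define Rel where "Rel x s \<longleftrightarrow> W (pr x s) \<or> \<not> rational_code K P (p1 x)" for x s
  have "semidecidable (\<lambda>z. Rel (p1 z) (p2 z))" unfolding Rel_def pr_p
    by (intro semidecidable_disj W(1) semidecidable_comp[OF semidecidable_not_rational_code[OF K_cases]] computable_intros)
  moreover have "\<exists>s. Rel x s" for x
  proof (cases "p1 x \<in> V")
    case True
    obtain s where "\<forall>j<D'. \<bar>y j (p1 x) - rat_val (component j s)\<bar> < (1 / 2) ^ (p2 x + a)"
      using component_dense[of "(1 / 2) ^ (p2 x + a)" D' "\<lambda>j. y j (p1 x)"] by auto
    then show ?thesis using W(2)[of "pr x s"] True by (auto simp: Rel_def)
  qed (auto simp: Rel_def V_def)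
  ultimately obtain g where g: "computable g" "\<And>x. Rel x (g x)" using semidecidable_choice[of Rel] by blast
  \<comment> \<open>Extending the code 0 of the empty polynomial always gives a valid code for
    \<open>Q\<close>, whatever number the search has returned.\<close>
  define f where "f k l = extend_code \<tau>' D' (g (pr k l)) 0" for k l
  have "effective f" unfolding effective_iff f_def pr_p
    by (intro computable_extend_code g(1) computable_const basis_cf[OF basis_Q])
  moreover have "rational_code K Q (f k l)" for k l
    unfolding f_def by (intro rational_code_extend[OF basis_Q] rational_code_0)
  moreover have "norm (\<phi> (rational_point sc star P k) - rational_point sc star Q (f k l)) < (1 / 2) ^ l"
    if k: "rational_code K P k" for k l
  proof -
    define s where "s = g (pr k l)"
    have "W (pr (pr k l) s)" using g(2)[of "pr k l"] k by (simp add: Rel_def s_def)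
    then have s: "\<bar>y j k - rat_val (component j s)\<bar> < (1 / 2) ^ (l + a)" if "j < D'" for j
      using W(2)[of "pr (pr k l) s"] k that by (simp add: V_def)
    define w where "w = \<phi> (rational_point sc star P k) - rational_point sc star Q (f k l)"
    have "co' j w = y j k - rat_val (component j s)" if "j < D'" for j
      using that by (simp add: w_def f_def s_def[symmetric] rational_point_extend[OF basis_Q] rational_point_0
          linear_diff[OF linQ] coord_sumQ y_def)
    then have "norm w \<le> (1 / 2) ^ (l + a) * (\<Sum>j<D'. norm (n j))"
      using s by (intro norm_le_coords) (simp add: less_imp_le)
    also have "\<dots> < (1 / 2) ^ (l + a) * 2 ^ a"
      using a by (intro mult_strict_left_mono) (auto simp: L_def)
    also have "\<dots> = (1 / 2) ^ l" by (simp add: power_add power_one_over)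
    finally show ?thesis by (simp add: w_def)
  qed
  ultimately have "computable_map K sc star sc star P Q \<phi>"
    unfolding computable_map_def by blast
  then show ?thesis using hom bij unfolding computable_isomorphism_def by blast
qed

end

theorem corollary5p9:
  fixes K :: "complex set"
    and sc :: "complex \<Rightarrow> 'a::{real_normed_algebra, banach} \<Rightarrow> 'a"
    and star :: "'a \<Rightarrow> 'a"
  assumes "K = \<real> \<or> K = UNIV"
    and "cstar_algebra K sc star TYPE('h::banach)"
    and "finite_dimensional_over K sc"
  shows "computably_categorical K sc star"
  unfolding computably_categorical_def
proof (intro allI impI)
  fix P Q :: "'a presentation"
  assume PQ: "computable_presentation K sc star P \<and> computable_presentation K sc star Q"
  obtain J \<epsilon> ip N e c where fd: "fd_cstar K sc star J \<epsilon> ip N e c"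
    using fd_cstar_exists[OF assms] by blast
  interpret fd_cstar K sc star J \<epsilon> ip N e c by (rule fd)
  obtain D m co \<tau> where P: "coded_basis P D m co \<tau>"
    using coded_basis_exists[of P] PQ unfolding computable_presentation_def by blast
  obtain D' n co' \<tau>' where Q: "coded_basis Q D' n co' \<tau>'"
    using coded_basis_exists[of Q] PQ unfolding computable_presentation_def by blast
  interpret two_bases K sc star J \<epsilon> ip N e c P Q D D' m n co co' \<tau> \<tau>'
    by (intro two_bases.intro two_bases_axioms.intro fd P Q PQ[THEN conjunct1] PQ[THEN conjunct2])
  show "\<exists>\<phi>. computable_isomorphism K sc star sc star P Q \<phi>"
    by (rule computable_isomorphism_exists)
qed

end
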